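(* Let $\ell=tp^n+k$ with integers $t\ge 0$, $1\le k\le p^n$, and suppose $\max(r+s-p^{n+1},0)+1\le\ell\le\min(r,s)$ and $m>0$. Assume that $t\le\min(r_n-1,s_n-1)$ and $M+1\le k\le p^n-\max(-e,0)$, and write $\mu=\mu_{m+M+1-k}$. Then $\lambda_\ell=(r_n+s_n-2t)p^n-\mu$; $(g-1)^{(r_n+s_n-2t-1)p^n}$ maps $D_{(r_n+s_n-t)p^n+R+S-k}$ to $D_{(t+1)p^n+R+S-k}$; and $(g-1)^{p^n-\mu-1}=(g-1)^{p^n+m+M-k_0-k_\infty}$ maps $D_{(t+1)p^n+R+S-k}$ to $D_{tp^n+k'}$. Let $C=J(R,p^n-S)=(c_{i,j})$ and $B=J(p^n-R,S)=(b_{i,j})$. Then the following hold. (1) Define $z_\ell\in D_{(t+1)p^n+R+S-k}$ by \[z_\ell=\sum_{i=0}^t(-1)^i\sum_{j=1}^{k-S}c_{k-S+1-j,j}\,v_{ip^n+R+S+j-k,\,(t+1-i)p^n+1-j}+(-1)^{R}\sum_{i=0}^t(-1)^i\sum_{j=1}^{k-R}b_{k-R+1-j,j}\,v_{(i+1)p^n+R+j-k,\,(t-i)p^n+S+1-j}.\] Then $(g-1)^{p^n-\mu-1}(z_\ell)=x_{tp^n+k'}$. (2) Let $P$ and $Q$ be the $(t+1)\times(t+1)$ matrices over $F$ with $(i,j)$ entries $\binom{r_n+s_n-2t-1}{r_n-t+j-i}$ and $\binom{r_n+s_n-2t-1}{r_n-t+j-i-1}$, respectively (both are invertible), let $X$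 be the $(t+1)\times1$ matrix with $(i,1)$ entry $(-1)^{i-1}$, and let $\zeta=P^{-1}X$ and $\eta=Q^{-1}X$. Define $y_\ell\in D_{(r_n+s_n-t)p^n+R+S-k}$ by \[y_\ell=\sum_{i=0}^t\zeta_{i+1,1}\sum_{j=1}^{k-S}c_{k-S+1-j,j}\,v_{(r_n-t+i)p^n+R+S+j-k,\,(s_n-i)p^n+1-j}+(-1)^{R}\sum_{i=0}^t\eta_{i+1,1}\sum_{j=1}^{k-R}b_{k-R+1-j,j}\,v_{(r_n-t+i)p^n+R+j-k,\,(s_n-i)p^n+S+1-j}.\] Then $(g-1)^{(r_n+s_n-2t-1)p^n}(y_\ell)=z_\ell$.
   Context: $p$ is a prime, $F$ a field of characteristic $p$, $G=\langle g\rangle$ a cyclic group of order $q=p^a$ ($a$ a positive integer). $V_q$ is the indecomposable $FG$-module of dimension $q$, with ordered $F$-basis $(v_1,\dots,v_q)$ such that $gv_1=v_1$ and $gv_i=v_{i-1}+v_i$ for $i>1$; $V_i=\langle v_1,\dots,v_i\rangle$, and $V_1,\dots,V_q$ is a complete set of indecomposable $FG$-modules. Let $1\le r,s\le q$ and write $V_r\otimes V_s\cong V_{\lambda_1}\oplus\dots\oplus V_{\lambda_{\min(r,s)}}$ with $\lambda_1\ge\dots\ge\lambda_{\min(r,s)}>0$. Let $n$ be the unique nonnegative integer with $p^n\le\max(r,s)<p^{n+1}$, and write $r=r_np^n+R$, $s=s_np^n+S$ with integers $0\le r_n,s_n<p$ and $0\le R,S<p^n$ (the paper writes $R_{n-1},S_{n-1}$).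 Put $m=\min(R,S)$, $M=\max(R,S)$ and $e=m+M-p^n$. When $m>0$ write $V_R\otimes V_S\cong V_{\mu_1}\oplus\dots\oplus V_{\mu_m}$ with $\mu_1\ge\dots\ge\mu_m>0$. For $M+1\le k\le p^n-\max(-e,0)$, let $k_0$ and $k_\infty$ be, respectively, the minimum and the maximum of the set of $i$ with $M+1\le i\le p^n-\max(-e,0)$ and $\mu_{m+M+1-i}=\mu_{m+M+1-k}$, and put $k'=k_0+k_\infty-k$. The elements $v_{i,j}=v_i\otimes g^{n-i}v_j$ ($1\le i\le r$, $1\le j\le s$) form a basis of $V_r\otimes V_s$ satisfying $(g-1)v_{i,j}=v_{i-1,j}+v_{i,j-1}$, with $v_{i,j}=0$ if $i\le0$ or $j\le0$. Put $D_d=\langle v_{i,j}\mid i+j=d+1\rangle$ for $1\le d\le r+s-1$ and $x_d=\sum_{i=1}^d(-1)^{i-1}v_{i,d+1-i}$ for $1\le d\le\min(r,s)$. Binomial coefficients $\binom cd$ are $0$ if $d<0$ or $d>c$, and are regarded as elements of $F$. Definition of the $r\times s$ matrix $J(r,s)$ over $F$, for any $1\le r,s\le q$ (with $\lambda_\ell$, $v_{i,j}$, $D_d$, $x_d$ taken for that pair $(r,s)$; any fixed integer $n$ in the exponent defining $v_{i,j}$ may be used). For $1\le\ell\le\min(r,s)$ let $\ell_0=\min\{i\mid\lambda_i=\lambda_\ell\}$. (i) If $\ell=\ell_0$, the entries $J(r,s)_{\ell+1-j,j}$, $1\le j\le\ell$, are the coefficients of the unique element $y=\sum_{j=1}^{\ell}J(r,s)_{\ell+1-j,j}\,v_{r-\ell+j,s+1-j}\in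 D_{r+s-\ell}$ with $(g-1)^{\lambda_\ell-1}(y)=x_{r+s+1-\ell-\lambda_\ell}$ (existence and uniqueness hold). (ii) If $\ell>\ell_0$, then $J(r,s)_{\ell+1-j,j}=(-1)^{\ell-\ell_0}J(r,s)_{\ell_0+1-j,j}$ for $1\le j\le\ell_0$ and $J(r,s)_{\ell+1-j,j}=0$ for $\ell_0<j\le\ell$. (iii) $J(r,s)_{i,j}=0$ if $i+j-1>\min(r,s)$. *)

theory Defs
  imports
    "HOL-Library.Function_Algebras"
    "HOL-Algebra.Elementary_Groups"
    "Jordan_Normal_Form.Gauss_Jordan_Elimination"
begin

text \<open>
  Vectors are coordinate functions \<open>'i \<Rightarrow> 'f\<close> over a field \<open>'f\<close>, with addition from
  \<^theory>\<open>HOL-Library.Function_Algebras\<close>. Throughout, \<open>G\<close> is a cyclic group with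
  generator \<open>g\<close> and \<open>order G\<close> is the power \<open>q\<close> of the characteristic.
\<close>

definition fscale :: "'f::field \<Rightarrow> ('i \<Rightarrow> 'f) \<Rightarrow> 'i \<Rightarrow> 'f"  (infixr \<open>*\<^sub>f\<close> 75)
  where "c *\<^sub>f u = (\<lambda>i. c * u i)"

interpretation fspace: vector_space "fscale :: 'f::field \<Rightarrow> ('i \<Rightarrow> 'f) \<Rightarrow> 'i \<Rightarrow> 'f"
  by unfold_locales (auto simp: fscale_def fun_eq_iff algebra_simps)

definition bvec :: "'i \<Rightarrow> 'i \<Rightarrow> 'f::field"
  where "bvec i = (\<lambda>k. if k = i then 1 else 0)"


section \<open>Modules for a cyclic group\<close>

record ('g, 'v) fgmod =
  mcarrier :: "'v set"
  maction :: "'g \<Rightarrow> 'v \<Rightarrow> 'v"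

definition fgmod_iso ::
    "('g, 'b) monoid_scheme \<Rightarrow> ('g, 'i \<Rightarrow> 'f::field) fgmod \<Rightarrow> ('g, 'j \<Rightarrow> 'f) fgmod \<Rightarrow> bool"
  where "fgmod_iso G M N \<longleftrightarrow>
    (\<exists>\<phi>. bij_betw \<phi> (mcarrier M) (mcarrier N) \<and>
      (\<forall>u \<in> mcarrier M. \<forall>w \<in> mcarrier M. \<phi> (u + w) = \<phi> u + \<phi> w) \<and>
      (\<forall>c. \<forall>u \<in> mcarrier M. \<phi> (c *\<^sub>f u) = c *\<^sub>f \<phi> u) \<and>
      (\<forall>h \<in> carrier G. \<forall>u \<in> mcarrier M. \<phi> (maction M h u) = maction N h (\<phi> u)))"

text \<open>The linear extension of \<open>v\<^sub>1 \<mapsto> v\<^sub>1\<close>, \<open>v\<^sub>i \<mapsto> v\<^sub>i\<^sub>-\<^sub>1 + v\<^sub>i\<close> for \<open>1 < i \<le> q\<close>.\<close>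

definition gen_map :: "nat \<Rightarrow> (nat \<Rightarrow> 'f::field) \<Rightarrow> nat \<Rightarrow> 'f"
  where "gen_map q u =
    (\<Sum>i = 1..q. u i *\<^sub>f (if i = 1 then bvec 1 else bvec (i - 1) + bvec i))"

text \<open>The action of \<open>h = g\<^sup>k\<close> on \<open>V\<^sub>q\<close> is the \<open>k\<close>-th power of the action of \<open>g\<close>.
  This does not depend on \<open>k\<close>, as the \<open>q\<close>-th power of the action of \<open>g\<close> is the identity
  on \<open>V\<^sub>q\<close>; we take the least \<open>k\<close>.\<close>

definition vact :: "('g, 'b) monoid_scheme \<Rightarrow> 'g \<Rightarrow> 'g \<Rightarrow> (nat \<Rightarrow> 'f::field) \<Rightarrow> nat \<Rightarrow> 'f"
  where "vact G g h = gen_map (order G) ^^ (LEAST k. g [^]\<^bsub>G\<^esub> (k::nat) = h)"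

text \<open>\<open>V\<^sub>r \<le> V\<^sub>q\<close>, the submodule spanned by \<open>v\<^sub>1, \<dots>, v\<^sub>r\<close>; meaningful for \<open>r \<le> q\<close>.\<close>

definition Vmod :: "('g, 'b) monoid_scheme \<Rightarrow> 'g \<Rightarrow> nat \<Rightarrow> ('g, nat \<Rightarrow> 'f::field) fgmod"
  where "Vmod G g r = \<lparr>mcarrier = fspace.span (bvec ` {1..r}), maction = vact G g\<rparr>"

definition tensor :: "(nat \<Rightarrow> 'f::field) \<Rightarrow> (nat \<Rightarrow> 'f) \<Rightarrow> nat \<times> nat \<Rightarrow> 'f"  (infixr \<open>\<otimes>\<^sub>v\<close> 77)
  where "u \<otimes>\<^sub>v w = (\<lambda>(i, j). u i * w j)"

text \<open>The diagonal action on \<open>V\<^sub>q \<otimes> V\<^sub>q\<close>: the linear extension of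
  \<open>v\<^sub>i \<otimes> v\<^sub>j \<mapsto> h v\<^sub>i \<otimes> h v\<^sub>j\<close>.\<close>

definition tact :: "('g, 'b) monoid_scheme \<Rightarrow> 'g \<Rightarrow> 'g \<Rightarrow> (nat \<times> nat \<Rightarrow> 'f::field) \<Rightarrow> nat \<times> nat \<Rightarrow> 'f"
  where "tact G g h w =
    (\<Sum>i = 1..order G. \<Sum>j = 1..order G. w (i, j) *\<^sub>f (vact G g h (bvec i) \<otimes>\<^sub>v vact G g h (bvec j)))"

definition Vtensor :: "('g, 'b) monoid_scheme \<Rightarrow> 'g \<Rightarrow> nat \<Rightarrow> nat \<Rightarrow> ('g, nat \<times> nat \<Rightarrow> 'f::field) fgmod"
  where "Vtensor G g r s =
    \<lparr>mcarrier = fspace.span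
        {u \<otimes>\<^sub>v w |u w. u \<in> mcarrier (Vmod G g r :: ('g, nat \<Rightarrow> 'f) fgmod) \<and>
                    w \<in> mcarrier (Vmod G g s :: ('g, nat \<Rightarrow> 'f) fgmod)},
     maction = tact G g\<rparr>"

text \<open>Partitions are lists; \<open>part xs i\<close> is the \<open>i\<close>-th part, counted from 1.\<close>

definition part :: "nat list \<Rightarrow> nat \<Rightarrow> nat"
  where "part xs i = xs ! (i - 1)"

text \<open>\<open>V\<^bsub>part xs 1\<^esub> \<oplus> \<dots> \<oplus> V\<^bsub>part xs (length xs)\<^esub>\<close>; the \<open>l\<close>-th component of
  \<open>u\<close> is \<open>\<lambda>i. u (l, i)\<close>.\<close>

definition Vsum :: "('g, 'b) monoid_scheme \<Rightarrow> 'g \<Rightarrow> nat list \<Rightarrow> ('g, nat \<times> nat \<Rightarrow> 'f::field) fgmod"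
  where "Vsum G g xs =
    \<lparr>mcarrier = {u. \<forall>l. (\<lambda>i. u (l, i)) \<in>
        (if l \<in> {1..length xs} then mcarrier (Vmod G g (part xs l)) else {0})},
     maction = (\<lambda>h u (l, i). vact G g h (\<lambda>i'. u (l, i')) i)\<rparr>"

definition decomposes_as ::
    "('g, 'b) monoid_scheme \<Rightarrow> 'g \<Rightarrow> ('g, 'i \<Rightarrow> 'f::field) fgmod \<Rightarrow> nat list \<Rightarrow> bool"
  where "decomposes_as G g M xs \<longleftrightarrow>
    sorted_wrt (\<ge>) xs \<and> set xs \<subseteq> {1..order G} \<and> fgmod_iso G M (Vsum G g xs)"

definition parts_of :: "('g, 'b) monoid_scheme \<Rightarrow> 'g \<Rightarrow> ('g, 'i \<Rightarrow> 'f::field) fgmod \<Rightarrow> nat list"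
  where "parts_of G g M = (THE xs. decomposes_as G g M xs)"


section \<open>The graded basis of the tensor product\<close>

definition gm1 :: "('g, 'b) monoid_scheme \<Rightarrow> 'g \<Rightarrow> (nat \<times> nat \<Rightarrow> 'f::field) \<Rightarrow> nat \<times> nat \<Rightarrow> 'f"
  where "gm1 G g w = tact G g g w - w"

text \<open>In the next definitions \<open>\<nu>\<close> is the fixed integer in the exponent of
  \<open>v\<^sub>i\<^sub>,\<^sub>j = v\<^sub>i \<otimes> g\<^bsup>\<nu>-i\<^esup> v\<^sub>j\<close>.\<close>

definition tvec :: "('g, 'b) monoid_scheme \<Rightarrow> 'g \<Rightarrow> int \<Rightarrow> int \<Rightarrow> int \<Rightarrow> nat \<times> nat \<Rightarrow> 'f::field"
  where "tvec G g \<nu> i j =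
    (if i \<le> 0 \<or> j \<le> 0 then 0
     else bvec (nat i) \<otimes>\<^sub>v vact G g (g [^]\<^bsub>G\<^esub> (\<nu> - i)) (bvec (nat j)))"

definition Dspace :: "('g, 'b) monoid_scheme \<Rightarrow> 'g \<Rightarrow> int \<Rightarrow> nat \<Rightarrow> nat \<Rightarrow> int \<Rightarrow> (nat \<times> nat \<Rightarrow> 'f::field) set"
  where "Dspace G g \<nu> r s d =
    fspace.span {tvec G g \<nu> i j |i j. i \<in> {1..int r} \<and> j \<in> {1..int s} \<and> i + j = d + 1}"

definition xvec :: "('g, 'b) monoid_scheme \<Rightarrow> 'g \<Rightarrow> int \<Rightarrow> int \<Rightarrow> nat \<times> nat \<Rightarrow> 'f::field"
  where "xvec G g \<nu> d = (\<Sum>i = 1..d. (- 1) ^ nat (i - 1) *\<^sub>f tvec G g \<nu> i (d + 1 - i))"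


section \<open>The matrices J(r,s)\<close>

text \<open>\<open>ent\<close> and \<open>mat1\<close> read and build matrices with indices starting at 1.\<close>

definition ent :: "'a mat \<Rightarrow> nat \<Rightarrow> nat \<Rightarrow> 'a"
  where "ent A i j = A $$ (i - 1, j - 1)"

definition mat1 :: "nat \<Rightarrow> nat \<Rightarrow> (nat \<Rightarrow> nat \<Rightarrow> 'a) \<Rightarrow> 'a mat"
  where "mat1 r s f = mat r s (\<lambda>(i, j). f (i + 1) (j + 1))"

text \<open>The coordinates \<open>c 1, \<dots>, c l\<close> of the unique
  \<open>y = (\<Sum>j = 1..l. c j v\<^bsub>r-l+j, s+1-j\<^esub>)\<close> in \<open>D\<^bsub>r+s-l\<^esub>\<close> with
  \<open>(g - 1)\<^bsup>\<lambda>-1\<^esup> y = x\<^bsub>r+s+1-l-\<lambda>\<^esub>\<close>, where \<open>\<lambda>\<close> is the \<open>l\<close>-th part of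
  \<open>V\<^sub>r \<otimes> V\<^sub>s\<close>. The vectors in this sum are all the basis vectors of \<open>D\<^bsub>r+s-l\<^esub>\<close>.\<close>

definition Jcoeffs :: "('g, 'b) monoid_scheme \<Rightarrow> 'g \<Rightarrow> int \<Rightarrow> nat \<Rightarrow> nat \<Rightarrow> nat \<Rightarrow> nat \<Rightarrow> 'f::field"
  where "Jcoeffs G g \<nu> r s l =
    (let lam_l = part (parts_of G g (Vtensor G g r s :: ('g, nat \<times> nat \<Rightarrow> 'f) fgmod)) l in
     (THE c. (\<forall>j. j \<notin> {1..l} \<longrightarrow> c j = 0) \<and>
       (gm1 G g ^^ (lam_l - 1))
         (\<Sum>j = 1..l. c j *\<^sub>f tvec G g \<nu> (int r - int l + int j) (int s + 1 - int j)) =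
       xvec G g \<nu> (int r + int s + 1 - int l - int lam_l)))"

definition Jmat :: "('g, 'b) monoid_scheme \<Rightarrow> 'g \<Rightarrow> int \<Rightarrow> nat \<Rightarrow> nat \<Rightarrow> 'f::field mat"
  where "Jmat G g \<nu> r s =
    (let lam = part (parts_of G g (Vtensor G g r s :: ('g, nat \<times> nat \<Rightarrow> 'f) fgmod)) in
     mat1 r s (\<lambda>i j.
       let l = i + j - 1; l0 = Min {i' \<in> {1..min r s}. lam i' = lam l} in
       if l > min r s then 0
       else if l = l0 then Jcoeffs G g \<nu> r s l j
       else if j \<le> l0 then (- 1) ^ (l - l0) * Jcoeffs G g \<nu> r s l0 j
       else 0))"


section \<open>Binomial coefficients in a field\<close>

definition binom :: "int \<Rightarrow> int \<Rightarrow> 'f::field"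
  where "binom c d = (if d < 0 \<or> d > c then 0 else of_nat (nat c choose nat d))"

end

theory Submission
  imports "HOL-Algebra.Multiplicative_Group" "Jordan_Normal_Form.Determinant" Defs
begin

text \<open>
  In the basis \<open>v\<^sub>i\<^sub>,\<^sub>j\<close> the module \<open>V\<^sub>r \<otimes> V\<^sub>s\<close> is \<open>F[x, y]/(x\<^sup>r, y\<^sup>s)\<close> with
  \<open>v\<^sub>i\<^sub>,\<^sub>j = x\<^sup>r\<^sup>-\<^sup>i y\<^sup>s\<^sup>-\<^sup>j\<close>, graded by degree, and \<open>g - 1\<close> is multiplication by
  \<open>T = x + y\<close>. Call \<open>a\<close> regular if \<open>T\<^bsup>r+s-2a\<^esup>\<close> is injective on forms of degree \<open>a - 1\<close>. Between
  consecutive regular indices \<open>a < b\<close> a single form of degree \<open>a\<close> reaches \<open>x\<^sub>b\<close>, and its multiples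
  by powers of \<open>x\<close> give \<open>b - a\<close> Jordan blocks of the same size \<open>r + s - a - b\<close>.

  Put \<open>q = p\<^sup>n\<close>, so \<open>T\<^sup>q = x\<^sup>q + y\<^sup>q\<close>. A relation \<open>T\<^sup>\<mu> f = x\<^sup>R A + y\<^sup>S B\<close> then entails
  \<open>x\<^sup>q\<^sup>-\<^sup>R f = T\<^sup>q\<^sup>-\<^sup>\<mu> A + y\<^sup>S h\<close>, \<open>T\<^sup>q\<^sup>-\<^sup>\<mu> B = y\<^sup>q\<^sup>-\<^sup>S f + x\<^sup>R h\<close> and
  \<open>T\<^sup>\<mu> h = x\<^sup>q\<^sup>-\<^sup>R B - y\<^sup>q\<^sup>-\<^sup>S A\<close>. Hence blocks of \<open>(R, S)\<close> correspond to blocks of \<open>(q-R, S)\<close> and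
  \<open>(R, q-S)\<close>, whose generators \<open>A\<close> and \<open>B\<close> are the rows of the matrices \<open>J\<close>. Up to a unit \<open>z\<^sub>\<ell>\<close> is
  \<open>(\<Sum>\<^sub>i (-1)\<^sup>i x\<^sup>(\<^sup>t\<^sup>-\<^sup>i\<^sup>)\<^sup>q y\<^sup>i\<^sup>q) T\<^sup>\<mu> h\<close>, so that \<open>T\<^sup>q\<^sup>-\<^sup>\<mu>\<^sup>-\<^sup>1\<close> turns it into an alternating sum,
  and the passage from \<open>y\<^sub>\<ell>\<close> to \<open>z\<^sub>\<ell>\<close> is a linear system in \<open>x\<^sup>q, y\<^sup>q\<close> with matrices \<open>P\<close> and \<open>Q\<close>.
  Finally \<open>\<lambda>\<^sub>\<ell>\<close> is read off because \<open>y\<^sub>\<ell>\<close> for the first \<open>\<ell>\<close> of the block does not vanish at \<open>x = -y\<close>,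
  that is, it does not lie in the image of \<open>T\<close>.
\<close>

hide_const (open) Polynomial.order

section \<open>Homogeneous elements as univariate polynomials\<close>

text \<open>Setting \<open>y = 1\<close> turns a form of known degree into a polynomial in
  \<open>x\<close>; the quotient by \<open>(x^r, y^s)\<close> then becomes the restriction to a
  window of coefficients. Multiplication by \<open>T\<close> is self-adjoint for the pairing that
  reads the coefficient of \<open>x^(r-1) y^(s-1)\<close>, and this is why regularity passes from
  the start of a string to its end. Parts are specified through abstract isomorphisms, so uniqueness
  of the decomposition must be proved before a block size can be named. The hypotheses on
  \<open>k\<close> place \<open>R + S + 1 - k\<close> among the indices of \<open>(R, S)\<close>
  that can be reflected to both complementary pairs. The lower bound on \<open>l\<close> amounts to
  \<open>rn + sn < p + t\<close>. This makes \<open>P\<close> and \<open>Q\<close> invertible: they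
  are the matrices of a power of \<open>T\<close> for the pairs \<open>(rn + 1, sn)\<close> and
  \<open>(rn, sn + 1)\<close>, and in these degrees characteristic \<open>p\<close> behaves like
  characteristic 0. The sign \<open>(-1)^R\<close> arises when two coefficients of one syzygy are
  compared.\<close>

definition deg_lt :: "nat \<Rightarrow> 'f::zero poly \<Rightarrow> bool"
  where "deg_lt a F \<longleftrightarrow> (\<forall>i\<ge>a. coeff F i = 0)"

text \<open>A polynomial \<open>F\<close> stands for the element \<open>\<Sum>\<^sub>e coeff F e v\<^bsub>r-e, b+1-r+e\<^esub>\<close> of \<open>D\<^sub>b\<close>, in which terms
  with a nonpositive index are \<open>0\<close>; \<open>alt_on r b c F\<close> says that this element is \<open>c x\<^sub>b\<close>.\<close>

definition alt_on :: "nat \<Rightarrow> nat \<Rightarrow> 'f::field \<Rightarrow> 'f poly \<Rightarrow> bool"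
  where "alt_on r b c F \<longleftrightarrow> (\<forall>i<r. r \<le> i + b \<longrightarrow> coeff F i = c * (- 1) ^ (r - 1 - i))"

text \<open>The form \<open>x + y\<close> at \<open>y = 1\<close>; its root -1 is where divisibility
  by \<open>T\<close> is tested.\<close>

definition T1 :: "'f::field poly" where "T1 = [:1, 1:]"

lemma T1_neq_0 [simp]: "T1 \<noteq> 0"
  by (simp add: T1_def)

lemma poly_T1 [simp]: "poly T1 x = 1 + x"
  by (simp add: T1_def)

lemma deg_lt_mono: "deg_lt a F \<Longrightarrow> a \<le> b \<Longrightarrow> deg_lt b F"
  by (auto simp: deg_lt_def)

lemma deg_lt_Suc_iff: "deg_lt (Suc a) F \<longleftrightarrow> degree F \<le> a"
  by (auto simp: deg_lt_def coeff_eq_0 Suc_le_eq intro: degree_le)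

text \<open>Index 0 gives the zero space, which a bound on \<open>degree\<close> cannot express; the
  forms bounded by \<open>a\<close> thus have dimension \<open>a\<close> also for
  \<open>a = 0\<close>.\<close>

lemma deg_lt_0_iff: "deg_lt 0 F \<longleftrightarrow> F = 0"
  by (auto simp: deg_lt_def poly_eq_iff)

lemma deg_lt_zero [simp]: "deg_lt a 0"
  by (simp add: deg_lt_def)

lemma deg_lt_add: "deg_lt a F \<Longrightarrow> deg_lt a G \<Longrightarrow> deg_lt a (F + G)"
  by (auto simp: deg_lt_def)

lemma deg_lt_diff: "deg_lt a F \<Longrightarrow> deg_lt a G \<Longrightarrow> deg_lt a (F - G)"
  for F :: "'f::ab_group_add poly"
  by (auto simp: deg_lt_def)

lemma deg_lt_smult: "deg_lt a F \<Longrightarrow> deg_lt a (smult c F)"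
  by (auto simp: deg_lt_def)

lemma deg_lt_mult:
  assumes "deg_lt a F" "degree G \<le> d" "a + d \<le> b"
  shows "deg_lt b (G * F)"
proof (cases a)
  case 0
  then show ?thesis using assms by (simp add: deg_lt_0_iff)
next
  case (Suc a')
  then have "degree F \<le> a'" using assms by (simp add: deg_lt_Suc_iff)
  then have "degree (G * F) \<le> d + a'"
    using degree_mult_le[of G F] assms by linarith
  then have "deg_lt (Suc (d + a')) (G * F)"
    by (simp add: deg_lt_Suc_iff)
  then show ?thesis by (rule deg_lt_mono) (use assms Suc in simp)
qed

lemma degree_T1_power: "degree (T1 ^ c :: 'f::field poly) = c"
  by (simp add: degree_power_eq T1_def)

lemma deg_lt_T1_power: "deg_lt a F \<Longrightarrow> a + c \<le> b \<Longrightarrow> deg_lt b (T1 ^ c * F)"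
  by (rule deg_lt_mult[where d = c]) (simp_all add: degree_T1_power)

lemma deg_lt_monom: "deg_lt a F \<Longrightarrow> a + c \<le> b \<Longrightarrow> deg_lt b (monom 1 c * F)"
  for F :: "'f::field poly"
  by (rule deg_lt_mult[where d = c]) (simp_all add: degree_monom_eq)

lemma coeff_T1_mult: "coeff (T1 * F) i = coeff F i + (if i = 0 then 0 else coeff F (i - 1))"
  for F :: "'f::field poly"
  by (cases i) (auto simp: T1_def)

lemma coeff_monom_mult': "coeff (monom 1 k * F) i = (if k \<le> i then coeff F (i - k) else 0)"
  for F :: "'f::field poly"
  by (simp add: coeff_monom_mult)

lemma poly_minus_one_monom [simp]: "poly (monom 1 k) (- 1 :: 'f::field) = (- 1) ^ k"
  by (simp add: poly_monom)

text \<open>In degrees where the truncation by \<open>x^r\<close> and \<open>y^s\<close> does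
  nothing, evaluation at -1 is reduction modulo \<open>T\<close>: vanishing there means lying in the
  image of \<open>g - 1\<close>, and the quotient loses one degree.\<close>

lemma poly_minus_one_eq_0E:
  fixes F :: "'f::field poly"
  assumes "poly F (- 1) = 0" "deg_lt (Suc a) F"
  obtains G where "F = T1 * G" "deg_lt a G"
proof -
  have "[:- (- 1), 1:] dvd F" using assms(1) by (simp only: poly_eq_0_iff_dvd)
  then obtain G where G: "F = T1 * G" by (auto simp: T1_def elim: dvdE)
  have "deg_lt a G"
  proof (cases "G = 0")
    case False
    have "degree F = Suc (degree G)" unfolding G using False by (subst degree_mult_eq) (auto simp: T1_def)
    then have "degree G < a" using assms(2) by (simp add: deg_lt_Suc_iff)
    then show ?thesis by (auto simp: deg_lt_def intro: coeff_eq_0)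
  qed simp
  then show ?thesis using G that by blast
qed

lemma T1_power_mult_eq_0D: "T1 ^ c * F = 0 \<Longrightarrow> F = 0" for F :: "'f::field poly"
  by simp

section \<open>Windows of alternating coefficients\<close>

lemma alt_on_add: "alt_on r b c F \<Longrightarrow> alt_on r b d G \<Longrightarrow> alt_on r b (c + d) (F + G)"
  by (auto simp: alt_on_def algebra_simps)

lemma alt_on_diff: "alt_on r b c F \<Longrightarrow> alt_on r b d G \<Longrightarrow> alt_on r b (c - d) (F - G)"
  by (auto simp: alt_on_def algebra_simps)

lemma alt_on_smult: "alt_on r b c F \<Longrightarrow> alt_on r b (d * c) (smult d F)"
  by (auto simp: alt_on_def algebra_simps)

lemma alt_on_zero [simp]: "alt_on r b 0 0"
  by (auto simp: alt_on_def)

lemma alt_on_unique: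
  assumes "alt_on r b c F" "alt_on r b d F" "0 < b" "0 < r"
  shows "c = d"
proof -
  have "coeff F (r - 1) = c"
    using assms(1)[unfolded alt_on_def, rule_format, of "r - 1"] assms(3,4) by simp
  moreover have "coeff F (r - 1) = d"
    using assms(2)[unfolded alt_on_def, rule_format, of "r - 1"] assms(3,4) by simp
  ultimately show ?thesis by simp
qed

text \<open>Coefficient \<open>i\<close> of the product uses only the coefficients
  \<open>i - d, ..., i\<close> of \<open>F\<close>, so the lower end of the window moves up by
  \<open>d\<close>.\<close>

lemma alt_on_0_mult:
  fixes F G :: "'f::field poly"
  assumes "alt_on r b 0 F" "degree G \<le> d" "b' + d \<le> b"
  shows "alt_on r b' 0 (G * F)"
  unfolding alt_on_def
proof (intro allI impI)
  fix i assume i: "i < r" "r \<le> i + b'"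
  have "coeff G j * coeff F (i - j) = 0" if "j \<le> i" for j
  proof (cases "j \<le> d")
    case True
    then have "coeff F (i - j) = 0" using assms i that by (auto simp: alt_on_def)
    then show ?thesis by simp
  next
    case False
    then show ?thesis using assms(2) by (simp add: coeff_eq_0)
  qed
  then have "coeff (G * F) i = 0"
    unfolding coeff_mult by (intro sum.neutral) auto
  then show "coeff (G * F) i = 0 * (- 1) ^ (r - 1 - i)" by simp
qed

lemma alt_on_0_T1_power: "alt_on r b 0 F \<Longrightarrow> b' + c \<le> b \<Longrightarrow> alt_on r b' 0 (T1 ^ c * F)"
  by (rule alt_on_0_mult[where d = c]) (simp_all add: degree_T1_power)

lemma alt_on_T1:
  fixes F :: "'f::field poly"
  assumes "alt_on r (Suc b) c F" "Suc b \<le> r"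
  shows "alt_on r b 0 (T1 * F)"
  unfolding alt_on_def
proof (intro allI impI)
  fix i assume i: "i < r" "r \<le> i + b"
  then have "coeff F i = c * (- 1) ^ (r - 1 - i)" "i \<noteq> 0"
    "coeff F (i - 1) = c * (- 1) ^ (Suc (r - 1 - i))"
    using assms by (auto simp: alt_on_def Suc_diff_Suc)
  then show "coeff (T1 * F) i = 0 * (- 1) ^ (r - 1 - i)"
    unfolding coeff_T1_mult by simp
qed

text \<open>In the module \<open>x\<close> takes \<open>v_{i,j}\<close> to \<open>v_{i-1,j}\<close>,
  hence \<open>x_{b+d}\<close> goes to \<open>(-1)^d x_b\<close> under \<open>x^d\<close>. The signs
  in the non-leading rows of \<open>J\<close> compensate for this.\<close>

lemma alt_on_monom:
  fixes F :: "'f::field poly"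
  assumes "alt_on r (b + d) c F" "b + d \<le> r"
  shows "alt_on r b ((- 1) ^ d * c) (monom 1 d * F)"
  unfolding alt_on_def
proof (intro allI impI)
  fix i assume i: "i < r" "r \<le> i + b"
  then have "coeff F (i - d) = c * (- 1) ^ (r - 1 - (i - d))" "d \<le> i"
    using assms by (auto simp: alt_on_def)
  moreover have "r - 1 - (i - d) = (r - 1 - i) + d" using i assms by auto
  ultimately show "coeff (monom 1 d * F) i = (- 1) ^ d * c * (- 1) ^ (r - 1 - i)"
    unfolding coeff_monom_mult' by (simp add: power_add)
qed

text \<open>The equations \<open>F_i + F_{i-1} = 0\<close> determine the window from its top
  coefficient, so the kernel of \<open>T\<close> on \<open>D_b\<close> is at most a line. If
  \<open>b > s\<close>, the degree bound kills the top coefficient; if \<open>b > r\<close>, the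
  chain runs down to the constant term, which \<open>T1 * F\<close> reproduces unchanged.\<close>

lemma alt_on_T1_kernel:
  fixes F :: "'f::field poly"
  assumes F: "deg_lt (r + s - b) F" and T: "alt_on r (b - 1) 0 (T1 * F)"
    and "0 < b" "0 < r" "0 < s"
  obtains c where "alt_on r b c F" "c \<noteq> 0 \<Longrightarrow> b \<le> min r s"
proof -
  define c where "c = coeff F (r - 1)"
  have step: "coeff F i + coeff F (i - 1) = 0" if "0 < i" "i < r" "r \<le> i + (b - 1)" for i
    using T[unfolded alt_on_def coeff_T1_mult, rule_format, of i] that by simp
  have alt: "j < b \<longrightarrow> coeff F (r - 1 - j) = c * (- 1) ^ j" if "j < r" for j
    using that
  proof (induction j)
    case (Suc j)
    show ?case
    proof
      assume "Suc j < b"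
      then have "coeff F (r - 1 - j) + coeff F (r - 1 - j - 1) = 0"
        using Suc.prems by (intro step) auto
      then show "coeff F (r - 1 - Suc j) = c * (- 1) ^ Suc j"
        using Suc \<open>Suc j < b\<close> by (simp add: add_eq_0_iff2) (metis minus_minus)
    qed
  qed (simp add: c_def)
  have "alt_on r b c F"
    unfolding alt_on_def
  proof (intro allI impI)
    fix i assume "i < r" "r \<le> i + b"
    then show "coeff F i = c * (- 1) ^ (r - 1 - i)"
      using alt[of "r - 1 - i"] by auto
  qed
  moreover have "b \<le> min r s" if "c \<noteq> 0"
  proof -
    have "b \<le> s"
    proof (rule ccontr)
      assume "\<not> b \<le> s"
      then have "c = 0" using F by (auto simp: deg_lt_def c_def)
      with that show False by simp
    qed
    moreover have "b \<le> r"
    proof (rule ccontr)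
      assume "\<not> b \<le> r"
      then have "coeff F 0 = 0"
        using T[unfolded alt_on_def coeff_T1_mult, rule_format, of 0] \<open>0 < r\<close> by simp
      moreover have "coeff F 0 = c * (- 1) ^ (r - 1)"
        using alt[of "r - 1"] \<open>\<not> b \<le> r\<close> \<open>0 < r\<close> by auto
      ultimately show False using that by simp
    qed
    ultimately show ?thesis by simp
  qed
  ultimately show ?thesis using that by blast
qed

text \<open>The coefficient of \<open>x\<^sup>r\<^sup>-\<^sup>1\<close> in \<open>T1 ^ c * G * H\<close>, computed in two ways: the residue pairing
  makes multiplication by \<open>T1\<close> self-adjoint.\<close>

lemma pairing_vanishes:
  fixes G H :: "'f::field poly"
  assumes G: "deg_lt (Suc d) G" and H: "deg_lt b H" and "d < r"
    and TG: "alt_on r b 0 (T1 ^ c * G)" and TH: "alt_on r (Suc d) y (T1 ^ c * H)"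
  shows "y * poly G (- 1) = 0"
proof -
  have "coeff (H * (T1 ^ c * G)) (r - 1) = 0"
  proof -
    have "coeff H j * coeff (T1 ^ c * G) (r - 1 - j) = 0" if "j \<le> r - 1" for j
    proof (cases "j < b")
      case True
      then have "coeff (T1 ^ c * G) (r - 1 - j) = 0"
        using TG \<open>d < r\<close> that by (auto simp: alt_on_def)
      then show ?thesis by simp
    next
      case False
      then show ?thesis using H by (simp add: deg_lt_def)
    qed
    then show ?thesis unfolding coeff_mult[of H] by (intro sum.neutral) auto
  qed
  moreover have "coeff (G * (T1 ^ c * H)) (r - 1) = y * poly G (- 1)"
  proof -
    have "coeff (G * (T1 ^ c * H)) (r - 1) = (\<Sum>j\<le>r - 1. coeff G j * coeff (T1 ^ c * H) (r - 1 - j))"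
      by (rule coeff_mult)
    also have "\<dots> = (\<Sum>j\<le>d. coeff G j * coeff (T1 ^ c * H) (r - 1 - j))"
      using \<open>d < r\<close> G by (intro sum.mono_neutral_right) (auto simp: deg_lt_def)
    also have "\<dots> = (\<Sum>j\<le>d. y * (coeff G j * (- 1) ^ j))"
      using TH \<open>d < r\<close> by (intro sum.cong) (auto simp: alt_on_def)
    also have "\<dots> = y * (\<Sum>j\<le>d. coeff G j * (- 1) ^ j)"
      by (simp add: sum_distrib_left)
    also have "(\<Sum>j\<le>d. coeff G j * (- 1) ^ j) = poly G (- 1)"
      using G by (simp add: poly_altdef deg_lt_Suc_iff sum.mono_neutral_right coeff_eq_0)
    finally show ?thesis .
  qed
  ultimately show ?thesis by (simp add: mult_ac)
qed

section \<open>Regular indices and strings\<close>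

text \<open>\<open>(g - 1)\<^bsup>r+s-2a\<^esup>\<close> is injective, hence bijective, as a map
  \<open>D\<^bsub>r+s-a\<^esub> \<rightarrow> D\<^sub>a\<close> of \<open>V\<^sub>r \<otimes> V\<^sub>s\<close>; both spaces have dimension \<open>a\<close>.\<close>

definition regular :: "'f::field itself \<Rightarrow> nat \<Rightarrow> nat \<Rightarrow> nat \<Rightarrow> bool"
  where "regular _ r s a \<longleftrightarrow>
    (\<forall>F :: 'f poly. deg_lt a F \<longrightarrow> alt_on r a 0 (T1 ^ (r + s - 2 * a) * F) \<longrightarrow> F = 0)"

text \<open>A further power of \<open>T1\<close> completes the exponent to
  \<open>r + s - 2 * a\<close>; the inequalities say that \<open>c\<close> is not yet too large and
  that the window left over still covers index \<open>a\<close>.\<close>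

lemma regularD:
  fixes F :: "'f::field poly"
  assumes "regular TYPE('f) r s a" "deg_lt a F" "alt_on r b 0 (T1 ^ c * F)"
    "c + a \<le> r + s - a" "a + (r + s - 2 * a) \<le> b + c"
  shows "F = 0"
proof -
  have "alt_on r a 0 (T1 ^ (r + s - 2 * a - c) * (T1 ^ c * F))"
    by (rule alt_on_0_T1_power[OF assms(3)]) (use assms(4,5) in linarith)
  also have "T1 ^ (r + s - 2 * a - c) * (T1 ^ c * F) = T1 ^ (r + s - 2 * a) * F"
    using assms(4) by (simp add: mult.assoc[symmetric] flip: power_add)
  finally show ?thesis using assms(1,2) by (simp add: regular_def)
qed

lemma regular_0: "regular TYPE('f::field) r s 0"
  by (simp add: regular_def deg_lt_0_iff)

text \<open>\<open>T1\<close> has constant term 1 and is therefore a unit modulo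
  \<open>x^r\<close>.\<close>

lemma low_coeffs_T1_power:
  fixes F :: "'f::field poly"
  assumes "\<And>i. i < r \<Longrightarrow> coeff (T1 ^ c * F) i = 0" "i < r"
  shows "coeff F i = 0"
  using assms
proof (induction c arbitrary: i)
  case (Suc c)
  have step: "coeff (T1 ^ c * F) i + (if i = 0 then 0 else coeff (T1 ^ c * F) (i - 1)) = 0"
    if "i < r" for i
    using Suc.prems(1)[OF that] by (simp add: mult.assoc coeff_T1_mult)
  have *: "coeff (T1 ^ c * F) i = 0" if "i < r" for i
    using that
  proof (induction i)
    case 0
    then show ?case using step[of 0] by simp
  next
    case (Suc i)
    then show ?case using step[of "Suc i"] by simp
  qed
  show ?case by (rule Suc.IH[OF * Suc.prems(2)])
qed simp

text \<open>For \<open>r <= s\<close> the window is all of \<open>0, ..., r - 1\<close>, and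
  \<open>T1\<close> is a unit modulo \<open>x^r\<close>. For \<open>s < r\<close> the other end
  decides: the leading coefficient of \<open>T1 ^ (r - s) * F\<close> would lie in the
  window.\<close>

lemma regular_min: "regular TYPE('f::field) r s (min r s)"
  unfolding regular_def
proof (intro allI impI)
  fix F :: "'f poly"
  assume F: "deg_lt (min r s) F" and Z: "alt_on r (min r s) 0 (T1 ^ (r + s - 2 * min r s) * F)"
  show "F = 0"
  proof (cases "r \<le> s")
    case True
    have "coeff (T1 ^ (s - r) * F) i = 0" if "i < r" for i
      using Z True that by (simp add: alt_on_def min_def)
    then have "coeff F i = 0" if "i < r" for i using that low_coeffs_T1_power by blast
    moreover have "coeff F i = 0" if "r \<le> i" for i using F True that by (simp add: deg_lt_def)
    ultimately show ?thesis by (metis coeff_0 not_le_imp_less poly_eqI)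
  next
    case False
    have D: "deg_lt r (T1 ^ (r - s) * F)" using F False by (intro deg_lt_T1_power[where a = s]) auto
    have e: "coeff (T1 ^ (r - s) * F) i = 0" if "r \<le> i + s" for i
    proof (cases "i < r")
      case True
      then show ?thesis using Z False that by (simp add: alt_on_def min_def)
    next
      case False
      then show ?thesis using D by (simp add: deg_lt_def)
    qed
    show ?thesis
    proof (rule ccontr)
      assume "F \<noteq> 0"
      then have "degree (T1 ^ (r - s) * F) = r - s + degree F"
        by (subst degree_mult_eq) (auto simp: degree_T1_power)
      moreover have "coeff (T1 ^ (r - s) * F) (r - s + degree F) = 0" using False by (intro e) simp
      ultimately have "T1 ^ (r - s) * F = 0" by (metis leading_coeff_0_iff)
      with \<open>F \<noteq> 0\<close> show False using T1_power_mult_eq_0D by blast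
    qed
  qed
qed

lemma kernel_by_dimension:
  assumes "a \<le> r"
  obtains F :: "'f::field poly" where "F \<noteq> 0" "deg_lt (Suc a) F" "alt_on r a 0 (T1 ^ c * F)"
proof -
  \<comment> \<open>The coefficients of \<open>F\<close> are \<open>a + 1\<close> unknowns subject
    to \<open>a\<close> equations; the zero row makes the matrix square, so that singularity yields
    a solution.\<close>
  define A :: "'f mat" where "A = mat (Suc a) (Suc a)
    (\<lambda>(i, j). if i < a then coeff (T1 ^ c * monom 1 j) (r - 1 - i) else 0)"
  have A: "A \<in> carrier_mat (Suc a) (Suc a)" by (simp add: A_def)
  have "A = mat\<^sub>r (Suc a) (Suc a) (\<lambda>i. if i = a then 0\<^sub>v (Suc a) else row A i)"
    by (rule eq_matI) (auto simp: A_def)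
  then have "det A = 0" using det_row_0[of a "Suc a" "row A"] A by fastforce
  then obtain v where v: "v \<in> carrier_vec (Suc a)" "v \<noteq> 0\<^sub>v (Suc a)" "A *\<^sub>v v = 0\<^sub>v (Suc a)"
    using det_0_iff_vec_prod_zero_field[OF A] by auto
  define F where "F = (\<Sum>j<Suc a. monom (v $ j) j)"
  have cF: "coeff F i = (if i < Suc a then v $ i else 0)" for i
    by (simp add: F_def coeff_sum if_distrib[of "\<lambda>x. coeff x i"] sum.delta)
  have "F \<noteq> 0"
  proof
    assume "F = 0"
    then have "v $ i = 0" if "i < Suc a" for i using cF[of i] that by simp
    then have "v = 0\<^sub>v (Suc a)" using v(1) by (intro eq_vecI) auto
    with v(2) show False by simp
  qed
  moreover have "deg_lt (Suc a) F" by (simp add: deg_lt_def cF)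
  moreover have "alt_on r a 0 (T1 ^ c * F)"
    unfolding alt_on_def
  proof (intro allI impI)
    fix i assume i: "i < r" "r \<le> i + a"
    define i' where "i' = r - 1 - i"
    have i': "i' < a" "i = r - 1 - i'" using i by (auto simp: i'_def)
    have "T1 ^ c * F = (\<Sum>j<Suc a. smult (v $ j) (T1 ^ c * monom 1 j))"
      unfolding F_def sum_distrib_left by (intro sum.cong) (simp_all add: smult_monom flip: mult_smult_right)
    then have "coeff (T1 ^ c * F) i = (\<Sum>j<Suc a. v $ j * coeff (T1 ^ c * monom 1 j) i)"
      by (simp add: coeff_sum)
    also have "\<dots> = (A *\<^sub>v v) $ i'"
      using i' v(1) A by (simp add: scalar_prod_def A_def mult.commute lessThan_atLeast0)
    also have "\<dots> = 0" using v(3) i' by simp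
    finally show "coeff (T1 ^ c * F) i = 0 * (- 1) ^ (r - 1 - i)" by simp
  qed
  ultimately show ?thesis using that by blast
qed

text \<open>\<open>F\<close> generates a string of length \<open>r + s - a - b\<close> from \<open>D\<^bsub>r+s-a-1\<^esub>\<close> down to \<open>x\<^sub>b\<close>.\<close>

definition string :: "nat \<Rightarrow> nat \<Rightarrow> nat \<Rightarrow> nat \<Rightarrow> 'f::field poly \<Rightarrow> bool"
  where "string r s a b F \<longleftrightarrow> a < b \<and> b \<le> min r s \<and> deg_lt (Suc a) F \<and>
    alt_on r b 1 (T1 ^ (r + s - a - b - 1) * F)"

lemma string_kernel:
  fixes F :: "'f::field poly"
  assumes "string r s a b F"
  shows "alt_on r (b - 1) 0 (T1 ^ (r + s - a - b) * F)"
proof -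
  have "alt_on r (b - 1) 0 (T1 * (T1 ^ (r + s - a - b - 1) * F))"
    using assms by (intro alt_on_T1[where c = 1]) (auto simp: string_def)
  moreover have "r + s - a - b = Suc (r + s - a - b - 1)" using assms by (auto simp: string_def)
  ultimately show ?thesis by (metis mult.assoc power_Suc)
qed

lemma string_shift:
  fixes F :: "'f::field poly"
  assumes "string r s a b F" "i \<le> b - 1"
  shows "alt_on r (b - i) ((- 1) ^ i) (T1 ^ (r + s - a - b - 1) * (monom 1 i * F))"
proof -
  have "alt_on r (b - i) ((- 1) ^ i * 1) (monom 1 i * (T1 ^ (r + s - a - b - 1) * F))"
    using assms by (intro alt_on_monom) (auto simp: string_def)
  then show ?thesis by (simp add: mult_ac)
qed

text \<open>A nonzero form with \<open>a + 1\<close> coefficients dies on the way to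
  \<open>D_a\<close>, which has only \<open>a\<close> coordinates. Its last nonzero image is
  annihilated by \<open>T\<close>, hence is a multiple of some \<open>x_b\<close>, and rescaling
  normalises it.\<close>

lemma string_exists:
  assumes "regular TYPE('f::field) r s a" "a < min r s"
  obtains b and F :: "'f::field poly" where "string r s a b F"
proof -
  obtain F :: "'f poly" where F: "F \<noteq> 0" "deg_lt (Suc a) F" "alt_on r a 0 (T1 ^ (r + s - 2 * a - 1) * F)"
    using kernel_by_dimension[of a r "r + s - 2 * a - 1"] assms(2) by auto
  \<comment> \<open>The index counts down from \<open>r + s - 1 - a\<close>, the degree in which
    \<open>F\<close> itself lives.\<close>
  define P where "P c \<longleftrightarrow> alt_on r (r + s - 1 - a - c) 0 (T1 ^ c * F)" for c
  have P: "P (r + s - 2 * a - 1)" using F(3) assms(2) by (simp add: P_def)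
  have "\<not> P 0"
  proof
    assume "P 0"
    then have "coeff F i = 0" if "i < r" for i
      using that assms(2) unfolding P_def alt_on_def by (auto dest: spec[of _ i])
    moreover have "coeff F i = 0" if "r \<le> i" for i using F(2) assms(2) that by (simp add: deg_lt_def)
    ultimately have "F = 0" by (metis coeff_0 not_le_imp_less poly_eqI)
    with F(1) show False by simp
  qed
  define c where "c = (LEAST c. P c)"
  have "P c" unfolding c_def using P by (rule LeastI)
  have c: "c \<le> r + s - 2 * a - 1" unfolding c_def using P by (rule Least_le)
  obtain N where N: "c = Suc N" using \<open>P c\<close> \<open>\<not> P 0\<close> by (cases c) auto
  then have nP: "\<not> P N" using not_less_Least[of N P] by (simp add: c_def)
  define b where "b = r + s - 1 - a - N"
  have ab: "a < b" "N = r + s - a - b - 1" using c N assms(2) by (auto simp: b_def)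
  have "deg_lt (r + s - b) (T1 ^ N * F)"
    by (rule deg_lt_T1_power[OF F(2)]) (use c N assms(2) in \<open>auto simp: b_def\<close>)
  moreover have "alt_on r (b - 1) 0 (T1 * (T1 ^ N * F))"
    using \<open>P c\<close> N by (simp add: P_def b_def mult.assoc[symmetric])
  ultimately obtain d where d: "alt_on r b d (T1 ^ N * F)" "d \<noteq> 0 \<Longrightarrow> b \<le> min r s"
    using alt_on_T1_kernel[of r s b "T1 ^ N * F"] ab assms(2) by auto
  have "d \<noteq> 0" using nP d(1) by (auto simp: P_def b_def)
  have "alt_on r b (inverse d * d) (smult (inverse d) (T1 ^ N * F))" by (rule alt_on_smult[OF d(1)])
  then have "string r s a b (smult (inverse d) F)"
    using d \<open>d \<noteq> 0\<close> ab F(2) by (simp add: string_def deg_lt_smult mult_smult_right)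
  then show ?thesis by (rule that)
qed

context
  fixes r s a b :: nat and F :: "'f::field poly"
  assumes reg: "regular TYPE('f) r s a" and str: "string r s a b F"
begin

text \<open>If \<open>F = T1 * G\<close>, then \<open>G\<close> would be killed by at most
  \<open>r + s - 2 * a\<close> factors \<open>T1\<close>, against regularity at
  \<open>a\<close>.\<close>

lemma string_top_nonzero: "poly F (- 1) \<noteq> 0"
proof
  assume "poly F (- 1) = 0"
  then obtain G where G: "F = T1 * G" "deg_lt a G"
    using str poly_minus_one_eq_0E[of F a] by (auto simp: string_def)
  have "alt_on r (b - 1) 0 (T1 ^ Suc (r + s - a - b) * G)"
    using string_kernel[OF str] by (simp only: G(1) power_Suc2 mult.assoc)
  then have "G = 0" by (rule regularD[OF reg G(2)]) (use str in \<open>auto simp: string_def\<close>)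
  then have "alt_on r b 1 (0 :: 'f poly)" using str G(1) by (simp add: string_def)
  then have "(1 :: 'f) = 0" by (rule alt_on_unique) (use str in \<open>auto simp: string_def\<close>)
  then show False by simp
qed

text \<open>Modulo \<open>T1\<close> the form \<open>H\<close> is a multiple of \<open>F\<close>;
  the remaining multiple of \<open>T1\<close> is zero by regularity, and \<open>F\<close> itself has
  the nonzero image \<open>x_b\<close>. This is the uniqueness that makes the rows of
  \<open>J\<close> well defined.\<close>

lemma string_top_inj:
  fixes H :: "'f poly"
  assumes H: "deg_lt (Suc a) H" "alt_on r b 0 (T1 ^ (r + s - a - b - 1) * H)"
  shows "H = 0"
proof -
  define c where "c = poly H (- 1) / poly F (- 1)"
  have "deg_lt (Suc a) (H - smult c F)"
    using H(1) str by (auto simp: string_def intro: deg_lt_diff deg_lt_smult)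
  moreover have "poly (H - smult c F) (- 1) = 0" using string_top_nonzero by (simp add: c_def)
  ultimately obtain G where G: "H - smult c F = T1 * G" "deg_lt a G"
    using poly_minus_one_eq_0E by blast
  have L: "r + s - a - b = Suc (r + s - a - b - 1)" using str by (auto simp: string_def)
  have "alt_on r (b - 1) 0 (T1 ^ 1 * (T1 ^ (r + s - a - b - 1) * H))"
    by (rule alt_on_0_T1_power[OF H(2)]) (use str in \<open>auto simp: string_def\<close>)
  then have "alt_on r (b - 1) 0 (T1 ^ (r + s - a - b) * H)"
    by (subst L) (simp add: mult.assoc)
  then have "alt_on r (b - 1) (0 - c * 0) (T1 ^ (r + s - a - b) * H - smult c (T1 ^ (r + s - a - b) * F))"
    by (intro alt_on_diff alt_on_smult string_kernel[OF str])
  then have "alt_on r (b - 1) 0 (T1 ^ (r + s - a - b) * (H - smult c F))"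
    by (simp add: algebra_simps)
  then have "alt_on r (b - 1) 0 (T1 ^ Suc (r + s - a - b) * G)"
    by (simp only: G(1) power_Suc2 mult.assoc)
  then have "G = 0" by (rule regularD[OF reg G(2)]) (use str in \<open>auto simp: string_def\<close>)
  then have Hc: "H = smult c F" using G(1) by simp
  have "alt_on r b (c * 1) (T1 ^ (r + s - a - b - 1) * H)"
    unfolding Hc mult_smult_right by (rule alt_on_smult) (use str in \<open>simp add: string_def\<close>)
  from alt_on_unique[OF this H(2)] have "c = 0" using str by (auto simp: string_def)
  then show ?thesis by (simp add: Hc)
qed

text \<open>Take a form killed on the way to \<open>D_b\<close> and strip off all factors
  \<open>T1\<close>, leaving a form of degree at most \<open>d\<close> that is nonzero at -1. If
  \<open>a <= d\<close>, pairing it with a preimage of \<open>x_{d+1}\<close> returns its value at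
  -1, which is thus zero; if \<open>d < a\<close>, regularity at \<open>a\<close> applies.\<close>

lemma string_end_regular: "regular TYPE('f) r s b"
  unfolding regular_def
proof (intro allI impI)
  fix G :: "'f poly"
  assume G: "deg_lt b G" "alt_on r b 0 (T1 ^ (r + s - 2 * b) * G)"
  show "G = 0"
  proof (rule ccontr)
    assume "G \<noteq> 0"
    define j where "j = Polynomial.order (- 1) G"
    obtain G' where G': "G = [:- (- 1), 1:] ^ j * G'" "\<not> [:- (- 1), 1:] dvd G'"
      using order_decomp[OF \<open>G \<noteq> 0\<close>, of "- 1"] by (auto simp: j_def)
    then have eq: "G = T1 ^ j * G'" by (simp add: T1_def)
    have nz: "poly G' (- 1) \<noteq> 0" using G'(2) by (simp only: poly_eq_0_iff_dvd not_False_eq_True)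
    then have "G' \<noteq> 0" by auto
    have "degree G = j + degree G'"
      unfolding eq using \<open>G' \<noteq> 0\<close> by (subst degree_mult_eq) (auto simp: degree_T1_power)
    moreover have "degree G < b" using G(1) \<open>G \<noteq> 0\<close>
      by (metis deg_lt_def leading_coeff_0_iff not_le_imp_less)
    ultimately have jd: "j + degree G' < b" by simp
    define d where "d = b - 1 - j"
    have degG': "deg_lt (Suc d) G'" using jd by (auto simp: deg_lt_Suc_iff d_def)
    have bounds: "a < b" "b \<le> r" "b \<le> s" using str by (auto simp: string_def)
    define c where "c = r + s - b - 1 - d"
    have "c = r + s - 2 * b + j" using jd bounds by (auto simp: c_def d_def)
    then have ker: "alt_on r b 0 (T1 ^ c * G')"
      using G(2) by (simp add: eq power_add mult_ac)
    show False
    proof (cases "a \<le> d")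
      case True
      \<comment> \<open>A shifted and partly descended copy of the generator, chosen so that
        \<open>T1 ^ c\<close> takes it to \<open>x_{d+1}\<close> up to sign.\<close>
      define H where "H = T1 ^ (d - a) * (monom 1 (b - 1 - d) * F)"
      have "deg_lt b H"
        unfolding H_def using str True jd bounds
        by (intro deg_lt_T1_power[where a = "a + b - d"] deg_lt_monom[where a = "Suc a"])
          (auto simp: string_def d_def)
      have "c + (d - a) = r + s - a - b - 1" using True bounds jd by (auto simp: c_def d_def)
      then have "T1 ^ c * H = T1 ^ (r + s - a - b - 1) * (monom 1 (b - 1 - d) * F)"
        unfolding H_def by (metis mult.assoc power_add)
      moreover have "alt_on r (b - (b - 1 - d)) ((- 1) ^ (b - 1 - d))
          (T1 ^ (r + s - a - b - 1) * (monom 1 (b - 1 - d) * F))"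
        by (rule string_shift[OF str]) simp
      moreover have "b - (b - 1 - d) = Suc d" using jd by (simp add: d_def)
      ultimately have "(- 1) ^ (b - 1 - d) * poly G' (- 1) = 0"
        using jd bounds by (intro pairing_vanishes[OF degG' \<open>deg_lt b H\<close> _ ker]) (auto simp: d_def)
      with nz show False by simp
    next
      case False
      have "deg_lt a (T1 ^ (a - 1 - d) * G')"
        by (rule deg_lt_T1_power[OF degG']) (use False in simp)
      moreover have "alt_on r a 0 (T1 ^ (b - a) * (T1 ^ c * G'))"
        by (rule alt_on_0_T1_power[OF ker]) (use bounds in simp)
      moreover have "(b - a) + c = (r + s - 2 * a) + (a - 1 - d)"
        using False bounds jd by (auto simp: c_def d_def)
      then have "T1 ^ (b - a) * (T1 ^ c * G') = T1 ^ (r + s - 2 * a) * (T1 ^ (a - 1 - d) * G')"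
        by (metis mult.assoc power_add)
      ultimately have "T1 ^ (a - 1 - d) * G' = 0"
        using reg unfolding regular_def by metis
      then show False using \<open>G' \<noteq> 0\<close> by simp
    qed
  qed
qed

text \<open>\<open>T1 ^ (i - a - 1) * F\<close> is a nonzero form in the domain at \<open>i\<close>,
  and its image in \<open>D_i\<close> is zero because the string already ended at \<open>x_b\<close>
  with \<open>b > i\<close>.\<close>

lemma no_regular_inside_string:
  assumes "a < i" "i < b"
  shows "\<not> regular TYPE('f) r s i"
proof
  assume i: "regular TYPE('f) r s i"
  have bounds: "b \<le> r" "b \<le> s" using str by (auto simp: string_def)
  have "T1 ^ (i - a - 1) * F = 0"
  proof (rule regularD[OF i])
    show "deg_lt i (T1 ^ (i - a - 1) * F)"
      by (rule deg_lt_T1_power[where a = "Suc a"]) (use str assms in \<open>auto simp: string_def\<close>)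
    have "(r + s - i - b) + (i - a - 1) = r + s - a - b - 1" using assms bounds by auto
    have "(r + s - 2 * i) + (i - a - 1) = (b - 1 - i) + (r + s - a - b)" using assms bounds by auto
    then have eq: "T1 ^ (r + s - 2 * i) * (T1 ^ (i - a - 1) * F) =
        T1 ^ (b - 1 - i) * (T1 ^ (r + s - a - b) * F)"
      by (metis mult.assoc power_add)
    show "alt_on r i 0 (T1 ^ (r + s - 2 * i) * (T1 ^ (i - a - 1) * F))"
      unfolding eq by (rule alt_on_0_T1_power[OF string_kernel[OF str]]) (use assms in simp)
  qed (use assms bounds in auto)
  then have "F = 0" by simp
  then show False using string_top_nonzero by simp
qed

end

section \<open>Jordan type from the regular indices\<close>

definition lo :: "'f::field itself \<Rightarrow> nat \<Rightarrow> nat \<Rightarrow> nat \<Rightarrow> nat"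
  where "lo F r s l = Max {a. a < l \<and> regular F r s a}"

definition hi :: "'f::field itself \<Rightarrow> nat \<Rightarrow> nat \<Rightarrow> nat \<Rightarrow> nat"
  where "hi F r s l = (LEAST b. l \<le> b \<and> regular F r s b)"

text \<open>All \<open>hi - lo\<close> indices of one interval receive the same size. That these
  sizes are the true parts is the content of \<open>parts_of_Vtensor\<close>.\<close>

definition jordan_part :: "'f::field itself \<Rightarrow> nat \<Rightarrow> nat \<Rightarrow> nat \<Rightarrow> nat"
  where "jordan_part F r s l = r + s - lo F r s l - hi F r s l"

lemma lo_less: "0 < l \<Longrightarrow> lo F r s l < l"
  and regular_lo: "0 < l \<Longrightarrow> regular F r s (lo F r s l)"
proof -
  assume "0 < l"
  have "{a. a < l \<and> regular F r s a} \<noteq> {}"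
    using \<open>0 < l\<close> by (metis (mono_tags, lifting) empty_iff mem_Collect_eq regular_def deg_lt_0_iff)
  then have "lo F r s l \<in> {a. a < l \<and> regular F r s a}"
    unfolding lo_def by (intro Max_in) auto
  then show "lo F r s l < l" "regular F r s (lo F r s l)" by auto
qed

lemma le_lo: "a < l \<Longrightarrow> regular F r s a \<Longrightarrow> a \<le> lo F r s l"
  unfolding lo_def by (intro Max_ge) auto

lemma hi_props:
  fixes F :: "'f::field itself"
  assumes "l \<le> min r s"
  shows le_hi: "l \<le> hi F r s l" and regular_hi: "regular F r s (hi F r s l)"
    and hi_le: "hi F r s l \<le> min r s"
proof -
  have *: "l \<le> min r s \<and> regular F r s (min r s)"
    using regular_min[of r s] assms by (simp add: regular_def)
  then show "l \<le> hi F r s l" "regular F r s (hi F r s l)"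
    unfolding hi_def by (metis (mono_tags, lifting) LeastI)+
  show "hi F r s l \<le> min r s" unfolding hi_def using * by (rule Least_le)
qed

lemma hi_le_regular: "l \<le> b \<Longrightarrow> regular F r s b \<Longrightarrow> hi F r s l \<le> b"
  unfolding hi_def by (rule Least_le) simp

lemma lo_eqI:
  assumes "a < l" "regular F r s a" "\<And>i. a < i \<Longrightarrow> i < l \<Longrightarrow> \<not> regular F r s i"
  shows "lo F r s l = a"
proof -
  have "a \<le> lo F r s l" using assms le_lo by blast
  moreover have "\<not> a < lo F r s l" using assms(3) lo_less regular_lo assms(1)
    by (metis gr_implies_not0 neq0_conv)
  ultimately show ?thesis by simp
qed

lemma hi_eqI:
  assumes "l \<le> b" "regular F r s b" "\<And>i. l \<le> i \<Longrightarrow> i < b \<Longrightarrow> \<not> regular F r s i"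
  shows "hi F r s l = b"
  unfolding hi_def using assms by (intro Least_equality) (auto intro: leI)

context
  fixes F :: "'f::field itself" and r s l :: nat
  assumes l: "0 < l" "l \<le> min r s"
begin

lemma no_regular_between:
  assumes "lo F r s l < i" "i < hi F r s l"
  shows "\<not> regular F r s i"
proof
  assume i: "regular F r s i"
  show False
  proof (cases "i < l")
    case True
    then show False using le_lo[OF True i] assms by simp
  next
    case False
    then show False using hi_le_regular[of l i F r s] i assms by simp
  qed
qed

lemma lo_hi_const:
  assumes "lo F r s l < i" "i \<le> hi F r s l"
  shows "lo F r s i = lo F r s l" "hi F r s i = hi F r s l"
proof -
  show "lo F r s i = lo F r s l"
    using assms l no_regular_between by (intro lo_eqI regular_lo) auto
  show "hi F r s i = hi F r s l"
    using assms l no_regular_between by (intro hi_eqI regular_hi) auto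
qed

lemma jordan_part_const:
  assumes "lo F r s l < i" "i \<le> hi F r s l"
  shows "jordan_part F r s i = jordan_part F r s l"
  using lo_hi_const[OF assms] by (simp add: jordan_part_def)

lemma jordan_part_pos: "0 < jordan_part F r s l"
  using lo_less[of l F r s] hi_le[of l r s F] l by (simp add: jordan_part_def)

lemma jordan_part_less_after:
  assumes "hi F r s l < i" "i \<le> min r s"
  shows "jordan_part F r s i < jordan_part F r s l"
proof -
  have "hi F r s l \<le> lo F r s i" using le_lo[OF assms(1) regular_hi] l by simp
  moreover have "i \<le> hi F r s i" "hi F r s i \<le> min r s" using le_hi hi_le assms(2) by blast+
  moreover have "lo F r s i < i" using lo_less assms by (metis gr_implies_not0 neq0_conv)
  moreover have "lo F r s l < l" "l \<le> hi F r s l" using l lo_less le_hi by blast+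
  ultimately show ?thesis using assms l unfolding jordan_part_def by linarith
qed

end

lemma jordan_part_eq_iff:
  assumes l: "0 < l" "l \<le> min r s" and i: "0 < i" "i \<le> min r s"
  shows "jordan_part F r s i = jordan_part F r s l \<longleftrightarrow> lo F r s l < i \<and> i \<le> hi F r s l"
proof
  assume eq: "jordan_part F r s i = jordan_part F r s l"
  have 1: "i \<le> hi F r s l" using jordan_part_less_after[OF l, of F i] i eq by force
  have 2: "l \<le> hi F r s i" using jordan_part_less_after[OF i, of F l] l eq by force
  have "lo F r s l < i"
  proof (rule ccontr)
    assume "\<not> lo F r s l < i"
    then have "hi F r s i \<le> lo F r s l" using hi_le_regular[OF _ regular_lo[of l F r s], of i] l by simp
    then show False using 2 lo_less[of l F r s] l by linarith
  qed
  with 1 show "lo F r s l < i \<and> i \<le> hi F r s l" by simp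
next
  assume "lo F r s l < i \<and> i \<le> hi F r s l"
  then show "jordan_part F r s i = jordan_part F r s l" using jordan_part_const[OF l] by blast
qed

lemma jordan_part_antimono:
  assumes "0 < l" "l \<le> i" "i \<le> min r s"
  shows "jordan_part F r s i \<le> jordan_part F r s l"
proof (cases "i \<le> hi F r s l")
  case True
  moreover have "lo F r s l < i" using lo_less[of l F r s] assms by simp
  ultimately show ?thesis using jordan_part_const[of l r s F i] assms by simp
next
  case False
  then show ?thesis using jordan_part_less_after[of l r s F i] assms by simp
qed

text \<open>The \<open>l\<close>-th Jordan block runs from \<open>D\<^bsub>r+s-l\<^esub>\<close> down to \<open>x\<^sub>d\<close> with \<open>d = mirror F r s l\<close>.\<close>

definition mirror :: "'f::field itself \<Rightarrow> nat \<Rightarrow> nat \<Rightarrow> nat \<Rightarrow> nat"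
  where "mirror F r s l = Suc (lo F r s l + hi F r s l) - l"

lemma mirror_props:
  fixes F :: "'f::field itself"
  assumes l: "0 < l" "l \<le> min r s"
  shows mirror_gt: "lo F r s l < mirror F r s l" and mirror_le: "mirror F r s l \<le> hi F r s l"
    and mirror_mirror: "mirror F r s (mirror F r s l) = l"
    and jordan_part_mirror: "jordan_part F r s l = Suc (r + s) - l - mirror F r s l"
    and mirror_bounds: "0 < mirror F r s l" "mirror F r s l \<le> min r s"
proof -
  have b: "lo F r s l < l" "l \<le> hi F r s l" "hi F r s l \<le> min r s"
    using l lo_less le_hi hi_le by blast+
  then show 1: "lo F r s l < mirror F r s l" "mirror F r s l \<le> hi F r s l"
    by (auto simp: mirror_def)
  have "lo F r s (mirror F r s l) = lo F r s l" "hi F r s (mirror F r s l) = hi F r s l"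
    using lo_hi_const[OF l 1] by auto
  then show "mirror F r s (mirror F r s l) = l"
    using b unfolding mirror_def[of F r s "mirror F r s l"] by (simp add: mirror_def)
  show "jordan_part F r s l = Suc (r + s) - l - mirror F r s l"
    using b by (simp add: mirror_def jordan_part_def)
  show "0 < mirror F r s l" "mirror F r s l \<le> min r s" using 1 b by linarith+
qed

lemma bij_betw_mirror: "bij_betw (mirror F r s) {1..min r s} {1..min r s}"
proof (rule bij_betw_byWitness[where f' = "mirror F r s"])
  show "mirror F r s ` {1..min r s} \<subseteq> {1..min r s}"
    using mirror_bounds[of _ r s F] by (auto simp: Suc_le_eq)
  then show "mirror F r s ` {1..min r s} \<subseteq> {1..min r s}" .
qed (auto simp: mirror_mirror)

text \<open>Each size is \<open>r + s + 1 - l - mirror l\<close> and \<open>mirror\<close> permutes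
  the indices, so with \<open>m = min r s\<close> the sum is
  \<open>m * (r + s + 1) - m * (m + 1)\<close>. This dimension count turns the independent strings
  into a basis.\<close>

lemma sum_jordan_part: "(\<Sum>l = 1..min r s. jordan_part F r s l) = r * s"
proof -
  define m where "m = min r s"
  have "int (\<Sum>l = 1..m. jordan_part F r s l) = (\<Sum>l = 1..m. int (Suc (r + s)) - int l - int (mirror F r s l))"
    unfolding of_nat_sum m_def
  proof (intro sum.cong refl)
    fix l assume "l \<in> {1..min r s}"
    then have l: "0 < l" "l \<le> min r s" by auto
    then show "int (jordan_part F r s l) = int (Suc (r + s)) - int l - int (mirror F r s l)"
      using jordan_part_mirror[OF l, of F] mirror_bounds[OF l, of F] by auto
  qed
  also have "\<dots> = int m * int (Suc (r + s)) - (\<Sum>l = 1..m. int l) - (\<Sum>l = 1..m. int (mirror F r s l))"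
    by (simp add: sum_subtractf)
  also have "(\<Sum>l = 1..m. int (mirror F r s l)) = (\<Sum>l = 1..m. int l)"
    unfolding m_def using sum.reindex_bij_betw[OF bij_betw_mirror, of int] by simp
  also have "int m * int (Suc (r + s)) - (\<Sum>l = 1..m. int l) - (\<Sum>l = 1..m. int l)
      = int m * (int r + int s - int m)"
  proof -
    have "2 * (\<Sum>l = 1..m. int l) = int m * (int m + 1)"
      by (induction m) (auto simp: algebra_simps)
    then show ?thesis by (simp add: algebra_simps)
  qed
  also have "\<dots> = int (r * s)" by (cases "r \<le> s") (auto simp: m_def min_def)
  finally show ?thesis unfolding m_def by (metis of_nat_eq_iff)
qed

lemma lo_hi_string:
  fixes F :: "'f::field poly"
  assumes "regular TYPE('f) r s a" "string r s a b F" "a < l" "l \<le> b"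
  shows "lo TYPE('f) r s l = a" "hi TYPE('f) r s l = b"
proof -
  note nr = no_regular_inside_string[OF assms(1,2)]
  show "lo TYPE('f) r s l = a" using assms nr by (intro lo_eqI) auto
  show "hi TYPE('f) r s l = b"
    using assms nr string_end_regular[OF assms(1,2)] by (intro hi_eqI) auto
qed

lemma string_at:
  assumes "0 < l" "l \<le> min r s"
  obtains F :: "'f::field poly" where "string r s (lo TYPE('f) r s l) (hi TYPE('f) r s l) F"
proof -
  have lo: "regular TYPE('f) r s (lo TYPE('f) r s l)" "lo TYPE('f) r s l < l"
    using assms regular_lo lo_less by blast+
  then obtain b and F :: "'f poly" where F: "string r s (lo TYPE('f) r s l) b F"
    using string_exists[of r s "lo TYPE('f) r s l"] assms by auto
  have "l \<le> b"
  proof (rule ccontr)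
    assume "\<not> l \<le> b"
    then have "b \<le> lo TYPE('f) r s l" using le_lo[OF _ string_end_regular[OF lo(1) F]] by simp
    then show False using F by (simp add: string_def)
  qed
  then have "hi TYPE('f) r s l = b" using lo_hi_string[OF lo(1) F] lo by blast
  with F that show ?thesis by blast
qed

text \<open>If \<open>F'\<close> gave a longer string, \<open>x\<^bsub>a+1\<^esub>\<close> would lie in the image of a power of \<open>T1\<close> that kills \<open>F\<close>,
  and the pairing would force \<open>F(-1) = 0\<close>.\<close>

lemma string_length_le:
  fixes F F' :: "'f::field poly"
  assumes F: "string r s a b F" "poly F (- 1) \<noteq> 0" and F': "string r s a' b' F'" and "a < b'"
  shows "r + s - a' - b' \<le> r + s - a - b"
proof (rule ccontr)
  assume less: "\<not> ?thesis"
  define c where "c = r + s - a - b"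
  define H where "H = T1 ^ (r + s - a' - b' - 1 - c) * (monom 1 (b' - 1 - a) * F')"
  have bounds: "a < b" "b \<le> r" "b \<le> s" "a' < b'" "b' \<le> r" "b' \<le> s"
    using F(1) F' by (auto simp: string_def)
  have "deg_lt (b - 1) H"
    unfolding H_def using F' less bounds \<open>a < b'\<close>
    by (intro deg_lt_T1_power[where a = "a' + b' - a"] deg_lt_monom[where a = "Suc a'"])
      (auto simp: string_def c_def)
  have "c + (r + s - a' - b' - 1 - c) = r + s - a' - b' - 1" using less by (simp add: c_def)
  then have "T1 ^ c * H = T1 ^ (r + s - a' - b' - 1) * (monom 1 (b' - 1 - a) * F')"
    unfolding H_def by (metis mult.assoc power_add)
  moreover have "alt_on r (b' - (b' - 1 - a)) ((- 1) ^ (b' - 1 - a))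
      (T1 ^ (r + s - a' - b' - 1) * (monom 1 (b' - 1 - a) * F'))"
    by (rule string_shift[OF F']) simp
  moreover have "b' - (b' - 1 - a) = Suc a" using \<open>a < b'\<close> by simp
  ultimately have "(- 1) ^ (b' - 1 - a) * poly F (- 1) = 0"
    using F(1) bounds string_kernel[OF F(1)]
    by (intro pairing_vanishes[OF _ \<open>deg_lt (b - 1) H\<close>, of a F r c]) (auto simp: string_def c_def)
  with F(2) show False by simp
qed

text \<open>The length bound is used in both directions. The condition at -1 takes the place of
  regularity of \<open>a\<close>, so a block is recognised from an explicit generator before the
  regular indices of \<open>(r, s)\<close> are known.\<close>

lemma jordan_part_string:
  fixes F :: "'f::field poly"
  assumes "string r s a b F" "poly F (- 1) \<noteq> 0" "a < l" "l \<le> b"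
  shows "jordan_part TYPE('f) r s l = r + s - a - b"
proof -
  have l: "0 < l" "l \<le> min r s" using assms by (auto simp: string_def)
  obtain F' :: "'f poly" where F': "string r s (lo TYPE('f) r s l) (hi TYPE('f) r s l) F'"
    by (rule string_at[OF l])
  have "poly F' (- 1) \<noteq> 0" by (rule string_top_nonzero[OF regular_lo[OF l(1)] F'])
  then have "r + s - a - b \<le> jordan_part TYPE('f) r s l"
    unfolding jordan_part_def using lo_less[OF l(1), of "TYPE('f)" r s] assms
    by (intro string_length_le[OF F' _ assms(1)]) auto
  moreover have "jordan_part TYPE('f) r s l \<le> r + s - a - b"
    unfolding jordan_part_def using le_hi[OF l(2), of "TYPE('f)"] assms
    by (intro string_length_le[OF assms(1,2) F']) auto
  ultimately show ?thesis by simp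
qed

section \<open>Transfer of syzygies along the Frobenius relation\<close>

lemma split_at:
  fixes F :: "'f::field poly"
  obtains A B where "F = monom 1 r * A + B" "deg_lt r B" "\<And>d. deg_lt d F \<Longrightarrow> deg_lt (d - r) A"
    "\<And>i. i < r \<Longrightarrow> coeff B i = coeff F i"
proof
  show "F = monom 1 r * poly_shift r F + poly_cutoff r F"
    by (auto simp: poly_eq_iff coeff_poly_shift coeff_poly_cutoff coeff_monom_mult')
  show "deg_lt r (poly_cutoff r F)" by (auto simp: deg_lt_def coeff_poly_cutoff)
  show "deg_lt (d - r) (poly_shift r F)" if "deg_lt d F" for d
    using that by (auto simp: deg_lt_def coeff_poly_shift)
qed (auto simp: coeff_poly_cutoff)

text \<open>The split of an element of \<open>D\<^sub>b\<close> that lies in the ideal \<open>(x\<^sup>r, y\<^sup>s)\<close>.\<close>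

lemma alt_on_0_split:
  fixes F :: "'f::field poly"
  assumes "alt_on r b 0 F" "deg_lt d F" "r \<le> e + b"
  obtains A B where "F = monom 1 r * A + B" "deg_lt e B" "deg_lt (d - r) A"
proof -
  obtain A B where AB: "F = monom 1 r * A + B" "deg_lt r B" "\<And>d. deg_lt d F \<Longrightarrow> deg_lt (d - r) A"
    "\<And>i. i < r \<Longrightarrow> coeff B i = coeff F i" using split_at[of F r] by blast
  have "deg_lt e B"
    unfolding deg_lt_def
  proof (intro allI impI)
    fix i assume "e \<le> i"
    then show "coeff B i = 0"
      using AB(2,4) assms(1,3) by (cases "i < r") (auto simp: deg_lt_def alt_on_def)
  qed
  then show ?thesis using that AB(1,3) assms(2) by blast
qed

lemma alt_on_0_sum:
  fixes A B :: "'f::field poly"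
  assumes "deg_lt e B" "e + b \<le> r"
  shows "alt_on r b 0 (monom 1 r * A + B)"
  unfolding alt_on_def
proof (intro allI impI)
  fix i assume "i < r" "r \<le> i + b"
  then show "coeff (monom 1 r * A + B) i = 0 * (- 1) ^ (r - 1 - i)"
    using assms by (auto simp: coeff_monom_mult' deg_lt_def)
qed

lemma deg_lt_monom_iff: "deg_lt (k + a) (monom 1 k * F) \<longleftrightarrow> deg_lt a F" for F :: "'f::field poly"
proof
  assume *: "deg_lt (k + a) (monom 1 k * F)"
  show "deg_lt a F"
    unfolding deg_lt_def
  proof (intro allI impI)
    fix i assume "a \<le> i"
    then have "coeff (monom 1 k * F) (k + i) = 0" using * by (simp add: deg_lt_def)
    then show "coeff F i = 0" by (simp add: coeff_monom_mult')
  qed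
qed (rule deg_lt_monom, auto)

lemma T1_power_char_power:
  assumes "prime p" "CHAR('f::field) = p"
  shows "(T1 :: 'f poly) ^ (p ^ n) = 1 + monom 1 (p ^ n)"
proof -
  have "(T1 :: 'f poly) = 1 + monom 1 1" by (simp add: T1_def monom_Suc one_pCons)
  moreover have "CHAR('f poly) = p" using assms by simp
  ultimately show ?thesis
    using freshmans_dream'[of "p ^ n" n "1 :: 'f poly" "monom 1 1"] assms by (simp add: monom_power)
qed

text \<open>Powers of an odd \<open>p\<close> are odd; for \<open>p = 2\<close> the two signs
  coincide.\<close>

lemma minus_one_power_char_power:
  assumes "prime p" "CHAR('f::field) = p"
  shows "(- 1 :: 'f) ^ (p ^ n) = - 1"
proof (cases "odd p")
  case False
  then have "p = 2" using assms(1) primes_dvd_imp_eq two_is_prime_nat by blast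
  then have "(2 :: 'f) = 0" using assms(2) of_nat_CHAR[where 'a = 'f] by simp
  then have "(1 :: 'f) = - 1" by (simp add: eq_neg_iff_add_eq_0)
  then show ?thesis by (metis power_one)
qed simp

text \<open>Transfer of syzygies. Here \<open>q\<close> is a power of the characteristic. From
  \<open>T\<^sup>\<delta> f \<in> (x\<^sup>R, y\<^sup>S)\<close> and \<open>T\<^sup>q = x\<^sup>q + y\<^sup>q\<close> one obtains
  relations for \<open>T\<^sup>q\<^sup>-\<^sup>\<delta>\<close> modulo \<open>(x\<^sup>q\<^sup>-\<^sup>R, y\<^sup>S)\<close> and
  modulo \<open>(x\<^sup>R, y\<^sup>q\<^sup>-\<^sup>S)\<close>.\<close>

lemma regular_transfer:
  fixes q :: nat
  assumes frob: "(T1 :: 'f::field poly) ^ q = 1 + monom 1 q"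
    and reg: "regular TYPE('f) R S b" and b: "b \<le> R" "b \<le> S" "R + S \<le> q + b" and RS: "R \<le> q" "S \<le> q"
  shows "regular TYPE('f) (q - R) S (S - b)" and "regular TYPE('f) R (q - S) (R - b)"
proof -
  \<comment> \<open>The exponent that regularity at \<open>b\<close> refers to; for both
    complementary pairs it becomes \<open>q - \<delta>\<close>.\<close>
  define \<delta> where "\<delta> = R + S - 2 * b"
  have regb: "f = 0" if "deg_lt b f" "alt_on R b 0 (T1 ^ \<delta> * f)" for f :: "'f poly"
    using reg that by (simp add: regular_def \<delta>_def)
  have \<delta>: "\<delta> \<le> q" "(q - \<delta>) + \<delta> = q" using b RS by (auto simp: \<delta>_def)
  have Tq: "T1 ^ \<delta> * (T1 ^ (q - \<delta>) * F) = F + monom 1 q * F" for F :: "'f poly"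
    using \<delta> frob by (simp add: mult.assoc[symmetric] distrib_right flip: power_add)
  show "regular TYPE('f) (q - R) S (S - b)"
    unfolding regular_def
  proof (intro allI impI)
    fix A :: "'f poly"
    assume A: "deg_lt (S - b) A"
      and Z: "alt_on (q - R) (S - b) 0 (T1 ^ (q - R + S - 2 * (S - b)) * A)"
    have ex: "q - R + S - 2 * (S - b) = q - \<delta>" using b RS by (auto simp: \<delta>_def)
    have dA: "deg_lt (q - R + b) (T1 ^ (q - \<delta>) * A)"
      by (rule deg_lt_T1_power[OF A]) (use b RS in \<open>auto simp: \<delta>_def\<close>)
    obtain f h where fh: "T1 ^ (q - \<delta>) * A = monom 1 (q - R) * f + h"
      "deg_lt (q - R - (S - b)) h" "deg_lt b f"
      using alt_on_0_split[OF Z[unfolded ex] dA, of "q - R - (S - b)"] b RS by auto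
    have eq: "A + monom 1 q * A = monom 1 (q - R) * (T1 ^ \<delta> * f) + T1 ^ \<delta> * h"
      unfolding Tq[symmetric] fh(1) by (simp add: algebra_simps)
    have "monom 1 q * A = monom 1 (q - R) * (monom 1 R * A)"
      using RS by (simp add: mult.assoc[symmetric] mult_monom)
    \<comment> \<open>The right-hand side has low degree, which bounds the degree of the remainder
      of \<open>T1 ^ \<delta> * f\<close> modulo \<open>x^R\<close>; hence
      \<open>T1 ^ \<delta> * f\<close> lies in the ideal \<open>(x^R, y^S)\<close>.\<close>
    from eq[unfolded this] have "monom 1 (q - R) * (T1 ^ \<delta> * f - monom 1 R * A) = A - T1 ^ \<delta> * h"
      by (simp add: algebra_simps)
    moreover have "deg_lt ((q - R) + (R - b)) (A - T1 ^ \<delta> * h)"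
      by (intro deg_lt_diff deg_lt_T1_power[OF fh(2)] deg_lt_mono[OF A]) (use b RS in \<open>auto simp: \<delta>_def\<close>)
    ultimately have d: "deg_lt (R - b) (T1 ^ \<delta> * f - monom 1 R * A)"
      by (metis deg_lt_monom_iff)
    define B where "B = T1 ^ \<delta> * f - monom 1 R * A"
    have TB: "T1 ^ \<delta> * f = monom 1 R * A + B" by (simp add: B_def)
    have "alt_on R b 0 (T1 ^ \<delta> * f)"
      unfolding TB by (rule alt_on_0_sum[where e = "R - b"]) (use d b in \<open>auto simp: B_def\<close>)
    then have "f = 0" by (rule regb[OF fh(3)])
    then have "monom 1 R * A = - B" by (simp add: B_def)
    moreover have "deg_lt R (- B)" using d deg_lt_mono[of "R - b" B R] by (simp add: B_def deg_lt_def)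
    ultimately have "deg_lt (R + 0) (monom 1 R * A)" by simp
    then show "A = 0" by (simp only: deg_lt_monom_iff deg_lt_0_iff)
  qed
  show "regular TYPE('f) R (q - S) (R - b)"
    unfolding regular_def
  proof (intro allI impI)
    fix B :: "'f poly"
    assume B: "deg_lt (R - b) B"
      and Z: "alt_on R (R - b) 0 (T1 ^ (R + (q - S) - 2 * (R - b)) * B)"
    have ex: "R + (q - S) - 2 * (R - b) = q - \<delta>" using b RS by (auto simp: \<delta>_def)
    have dB: "deg_lt (q - S + b) (T1 ^ (q - \<delta>) * B)"
      by (rule deg_lt_T1_power[OF B]) (use b RS in \<open>auto simp: \<delta>_def\<close>)
    obtain h f where fh: "T1 ^ (q - \<delta>) * B = monom 1 R * h + f" "deg_lt b f"
      using alt_on_0_split[OF Z[unfolded ex] dB, of b] b RS by (metis diff_add le_add_diff_inverse order_refl)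
    have eq: "B + monom 1 q * B = monom 1 R * (T1 ^ \<delta> * h) + T1 ^ \<delta> * f"
      unfolding Tq[symmetric] fh(1) by (simp add: algebra_simps)
    \<comment> \<open>The same syzygy entered from the other side: \<open>B\<close> is given and
      \<open>A\<close> is recovered.\<close>
    define A where "A = monom 1 (q - R) * B - T1 ^ \<delta> * h"
    have "monom 1 q * B = monom 1 R * (monom 1 (q - R) * B)"
      using RS by (simp add: mult.assoc[symmetric] mult_monom)
    from eq[unfolded this] have TA: "T1 ^ \<delta> * f = monom 1 R * A + B"
      by (simp add: A_def algebra_simps)
    have "alt_on R b 0 (T1 ^ \<delta> * f)"
      unfolding TA by (rule alt_on_0_sum[OF B]) (use b in simp)
    then have "f = 0" by (rule regb[OF fh(2)])
    with TA have "monom 1 R * A = - B" by (simp add: eq_neg_iff_add_eq_0)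
    moreover have "deg_lt R (- B)" using B deg_lt_mono[of "R - b" B R] by (simp add: deg_lt_def)
    ultimately have "deg_lt (R + 0) (monom 1 R * A)" by simp
    then have "A = 0" by (simp only: deg_lt_monom_iff deg_lt_0_iff)
    with \<open>monom 1 R * A = - B\<close> show "B = 0" by simp
  qed
qed

text \<open>Passing to a complementary pair is an involution, since \<open>q - (q - R) = R\<close>
  and \<open>S - (S - b) = b\<close>; a second transfer gives the converse.\<close>

lemma regular_transfer_iff:
  fixes q :: nat
  assumes frob: "(T1 :: 'f::field poly) ^ q = 1 + monom 1 q"
    and b: "b \<le> R" "b \<le> S" "R + S \<le> q + b" and RS: "R \<le> q" "S \<le> q"
  shows "regular TYPE('f) (q - R) S (S - b) \<longleftrightarrow> regular TYPE('f) R S b"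
    and "regular TYPE('f) R (q - S) (R - b) \<longleftrightarrow> regular TYPE('f) R S b"
proof -
  show "regular TYPE('f) (q - R) S (S - b) \<longleftrightarrow> regular TYPE('f) R S b"
    using regular_transfer(1)[OF frob, of R S b] regular_transfer(1)[OF frob, of "q - R" S "S - b"] b RS by auto
  show "regular TYPE('f) R (q - S) (R - b) \<longleftrightarrow> regular TYPE('f) R S b"
    using regular_transfer(2)[OF frob, of R S b] regular_transfer(2)[OF frob, of R "q - S" "R - b"] b RS by auto
qed

text \<open>If \<open>R + S > q\<close>, the reflection takes this index to
  \<open>q - R = min (q - R) S\<close>, which is regular. No interval therefore straddles the point
  where the reflection stops being defined.\<close>

lemma regular_excess:
  fixes q :: nat
  assumes frob: "(T1 :: 'f::field poly) ^ q = 1 + monom 1 q" and RS: "R \<le> q" "S \<le> q"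
  shows "regular TYPE('f) R S (R + S - q)"
proof (cases "R + S \<le> q")
  case True
  then show ?thesis by (simp add: regular_0)
next
  case False
  have "regular TYPE('f) (q - R) S (S - (R + S - q))"
    using regular_min[of "q - R" S] False RS by (simp add: min_def split: if_splits)
  then show ?thesis using regular_transfer_iff(1)[OF frob, of "R + S - q" R S] False RS by auto
qed

text \<open>The reflection \<open>l \<mapsto> S + 1 - l\<close> reverses the order of the regular indices, so it exchanges the
  two ends of a block.\<close>

lemma lo_hi_transfer:
  fixes q :: nat and R S l :: nat
  assumes frob: "(T1 :: 'f::field poly) ^ q = 1 + monom 1 q" and RS: "R \<le> q" "S \<le> q"
    and l: "R + S - q < l" "l \<le> min R S"
  defines "a \<equiv> lo TYPE('f) R S l" and "b \<equiv> hi TYPE('f) R S l"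
  shows "lo TYPE('f) (q - R) S (Suc S - l) = S - b" "hi TYPE('f) (q - R) S (Suc S - l) = S - a"
    "lo TYPE('f) R (q - S) (Suc R - l) = R - b" "hi TYPE('f) R (q - S) (Suc R - l) = R - a"
    "R + S - q \<le> a"
proof -
  have ea: "R + S - q \<le> a"
    unfolding a_def using l(1) regular_excess[OF frob RS] by (rule le_lo)
  have ab: "a < l" "l \<le> b" "b \<le> R" "b \<le> S"
    using l lo_less[of l "TYPE('f)" R S] le_hi[OF l(2), of "TYPE('f)"] hi_le[OF l(2), of "TYPE('f)"]
    by (auto simp: a_def b_def)
  have reg: "regular TYPE('f) R S a" "regular TYPE('f) R S b"
    using l regular_lo[of l "TYPE('f)" R S] regular_hi[OF l(2), of "TYPE('f)"] by (auto simp: a_def b_def)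
  have nreg: "\<not> regular TYPE('f) R S i" if "a < i" "i < b" for i
    using no_regular_between[of l R S "TYPE('f)" i] l that by (auto simp: a_def b_def)
  have n1: "\<not> regular TYPE('f) (q - R) S i" if "S - b < i" "i < S - a" for i
    using nreg[of "S - i"] regular_transfer_iff(1)[OF frob, of "S - i" R S] that ea ab RS by auto
  have n2: "\<not> regular TYPE('f) R (q - S) i" if "R - b < i" "i < R - a" for i
    using nreg[of "R - i"] regular_transfer_iff(2)[OF frob, of "R - i" R S] that ea ab RS by auto
  have r: "regular TYPE('f) (q - R) S (S - b)" "regular TYPE('f) (q - R) S (S - a)"
    "regular TYPE('f) R (q - S) (R - b)" "regular TYPE('f) R (q - S) (R - a)"
    using reg ea ab RS regular_transfer_iff[OF frob, of _ R S] by auto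
  show "lo TYPE('f) (q - R) S (Suc S - l) = S - b" using ab n1 r by (intro lo_eqI) auto
  show "hi TYPE('f) (q - R) S (Suc S - l) = S - a" using ab n1 r by (intro hi_eqI) auto
  show "lo TYPE('f) R (q - S) (Suc R - l) = R - b" using ab n2 r by (intro lo_eqI) auto
  show "hi TYPE('f) R (q - S) (Suc R - l) = R - a" using ab n2 r by (intro hi_eqI) auto
  show "R + S - q \<le> a" by (rule ea)
qed

section \<open>Generators of complementary blocks\<close>

text \<open>Below degree \<open>Q\<close> the hypothesis reads \<open>U = c / (1 + x)\<close>, a
  geometric series.\<close>

lemma coeff_geometric:
  fixes U :: "'f::field poly"
  assumes "T1 * U = [:c:] + monom 1 Q" "j < Q"
  shows "coeff U j = c * (- 1) ^ j"
  using assms(2)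
proof (induction j)
  case 0
  have "coeff (T1 * U) 0 = c" unfolding assms(1) using 0 by (simp add: coeff_monom)
  then show ?case by (simp add: coeff_T1_mult)
next
  case (Suc j)
  have "coeff (T1 * U) (Suc j) = 0" unfolding assms(1) using Suc.prems by (simp add: coeff_monom)
  then show ?case using Suc by (simp add: coeff_T1_mult add_eq_0_iff2)
qed

text \<open>From the degree of \<open>h\<close> on, the coefficients of
  \<open>c * h / (1 + x)\<close> are those of its polar part
  \<open>c * h(-1) / (1 + x)\<close>.\<close>

lemma coeff_geometric_mult:
  fixes U h :: "'f::field poly"
  assumes U: "T1 * U = [:c:] + monom 1 Q" and h: "deg_lt (Suc H) h" and i: "H \<le> i" "i < Q"
  shows "coeff (U * h) i = c * (- 1) ^ i * poly h (- 1)"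
proof -
  have "coeff (h * U) i = (\<Sum>j\<le>i. coeff h j * coeff U (i - j))" by (rule coeff_mult)
  also have "\<dots> = (\<Sum>j\<le>i. c * (- 1) ^ i * (coeff h j * (- 1) ^ j))"
  proof (intro sum.cong refl)
    fix j assume "j \<in> {..i}"
    then have "(- 1 :: 'f) ^ (i - j) = (- 1) ^ i * (- 1) ^ j"
      by (simp add: power_add flip: neg_one_power_add_eq_neg_one_power_diff)
    then show "coeff h j * coeff U (i - j) = c * (- 1) ^ i * (coeff h j * (- 1) ^ j)"
      using coeff_geometric[OF U, of "i - j"] i by simp
  qed
  also have "\<dots> = c * (- 1) ^ i * (\<Sum>j\<le>i. coeff h j * (- 1) ^ j)"
    by (simp only: sum_distrib_left)
  also have "(\<Sum>j\<le>i. coeff h j * (- 1) ^ j) = poly h (- 1)"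
  proof -
    have "degree h \<le> i" using h i by (simp add: deg_lt_Suc_iff)
    then show ?thesis by (simp add: poly_altdef) (intro sum.mono_neutral_right; auto simp: coeff_eq_0)
  qed
  finally show ?thesis by (simp add: mult.commute)
qed

text \<open>Both generators come from the same syzygy: reducing \<open>T\<^sup>q\<^sup>-\<^sup>\<mu> \<beta>\<close> modulo
  \<open>(x\<^sup>q\<^sup>-\<^sup>R, y\<^sup>S)\<close> yields \<open>f\<close> and \<open>h\<close>, and \<open>T\<^sup>\<mu> f - x\<^sup>R \<beta>\<close> is then a multiple of
  \<open>\<gamma>\<close>; comparing two coefficients gives the factor.\<close>

lemma string_pair:
  fixes \<beta> \<gamma> :: "'f::field poly" and q :: nat
  assumes frob: "(T1 :: 'f poly) ^ q = 1 + monom 1 q" and sgn: "(- 1 :: 'f) ^ q = - 1"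
    and ab: "a < b" "b \<le> R" "b \<le> S" "R + S \<le> q + a" and RS: "R < q" "S < q"
    and reg: "regular TYPE('f) R (q - S) (R - b)"
    and \<beta>: "string (q - R) S (S - b) (S - a) \<beta>"
    and \<gamma>: "string R (q - S) (R - b) (R - a) \<gamma>"
  obtains h where "monom 1 (q - R) * \<gamma> + smult ((- 1) ^ R) \<beta> = T1 ^ (R + S - a - b) * h"
    "poly h (- 1) = 1" "deg_lt (Suc (q + a - R - S)) h"
proof -
  define \<mu> where "\<mu> = R + S - a - b"
  define N where "N = q - \<mu> - 1"
  define e where "e = Suc (q + a - R - S)"
  have \<mu>: "0 < \<mu>" "\<mu> < q" "(q - \<mu>) + \<mu> = q" "Suc N = q - \<mu>" "N + \<mu> = q - 1"
    using ab RS by (auto simp: \<mu>_def N_def)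
  have lenB: "q - R + S - (S - b) - (S - a) = q - \<mu>"
    and lenC: "R + (q - S) - (R - b) - (R - a) = q - \<mu>"
    using ab RS by (auto simp: \<mu>_def)
  have Tq: "T1 ^ \<mu> * (T1 ^ (q - \<mu>) * F) = F + monom 1 q * F" for F :: "'f poly"
    using \<mu> frob by (simp add: mult.assoc[symmetric] distrib_right add.commute flip: power_add)
  have d\<beta>: "deg_lt (Suc (S - b)) \<beta>" and x\<beta>: "alt_on (q - R) (S - a) 1 (T1 ^ N * \<beta>)"
    using \<beta> unfolding string_def lenB N_def by blast+
  have d\<gamma>: "deg_lt (Suc (R - b)) \<gamma>" and x\<gamma>: "alt_on R (R - a) 1 (T1 ^ N * \<gamma>)"
    using \<gamma> unfolding string_def lenC N_def by blast+
  have z\<beta>: "alt_on (q - R) (S - a - 1) 0 (T1 ^ (q - \<mu>) * \<beta>)"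
    using string_kernel[OF \<beta>] lenB by simp
  have dT\<beta>: "deg_lt (q - R + Suc a) (T1 ^ (q - \<mu>) * \<beta>)"
    by (rule deg_lt_T1_power[OF d\<beta>]) (use ab RS in \<open>auto simp: \<mu>_def\<close>)
  \<comment> \<open>As \<open>\<beta>\<close> ends at \<open>x_{S-a}\<close>, one more factor
    \<open>T1\<close> lands in the ideal \<open>(x^(q-R), y^S)\<close>; \<open>f\<close> and
    \<open>h0\<close> describe the two summands.\<close>
  obtain f h0 where fh: "T1 ^ (q - \<mu>) * \<beta> = monom 1 (q - R) * f + h0" "deg_lt e h0" "deg_lt (Suc a) f"
  proof -
    have "q - R \<le> e + (S - a - 1)" using ab RS by (auto simp: e_def)
    from alt_on_0_split[OF z\<beta> dT\<beta> this] that show ?thesis by (metis add_diff_cancel_left')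
  qed
  \<comment> \<open>The third leg of the syzygy: it inherits the degree bound of
    \<open>\<gamma>\<close> from \<open>B1\<close> and the same kernel condition, hence is a
    multiple of \<open>\<gamma>\<close>.\<close>
  define B where "B = T1 ^ \<mu> * f - monom 1 R * \<beta>"
  have mq: "monom 1 q * F = monom 1 (q - R) * (monom 1 R * F)" for F :: "'f poly"
    using RS by (simp add: mult.assoc[symmetric] mult_monom)
  have "\<beta> + monom 1 (q - R) * (monom 1 R * \<beta>) = monom 1 (q - R) * (T1 ^ \<mu> * f) + T1 ^ \<mu> * h0"
    unfolding mq[symmetric] Tq[symmetric] fh(1) by (simp add: algebra_simps)
  then have B1: "monom 1 (q - R) * B = \<beta> - T1 ^ \<mu> * h0"
    by (simp add: B_def algebra_simps)
  have "deg_lt ((q - R) + Suc (R - b)) (\<beta> - T1 ^ \<mu> * h0)"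
    by (intro deg_lt_diff deg_lt_T1_power[OF fh(2)] deg_lt_mono[OF d\<beta>])
      (use ab RS in \<open>auto simp: e_def \<mu>_def\<close>)
  then have dB: "deg_lt (Suc (R - b)) B" by (metis B1 deg_lt_monom_iff)
  have "T1 ^ (q - \<mu>) * B = monom 1 R * (- h0) + f"
  proof -
    have "T1 ^ (q - \<mu>) * B = T1 ^ \<mu> * (T1 ^ (q - \<mu>) * f) - monom 1 R * (T1 ^ (q - \<mu>) * \<beta>)"
      by (simp add: B_def algebra_simps)
    also have "\<dots> = f + monom 1 q * f - monom 1 R * (monom 1 (q - R) * f + h0)"
      unfolding Tq fh(1) ..
    also have "monom 1 R * (monom 1 (q - R) * f + h0) = monom 1 q * f + monom 1 R * h0"
      unfolding mq by (simp add: algebra_simps)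
    finally show ?thesis by simp
  qed
  moreover have "alt_on R (R - a - 1) 0 (monom 1 R * (- h0) + f)"
    by (rule alt_on_0_sum[OF fh(3)]) (use ab in simp)
  ultimately have "alt_on R (R - a - 1) 0 (T1 * (T1 ^ N * B))"
    using \<mu>(4) by (metis mult.assoc power_Suc)
  moreover have "deg_lt (R + (q - S) - (R - a)) (T1 ^ N * B)"
    by (rule deg_lt_T1_power[OF dB]) (use ab RS in \<open>auto simp: N_def \<mu>_def\<close>)
  ultimately obtain \<kappa> where \<kappa>: "alt_on R (R - a) \<kappa> (T1 ^ N * B)"
    using alt_on_T1_kernel[of R "q - S" "R - a" "T1 ^ N * B"] ab RS by auto
  have "B - smult \<kappa> \<gamma> = 0"
  proof (rule string_top_inj[OF reg \<gamma>])
    show "deg_lt (Suc (R - b)) (B - smult \<kappa> \<gamma>)"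
      by (intro deg_lt_diff deg_lt_smult dB d\<gamma>)
    have "alt_on R (R - a) (\<kappa> - \<kappa> * 1) (T1 ^ N * B - smult \<kappa> (T1 ^ N * \<gamma>))"
      by (intro alt_on_diff \<kappa> alt_on_smult x\<gamma>)
    then show "alt_on R (R - a) 0 (T1 ^ (R + (q - S) - (R - b) - (R - a) - 1) * (B - smult \<kappa> \<gamma>))"
      unfolding lenC by (simp add: N_def algebra_simps)
  qed
  then have B\<gamma>: "B = smult \<kappa> \<gamma>" by simp
  have "T1 ^ N * (monom 1 (q - R) * B - \<beta>) = T1 ^ (q - 1) * (- h0)"
    unfolding B1 \<mu>(5)[symmetric] power_add by (simp add: algebra_simps)
  then have eq: "monom 1 (q - R) * (T1 ^ N * B) - T1 ^ N * \<beta> = T1 ^ (q - 1) * (- h0)"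
    by (simp add: algebra_simps)
  have geo: "T1 * T1 ^ (q - 1) = [:1 :: 'f:] + monom 1 q"
    using frob \<mu> RS by (cases q) (auto simp: one_pCons)
  have dh: "deg_lt e (- h0)" using fh(2) by (simp add: deg_lt_def)
  note co = coeff_geometric_mult[OF geo dh[unfolded e_def]]
  \<comment> \<open>At \<open>q - 1\<close> only the term with \<open>B\<close> contributes, giving
    \<open>\<kappa>\<close>; at \<open>q - R - 1\<close> only \<open>\<beta>\<close> contributes,
    giving -1. Both equal the value of \<open>- h0\<close> at -1 up to a known sign, whence
    \<open>\<kappa> = - ((- 1) ^ R)\<close>.\<close>
  have "coeff (monom 1 (q - R) * (T1 ^ N * B) - T1 ^ N * \<beta>) (q - 1) = \<kappa>"
  proof -
    have "deg_lt (q - 1) (T1 ^ N * \<beta>)"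
      by (rule deg_lt_T1_power[OF d\<beta>]) (use ab RS in \<open>auto simp: N_def \<mu>_def\<close>)
    moreover have "coeff (T1 ^ N * B) (R - 1) = \<kappa>"
      using \<kappa>[unfolded alt_on_def, rule_format, of "R - 1"] ab by simp
    moreover have "q - 1 - (q - R) = R - 1" using RS by simp
    ultimately show ?thesis using ab RS by (simp add: coeff_monom_mult' deg_lt_def)
  qed
  moreover have "(- 1 :: 'f) ^ (q - 1) = 1"
    using sgn RS by (cases q) auto
  ultimately have k1: "\<kappa> = poly (- h0) (- 1)"
    using co[of "q - 1"] ab RS unfolding eq by simp
  have "coeff (monom 1 (q - R) * (T1 ^ N * B) - T1 ^ N * \<beta>) (q - R - 1) = - 1"
    using x\<beta>[unfolded alt_on_def, rule_format, of "q - R - 1"] ab RS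
    by (simp add: coeff_monom_mult')
  then have "- 1 = (- 1) ^ (q - R - 1) * poly (- h0) (- 1)"
    using co[of "q - R - 1"] ab RS unfolding eq by simp
  then have "- ((- 1) ^ R * (- 1) ^ Suc 0) = ((- 1) ^ R * (- 1) ^ (q - R - 1) * (- 1) ^ Suc 0) * poly (- h0) (- 1)"
    by (metis (no_types, lifting) mult.assoc mult.commute mult_minus_right mult.right_neutral)
  also have "(- 1 :: 'f) ^ R * (- 1) ^ (q - R - 1) * (- 1) ^ Suc 0 = (- 1) ^ q"
    unfolding power_add[symmetric] using RS by simp
  finally have k2: "\<kappa> = - ((- 1) ^ R)" unfolding k1 sgn by (simp add: minus_equation_iff eq_commute)
  have kk: "\<kappa> * \<kappa> = 1" unfolding k2 by (simp add: power_mult_distrib flip: power_add mult_2)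
  \<comment> \<open>Multiplication by \<open>\<kappa>\<close>, whose square is 1, normalises the
    value of \<open>h\<close> at -1 to 1.\<close>
  show ?thesis
  proof (rule that[of "smult \<kappa> (- h0)"])
    have "smult \<kappa> (monom 1 (q - R) * B - \<beta>) = smult \<kappa> (T1 ^ \<mu> * (- h0))"
      unfolding B1 by simp
    then have "smult (\<kappa> * \<kappa>) (monom 1 (q - R) * \<gamma>) - smult \<kappa> \<beta> = T1 ^ \<mu> * smult \<kappa> (- h0)"
      by (simp add: B\<gamma> smult_diff_right)
    then show "monom 1 (q - R) * \<gamma> + smult ((- 1) ^ R) \<beta> = T1 ^ (R + S - a - b) * smult \<kappa> (- h0)"
      unfolding kk by (simp add: k2 \<mu>_def)
    show "poly (smult \<kappa> (- h0)) (- 1) = 1" using k1 kk by simp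
    show "deg_lt (Suc (q + a - R - S)) (smult \<kappa> (- h0))"
      using dh by (intro deg_lt_smult) (simp add: e_def)
  qed
qed

section \<open>Alternating sums under the substitution x to x^q\<close>

definition alt_poly :: "nat \<Rightarrow> 'f::field poly"
  where "alt_poly t = (\<Sum>i\<le>t. monom ((- 1) ^ i) (t - i))"

text \<open>Only the variable is raised to the power \<open>q\<close>, the coefficients stay; on
  \<open>T1\<close>, whose coefficients are 1, this agrees with the \<open>q\<close>-th power when
  \<open>q\<close> is a power of the characteristic.\<close>

abbreviation frob :: "nat \<Rightarrow> 'f::field poly \<Rightarrow> 'f poly"
  where "frob q F \<equiv> pcompose F (monom 1 q)"

lemma coeff_alt_poly: "coeff (alt_poly t) i = (if i \<le> t then (- 1) ^ (t - i) else 0)"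
proof -
  have "coeff (alt_poly t :: 'a poly) i = (\<Sum>j\<le>t. if j = t - i \<and> i \<le> t then (- 1) ^ j else 0)"
    unfolding alt_poly_def coeff_sum by (intro sum.cong) (auto simp: coeff_monom)
  then show ?thesis by (simp add: sum.delta)
qed

text \<open>\<open>alt_poly t\<close> is the quotient of \<open>x^(t+1) - (-1)^(t+1)\<close> by
  \<open>x + 1\<close>.\<close>

lemma T1_alt_poly: "T1 * alt_poly t = [:(- 1) ^ t:] + (monom 1 (Suc t) :: 'f::field poly)"
  by (rule poly_eqI) (auto simp: coeff_T1_mult coeff_alt_poly coeff_monom coeff_pCons Suc_diff_le
      not_le le_less_Suc_eq split: nat.splits)

lemma frob_monom: "frob q (monom c k) = monom c (q * k)" for c :: "'f::field"
  by (induction k arbitrary: c)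
    (simp_all add: monom_0 monom_Suc pcompose_pCons mult_monom add.commute)

text \<open>Times \<open>T1\<close>, the product of \<open>frob q (alt_poly t)\<close> and
  \<open>T1 ^ (q - 1)\<close> is \<open>(-1)^t + x^((t+1)q)\<close>, so this product is a truncated
  geometric series; multiplied by \<open>h\<close> it alternates from degree \<open>H\<close> on,
  scaled by \<open>h(-1) = 1\<close>.\<close>

lemma alternating_block:
  fixes h :: "'f::field poly"
  assumes frob: "(T1 :: 'f poly) ^ q = 1 + monom 1 q" and sgn: "(- 1 :: 'f) ^ q = - 1" and "0 < q"
    and h: "deg_lt (Suc H) h" "poly h (- 1) = 1"
  shows "alt_on (Suc t * q) (Suc t * q - H) 1 (frob q (alt_poly t) * (T1 ^ (q - 1) * h))"
proof -
  have "T1 * (frob q (alt_poly t) * T1 ^ (q - 1)) = frob q (alt_poly t) * T1 ^ q"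
    using \<open>0 < q\<close> by (cases q) (simp_all add: mult_ac)
  also have "T1 ^ q = frob q (T1 :: 'f poly)" unfolding frob by (simp add: T1_def pcompose_pCons one_pCons)
  also have "frob q (alt_poly t) * frob q T1 = frob q (T1 * alt_poly t :: 'f poly)"
    by (simp add: pcompose_mult mult.commute)
  also have "\<dots> = [:(- 1) ^ t:] + monom 1 (Suc t * q)"
    unfolding T1_alt_poly by (simp add: pcompose_add frob_monom mult.commute)
  finally have geo: "T1 * (frob q (alt_poly t) * T1 ^ (q - 1)) = [:(- 1 :: 'f) ^ t:] + monom 1 (Suc t * q)" .
  show ?thesis
    unfolding alt_on_def
  proof (intro allI impI)
    fix i assume i: "i < Suc t * q" "Suc t * q \<le> i + (Suc t * q - H)"
    have "coeff (frob q (alt_poly t) * T1 ^ (q - 1) * h) i = (- 1) ^ t * (- 1) ^ i * poly h (- 1)"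
      using i by (intro coeff_geometric_mult[OF geo h(1)]) auto
    moreover have "(- 1 :: 'f) ^ t * (- 1) ^ i = (- 1) ^ (Suc t * q - 1 - i)"
    proof -
      have "(- 1 :: 'f) ^ (Suc t * q - Suc i) = (- 1) ^ (Suc t * q) * (- 1) ^ Suc i"
        unfolding power_add[symmetric]
        by (rule neg_one_power_add_eq_neg_one_power_diff[symmetric]) (use i in simp)
      also have "(- 1 :: 'f) ^ (Suc t * q) = (- 1) ^ Suc t" using sgn by (metis mult.commute power_mult)
      finally show ?thesis by simp
    qed
    ultimately show "coeff (frob q (alt_poly t) * (T1 ^ (q - 1) * h)) i = 1 * (- 1) ^ (Suc t * q - 1 - i)"
      using h(2) by (simp add: mult.assoc)
  qed
qed

section \<open>Regularity in small degrees by a Wronskian argument\<close>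

lemma coeff_mult_top:
  fixes F G :: "'f::field poly"
  assumes "degree F \<le> d" "degree G \<le> e"
  shows "coeff (F * G) (d + e) = coeff F d * coeff G e"
proof -
  have "coeff (F * G) (d + e) = (\<Sum>j\<le>d + e. coeff F j * coeff G (d + e - j))" by (rule coeff_mult)
  also have "\<dots> = (\<Sum>j\<le>d + e. if j = d then coeff F d * coeff G e else 0)"
  proof (intro sum.cong refl)
    fix j
    consider "d < j" | "j = d" | "j < d" "e < d + e - j" by linarith
    then show "coeff F j * coeff G (d + e - j) = (if j = d then coeff F d * coeff G e else 0)"
      using assms by cases (auto simp: coeff_eq_0)
  qed
  finally show ?thesis by simp
qed

lemma degree_pderiv_le': "degree (pderiv F) \<le> degree F - 1" for F :: "'f::field poly"
  by (rule degree_le) (auto simp: coeff_pderiv coeff_eq_0)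

lemma pderiv_T1: "pderiv T1 = 1"
  by (simp add: T1_def pderiv_pCons)

text \<open>In small degree the characteristic plays no role: a relation \<open>T\<^sup>c F = x\<^sup>r A + B\<close> is excluded by
  comparing the degree of the Wronskian of \<open>x\<^sup>r A\<close> and \<open>B\<close> with its zeros at \<open>0\<close> and \<open>-1\<close>.\<close>

lemma regular_small:
  assumes p: "prime p" "CHAR('f::field) = p" and a: "a \<le> r" "a \<le> s" "r + s \<le> p + a"
  shows "regular TYPE('f) r s a"
  unfolding regular_def
proof (intro allI impI)
  fix F :: "'f poly"
  assume F: "deg_lt a F" and Z: "alt_on r a 0 (T1 ^ (r + s - 2 * a) * F)"
  define c where "c = r + s - 2 * a"
  have dT: "deg_lt (r + (s - a)) (T1 ^ c * F)" by (rule deg_lt_T1_power[OF F]) (use a in \<open>simp add: c_def\<close>)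
  obtain A B where AB: "T1 ^ c * F = monom 1 r * A + B" "deg_lt (r - a) B" "deg_lt (s - a) A"
    using alt_on_0_split[OF Z[folded c_def] dT, of "r - a"] a by auto
  show "F = 0"
  proof (rule ccontr)
    assume "F \<noteq> 0"
    have "A \<noteq> 0"
    proof
      assume "A = 0"
      then have "deg_lt (r - a) (T1 ^ c * F)" using AB by simp
      moreover have "degree (T1 ^ c * F) = c + degree F"
        using \<open>F \<noteq> 0\<close> by (subst degree_mult_eq) (auto simp: degree_T1_power)
      then have "r - a \<le> degree (T1 ^ c * F)" using a by (simp add: c_def)
      ultimately have "lead_coeff (T1 ^ c * F) = 0" by (simp add: deg_lt_def)
      then show False using \<open>F \<noteq> 0\<close> by simp
    qed
    have "B \<noteq> 0"
    proof
      assume "B = 0"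
      then have "coeff (T1 ^ c * F) i = 0" if "i < r" for i
        using that by (simp add: AB(1) coeff_monom_mult')
      then have "coeff F i = 0" if "i < r" for i using that low_coeffs_T1_power by blast
      then have "F = 0" using F a by (metis coeff_0 deg_lt_def le_trans not_le_imp_less poly_eqI)
      with \<open>F \<noteq> 0\<close> show False ..
    qed
    define U where "U = monom 1 r * A"
    have "U \<noteq> 0" using \<open>A \<noteq> 0\<close> by (simp add: U_def)
    define u v where "u = degree U" and "v = degree B"
    have u: "u = r + degree A" unfolding u_def U_def
      using \<open>A \<noteq> 0\<close> by (subst degree_mult_eq) (auto simp: degree_monom_eq)
    have "degree A < s - a" using AB(3) \<open>A \<noteq> 0\<close> by (metis deg_lt_def leading_coeff_0_iff not_le_imp_less)
    moreover have "v < r - a" using AB(2) \<open>B \<noteq> 0\<close> v_def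
      by (metis deg_lt_def leading_coeff_0_iff not_le_imp_less)
    \<comment> \<open>\<open>u < p\<close> is where \<open>r + s <= p + a\<close> enters.\<close>
    ultimately have uv: "v < u" "u < p" "u + v + 3 \<le> 2 * r + s - 2 * a + 1" "0 < r" "0 < c"
      using u a by (auto simp: c_def)
    define W where "W = U * pderiv B - pderiv U * B"
    have dW: "degree W \<le> u + v - 1"
    proof (rule degree_le, intro allI impI)
      fix i assume i: "u + v - 1 < i"
      have "degree (U * pderiv B) < i" if "pderiv B \<noteq> 0"
      proof -
        have "degree B \<noteq> 0"
        proof
          assume "degree B = 0"
          then have "pderiv B = 0" by (auto simp: poly_eq_iff coeff_pderiv coeff_eq_0)
          with that show False by simp
        qed
        have "degree (U * pderiv B) \<le> u + (v - 1)"
          using degree_mult_le[of U "pderiv B"] degree_pderiv_le'[of B] by (simp add: u_def v_def)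
        then show ?thesis using i \<open>degree B \<noteq> 0\<close> by (simp add: v_def)
      qed
      then have 1: "coeff (U * pderiv B) i = 0" by (cases "pderiv B = 0") (auto intro: coeff_eq_0)
      have "degree (pderiv U * B) \<le> (u - 1) + v"
        using degree_mult_le[of "pderiv U" B] degree_pderiv_le'[of U] by (simp add: u_def v_def)
      then have "coeff (pderiv U * B) i = 0" using i uv by (intro coeff_eq_0) auto
      with 1 show "coeff W i = 0" by (simp add: W_def)
    qed
    \<comment> \<open>The top coefficients cancel only if \<open>u\<close> and \<open>v\<close>
      agree in the field, which \<open>0 < u - v < p\<close> excludes.\<close>
    have "coeff W (u + v - 1) \<noteq> 0"
    proof -
      have "coeff (U * pderiv B) (u + v - 1) = lead_coeff U * (of_nat v * lead_coeff B)"
      proof (cases "v = 0")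
        case True
        then have "pderiv B = 0" by (auto simp: poly_eq_iff coeff_pderiv v_def coeff_eq_0)
        then show ?thesis using True by simp
      next
        case False
        have "coeff (U * pderiv B) (u + (v - 1)) = coeff U u * coeff (pderiv B) (v - 1)"
          using degree_pderiv_le'[of B] by (intro coeff_mult_top) (auto simp: u_def v_def)
        then show ?thesis using False by (simp add: coeff_pderiv u_def v_def)
      qed
      moreover have "coeff (pderiv U * B) (u + v - 1) = of_nat u * lead_coeff U * lead_coeff B"
      proof -
        have "coeff (pderiv U * B) ((u - 1) + v) = coeff (pderiv U) (u - 1) * coeff B v"
          using degree_pderiv_le'[of U] by (intro coeff_mult_top) (auto simp: u_def v_def)
        then show ?thesis using uv by (simp add: coeff_pderiv u_def v_def)
      qed
      ultimately have "coeff W (u + v - 1) = (of_nat v - of_nat u) * (lead_coeff U * lead_coeff B)"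
        by (simp add: W_def algebra_simps)
      moreover have "(of_nat v :: 'f) \<noteq> of_nat u"
      proof
        assume "(of_nat v :: 'f) = of_nat u"
        then have "(of_nat (u - v) :: 'f) = 0" using uv by (simp add: of_nat_diff)
        then have "p dvd u - v" using p by (simp add: of_nat_eq_0_iff_char_dvd)
        then show False using uv by (auto dest: dvd_imp_le)
      qed
      ultimately show ?thesis using \<open>U \<noteq> 0\<close> \<open>B \<noteq> 0\<close> by simp
    qed
    then have "W \<noteq> 0" by auto
    obtain c' where c': "c = Suc c'" using uv by (cases c) auto
    \<comment> \<open>What remains of \<open>W\<close> after removing the factor
      \<open>T1 ^ (c - 1)\<close> shared by \<open>T1 ^ c * F\<close> and its derivative.\<close>
    define G where "G = T1 * F * pderiv B - smult (of_nat c) (F * B) - T1 * pderiv F * B"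
    have "W = (T1 ^ c * F) * pderiv B - pderiv (T1 ^ c * F) * B"
      unfolding AB(1) W_def U_def pderiv_add by (simp add: algebra_simps)
    also have "pderiv (T1 ^ c * F) = T1 ^ c' * (smult (of_nat c) F + T1 * pderiv F)"
      unfolding c' pderiv_mult pderiv_power_Suc pderiv_T1 by (simp add: algebra_simps)
    also have "(T1 ^ c * F) * pderiv B - T1 ^ c' * (smult (of_nat c) F + T1 * pderiv F) * B = T1 ^ c' * G"
      by (simp add: c' G_def algebra_simps)
    finally have WG: "W = T1 ^ c' * G" .
    have "coeff W i = 0" if "i < r - 1" for i
    proof -
      have 1: "coeff U j = 0" if "j < r" for j using that by (simp add: U_def coeff_monom_mult')
      have "coeff (U * pderiv B) i = 0"
        unfolding coeff_mult using 1 that by (intro sum.neutral) auto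
      moreover have "coeff (pderiv U * B) i = 0"
        unfolding coeff_mult using 1 that by (intro sum.neutral) (auto simp: coeff_pderiv)
      ultimately show ?thesis by (simp add: W_def)
    qed
    then have "coeff G i = 0" if "i < r - 1" for i using low_coeffs_T1_power that WG by metis
    moreover have "G \<noteq> 0" using WG \<open>W \<noteq> 0\<close> by auto
    ultimately have "r - 1 \<le> degree G" by (metis leading_coeff_0_iff not_le_imp_less)
    moreover have "degree W = c' + degree G"
      unfolding WG using \<open>G \<noteq> 0\<close> by (subst degree_mult_eq) (auto simp: degree_T1_power)
    \<comment> \<open>Zeros of order \<open>c - 1\<close> at -1 and \<open>r - 1\<close> at 0 exceed
      the degree bound \<open>u + v - 1\<close> by at least one.\<close>
    ultimately show False using dW uv c' a by (auto simp: c_def)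
  qed
qed

section \<open>Block matrices of binomial coefficients\<close>

text \<open>Entry \<open>i\<close> belongs to a first index that increases with \<open>i\<close>,
  hence to an exponent of \<open>x\<close> that decreases; this explains the reversal.\<close>

definition rev_poly :: "nat \<Rightarrow> (nat \<Rightarrow> 'f::field) \<Rightarrow> 'f poly"
  where "rev_poly t v = (\<Sum>i\<le>t. monom (v i) (t - i))"

lemma coeff_rev_poly: "coeff (rev_poly t v) j = (if j \<le> t then v (t - j) else 0)"
proof -
  have "coeff (rev_poly t v) j = (\<Sum>i\<le>t. if i = t - j \<and> j \<le> t then v i else 0)"
    unfolding rev_poly_def coeff_sum by (intro sum.cong) (auto simp: coeff_monom)
  then show ?thesis by (simp add: sum.delta)
qed

lemma deg_lt_rev_poly: "deg_lt (Suc t) (rev_poly t v)"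
  by (simp add: deg_lt_def coeff_rev_poly)

lemma coeff_T1_power: "coeff (T1 ^ c) n = (of_nat (c choose n) :: 'f::field)"
proof (induction c arbitrary: n)
  case (Suc c)
  show ?case by (cases n) (simp_all add: coeff_T1_mult Suc)
qed (simp add: binomial_eq_0)

lemma coeff_T1_power_rev_poly:
  assumes "i \<le> t" "t < r"
  shows "coeff (T1 ^ c * rev_poly t v) (r - 1 - i) =
    (\<Sum>j\<le>t. binom (int c) (int r - 1 - int t + int j - int i) * v j)"
proof -
  have "T1 ^ c * rev_poly t v = (\<Sum>j\<le>t. monom (v j) (t - j) * T1 ^ c)"
    unfolding rev_poly_def by (simp add: sum_distrib_left mult.commute)
  then have "coeff (T1 ^ c * rev_poly t v) (r - 1 - i) =
      (\<Sum>j\<le>t. if t - j \<le> r - 1 - i then v j * of_nat (c choose (r - 1 - i - (t - j))) else 0)"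
    by (auto simp: coeff_sum coeff_monom_mult coeff_T1_power intro!: sum.cong)
  also have "\<dots> = (\<Sum>j\<le>t. binom (int c) (int r - 1 - int t + int j - int i) * v j)"
  proof (intro sum.cong refl)
    fix j assume j: "j \<in> {..t}"
    show "(if t - j \<le> r - 1 - i then v j * of_nat (c choose (r - 1 - i - (t - j))) else 0) =
        binom (int c) (int r - 1 - int t + int j - int i) * v j"
    proof (cases "t - j \<le> r - 1 - i")
      case True
      then have "int r - 1 - int t + int j - int i = int (r - 1 - i - (t - j))"
        using assms j by auto
      then show ?thesis using True by (simp add: binom_def binomial_eq_0 mult.commute)
    next
      case False
      then show ?thesis using assms j by (auto simp: binom_def)
    qed
  qed
  finally show ?thesis .
qed

text \<open>\<open>M\<close> is the matrix of \<open>T^c\<close> from \<open>D_{r+s-t-1}\<close> to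
  \<open>D_{t+1}\<close> in \<open>V_r \<otimes> V_s\<close>, so regularity at \<open>t + 1\<close>
  is its invertibility, and the solution of the system with right-hand side \<open>X\<close> lists
  the coordinates of the preimage of \<open>x_{t+1}\<close>.\<close>

lemma toeplitz_system:
  fixes M X :: "'f::field mat"
  assumes reg: "regular TYPE('f) r s (Suc t)" and t: "t < r" "t < s"
    and c: "c = r + s - 2 * Suc t"
    and M: "M = mat1 (t + 1) (t + 1) (\<lambda>i j. binom (int c) (int r - 1 - int t + int j - int i))"
    and X: "X = mat1 (t + 1) 1 (\<lambda>i j. (- 1) ^ (i - 1))"
  shows "invertible_mat M"
    and "alt_on r (Suc t) 1 (T1 ^ c * rev_poly t (\<lambda>i. ent (the (mat_inverse M) * X) (i + 1) 1))"
proof -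
  have cM: "M \<in> carrier_mat (t + 1) (t + 1)" and cX: "X \<in> carrier_mat (t + 1) 1"
    by (simp_all add: M X mat1_def)
  have Mv: "(M *\<^sub>v v) $ i = coeff (T1 ^ c * rev_poly t (\<lambda>i. v $ i)) (r - 1 - i)"
    if "i \<le> t" "v \<in> carrier_vec (t + 1)" for v i
  proof -
    have "(M *\<^sub>v v) $ i = (\<Sum>j<t + 1. binom (int c) (int r - 1 - int t + int j - int i) * v $ j)"
    proof -
      have "(M *\<^sub>v v) $ i = (\<Sum>j<t + 1. M $$ (i, j) * v $ j)"
        using that cM by (simp add: scalar_prod_def lessThan_atLeast0)
      also have "\<dots> = (\<Sum>j<t + 1. binom (int c) (int r - 1 - int t + int j - int i) * v $ j)"
        using that by (intro sum.cong refl) (simp add: M mat1_def algebra_simps)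
      finally show ?thesis .
    qed
    also have "{..<t + 1} = {..t}" by auto
    finally show ?thesis unfolding coeff_T1_power_rev_poly[OF that(1) t(1)] .
  qed
  have alt: "alt_on r (Suc t) x (T1 ^ c * rev_poly t (\<lambda>i. v $ i))"
    if "\<And>i. i \<le> t \<Longrightarrow> (M *\<^sub>v v) $ i = x * (- 1) ^ i" "v \<in> carrier_vec (t + 1)" for v x
    unfolding alt_on_def
  proof (intro allI impI)
    fix i assume "i < r" "r \<le> i + Suc t"
    then show "coeff (T1 ^ c * rev_poly t (\<lambda>i. v $ i)) i = x * (- 1) ^ (r - 1 - i)"
      using that(1)[of "r - 1 - i"] Mv[OF _ that(2), of "r - 1 - i"] by auto
  qed
  have "det M \<noteq> 0"
  proof
    assume "det M = 0"
    then obtain v where v: "v \<in> carrier_vec (t + 1)" "v \<noteq> 0\<^sub>v (t + 1)" "M *\<^sub>v v = 0\<^sub>v (t + 1)"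
      using det_0_iff_vec_prod_zero_field[OF cM] by auto
    have "alt_on r (Suc t) 0 (T1 ^ c * rev_poly t (\<lambda>i. v $ i))"
      by (rule alt) (use v in auto)
    then have "rev_poly t (\<lambda>i. v $ i) = 0"
      unfolding c by (rule reg[unfolded regular_def, rule_format, OF deg_lt_rev_poly])
    then have "v $ i = 0" if "i \<le> t" for i
      using coeff_rev_poly[of t "\<lambda>i. v $ i" "t - i"] that by simp
    then have "v = 0\<^sub>v (t + 1)" using v(1) by (intro eq_vecI) auto
    with v(2) show False ..
  qed
  have U: "M \<in> Units (ring_mat TYPE('f) (t + 1) ())"
    by (rule det_non_zero_imp_unit[OF cM \<open>det M \<noteq> 0\<close>])
  obtain N where N: "mat_inverse M = Some N"
    using mat_inverse(1)[OF cM, of "()"] U by (cases "mat_inverse M") auto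
  have N': "M * N = 1\<^sub>m (t + 1)" "N * M = 1\<^sub>m (t + 1)" "N \<in> carrier_mat (t + 1) (t + 1)"
    using mat_inverse(2)[OF cM N] by auto
  then show "invertible_mat M"
    using cM unfolding invertible_mat_def inverts_mat_def by auto
  define v where "v = col (N * X) 0"
  have v: "v \<in> carrier_vec (t + 1)" unfolding v_def by (intro carrier_vecI) (use N' in auto)
  have "M *\<^sub>v v = col (M * (N * X)) 0"
    unfolding v_def using cM N' cX by (subst col_mult2[of _ "t + 1" "t + 1" _ 1]) auto
  also have "M * (N * X) = X"
    using cM N' cX by (simp flip: assoc_mult_mat)
  finally have "(M *\<^sub>v v) $ i = 1 * (- 1) ^ i" if "i \<le> t" for i
    using that by (simp add: X mat1_def)
  from alt[OF this v] have "alt_on r (Suc t) 1 (T1 ^ c * rev_poly t (\<lambda>i. v $ i))" .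
  moreover have "rev_poly t (\<lambda>i. v $ i) = rev_poly t (\<lambda>i. ent (the (mat_inverse M) * X) (i + 1) 1)"
    unfolding rev_poly_def
    by (intro sum.cong refl arg_cong2[where f = monom]) (use N' cX in \<open>auto simp: ent_def v_def N\<close>)
  ultimately show "alt_on r (Suc t) 1 (T1 ^ c * rev_poly t (\<lambda>i. ent (the (mat_inverse M) * X) (i + 1) 1))"
    by simp
qed

text \<open>Since \<open>C\<close> has width \<open>e\<close>, the term of index \<open>E\<close> in
  \<open>D\<close> only reaches the exponents \<open>E * q, ..., E * q + e - 1\<close>.\<close>

lemma coeff_frob_mult_eq_0:
  fixes D C :: "'f::field poly"
  assumes "deg_lt e C" "\<And>E. E * q \<le> i \<Longrightarrow> i < E * q + e \<Longrightarrow> coeff D E = 0"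
  shows "coeff (frob q D * C) i = 0"
proof -
  have "frob q D = frob q (\<Sum>E\<le>degree D. monom (coeff D E) E)" by (simp add: poly_as_sum_of_monoms)
  also have "\<dots> = (\<Sum>E\<le>degree D. monom (coeff D E) (q * E))" by (simp add: pcompose_sum frob_monom)
  finally have "coeff (frob q D * C) i = (\<Sum>E\<le>degree D. coeff (monom (coeff D E) (q * E) * C) i)"
    by (simp add: sum_distrib_right coeff_sum)
  also have "\<dots> = 0"
  proof (intro sum.neutral ballI)
    fix E
    show "coeff (monom (coeff D E) (q * E) * C) i = 0"
    proof (cases "E * q \<le> i \<and> i < E * q + e")
      case True
      then show ?thesis using assms(2)[of E] by (simp add: coeff_monom_mult)
    next
      case False
      then have "q * E \<le> i \<Longrightarrow> coeff C (i - q * E) = 0"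
        using assms(1) by (auto simp: deg_lt_def mult.commute)
      then show ?thesis by (simp add: coeff_monom_mult)
    qed
  qed
  finally show ?thesis .
qed

text \<open>The coordinate polynomials of \<open>z\<^sub>\<ell>\<close>, with base index \<open>(t + 1) q\<close>, and of \<open>y\<^sub>\<ell>\<close>, with base index \<open>r\<close>.\<close>

definition z_poly :: "nat \<Rightarrow> nat \<Rightarrow> nat \<Rightarrow> 'f::field poly \<Rightarrow> 'f poly \<Rightarrow> 'f poly"
  where "z_poly q R t C B = frob q (alt_poly t) * (monom 1 (q - R) * C + smult ((- 1) ^ R) B)"

definition y_poly :: "nat \<Rightarrow> nat \<Rightarrow> 'f::field poly \<Rightarrow> 'f poly \<Rightarrow> 'f poly \<Rightarrow> 'f poly \<Rightarrow> 'f poly"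
  where "y_poly q R \<Phi> \<Psi> C B = frob q \<Phi> * C + smult ((- 1) ^ R) (monom 1 R * (frob q \<Psi> * B))"

section \<open>The passage from y to z and the value of y at -1\<close>

lemma frob_T1_power:
  fixes F :: "'f::field poly"
  assumes "(T1 :: 'f poly) ^ q = 1 + monom 1 q"
  shows "T1 ^ (c * q) * frob q F = frob q (T1 ^ c * F)"
proof -
  have "frob q (T1 :: 'f poly) = T1 ^ q"
    unfolding assms by (simp add: T1_def pcompose_pCons one_pCons)
  then have "frob q (T1 ^ c :: 'f poly) = T1 ^ (c * q)"
    by (induction c) (simp_all add: pcompose_mult power_add pcompose_1)
  then show ?thesis by (simp add: pcompose_mult)
qed

lemma monom_frob: "monom 1 (E * q) * frob q F = frob q (monom 1 E * F)" for F :: "'f::field poly"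
  by (simp add: pcompose_mult frob_monom mult.commute)

lemma coeff_diff_alt_poly:
  fixes F :: "'f::field poly"
  assumes "alt_on (Suc e + t) (Suc t) 1 F" "e \<le> i" "i \<le> e + t"
  shows "coeff (F - monom 1 e * alt_poly t) i = 0"
proof -
  have "coeff F i = (- 1) ^ (e + t - i)" using assms by (auto simp: alt_on_def)
  moreover have "e + t - i = t - (i - e)" using assms by simp
  ultimately show ?thesis using assms by (simp add: coeff_monom_mult' coeff_alt_poly)
qed

text \<open>The differences \<open>D1\<close> and \<open>D2\<close> vanish at every block index that
  the window meets. The \<open>C\<close>-terms start at exponents \<open>E * q\<close> with
  \<open>E <= rn\<close>, the \<open>B\<close>-terms at \<open>E * q + R\<close> with
  \<open>E < rn\<close>; this is why \<open>\<Phi>\<close> solves the system with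
  \<open>rn + 1\<close> blocks and \<open>\<Psi>\<close> the one with \<open>rn\<close>.\<close>

lemma y_poly_to_z_poly:
  fixes C B \<Phi> \<Psi> :: "'f::field poly"
  assumes frob: "(T1 :: 'f poly) ^ q = 1 + monom 1 q"
    and C: "deg_lt (k - S) C" and B: "deg_lt (k - R) B"
    and RS: "R < q" "S < q" "R < k" "S < k" "k \<le> q" "k \<le> R + S" and t: "t < rn"
    and \<Phi>: "alt_on (Suc rn) (Suc t) 1 (T1 ^ c * \<Phi>)" and \<Psi>: "alt_on rn (Suc t) 1 (T1 ^ c * \<Psi>)"
    and r: "r = rn * q + R"
  shows "alt_on r (Suc t * q + R + S - k) 0
    (T1 ^ (c * q) * y_poly q R \<Phi> \<Psi> C B - monom 1 (r - Suc t * q) * z_poly q R t C B)"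
proof -
  define e where "e = rn - 1 - t"
  have rn: "rn = Suc e + t" using t by (simp add: e_def)
  define D1 where "D1 = T1 ^ c * \<Phi> - monom 1 (Suc e) * alt_poly t"
  define D2 where "D2 = T1 ^ c * \<Psi> - monom 1 e * alt_poly t"
  have r1: "r - Suc t * q = e * q + R" by (simp add: r rn algebra_simps)
  have D1: "coeff D1 i = 0" if "Suc e \<le> i" "i \<le> Suc e + t" for i
    unfolding D1_def using \<Phi> that by (intro coeff_diff_alt_poly) (simp_all add: rn)
  have D2: "coeff D2 i = 0" if "e \<le> i" "i \<le> e + t" for i
    unfolding D2_def using \<Psi> that by (intro coeff_diff_alt_poly) (simp_all add: rn)
  have m1: "monom 1 (e * q + R) * (monom 1 (q - R) * (frob q (alt_poly t) * C)) =
      frob q (monom 1 (Suc e) * alt_poly t) * C"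
    unfolding monom_frob[symmetric] mult.assoc[symmetric] mult_monom
    using RS by (simp add: add.commute)
  have m2: "monom 1 (e * q + R) * (frob q (alt_poly t) * B) =
      monom 1 R * (frob q (monom 1 e * alt_poly t) * B)"
    unfolding monom_frob[symmetric] mult.assoc[symmetric] mult_monom by (simp add: add.commute)
  have "T1 ^ (c * q) * y_poly q R \<Phi> \<Psi> C B = T1 ^ (c * q) * frob q \<Phi> * C
      + smult ((- 1) ^ R) (monom 1 R * (T1 ^ (c * q) * frob q \<Psi> * B))"
    by (simp add: y_poly_def algebra_simps)
  also have "\<dots> = frob q (T1 ^ c * \<Phi>) * C + smult ((- 1) ^ R) (monom 1 R * (frob q (T1 ^ c * \<Psi>) * B))"
    unfolding frob_T1_power[OF frob] by simp
  also have "\<dots> - monom 1 (e * q + R) * z_poly q R t C B =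
      frob q D1 * C + smult ((- 1) ^ R) (monom 1 R * (frob q D2 * B))"
  proof -
    have "monom 1 (e * q + R) * z_poly q R t C B =
        monom 1 (e * q + R) * (monom 1 (q - R) * (frob q (alt_poly t) * C)) +
        smult ((- 1) ^ R) (monom 1 (e * q + R) * (frob q (alt_poly t) * B))"
      by (simp add: z_poly_def algebra_simps smult_add_right)
    then show ?thesis unfolding m1 m2 D1_def D2_def pcompose_diff
      by (simp add: algebra_simps smult_diff_right smult_add_right)
  qed
  finally have eq: "T1 ^ (c * q) * y_poly q R \<Phi> \<Psi> C B - monom 1 (r - Suc t * q) * z_poly q R t C B =
      frob q D1 * C + smult ((- 1) ^ R) (monom 1 R * (frob q D2 * B))" unfolding r1 .
  show ?thesis
    unfolding alt_on_def eq
  proof (intro allI impI)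
    fix i assume i: "i < r" "r \<le> i + (Suc t * q + R + S - k)"
    have lb: "e * q + k \<le> i + S" using i RS by (auto simp: r rn algebra_simps)
    have ub: "i < Suc (e + t) * q + R" using i by (simp add: r rn)
    have "coeff (frob q D1 * C) i = 0"
    proof (rule coeff_frob_mult_eq_0[OF C])
      fix E assume E: "E * q \<le> i" "i < E * q + (k - S)"
      have "E * q < Suc (Suc (e + t)) * q" using E ub RS by simp
      then have "E < Suc (Suc (e + t))" by (metis mult_less_cancel2)
      moreover have "e * q < E * q" using E lb RS by linarith
      then have "e < E" by (metis mult_less_cancel2)
      ultimately show "coeff D1 E = 0" by (intro D1) auto
    qed
    moreover have "coeff (monom 1 R * (frob q D2 * B)) i = 0"
    proof -
      have "coeff (frob q D2 * B) (i - R) = 0" if "R \<le> i"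
      proof (rule coeff_frob_mult_eq_0[OF B])
        fix E assume E: "E * q \<le> i - R" "i - R < E * q + (k - R)"
        have "E * q < Suc (e + t) * q" using E ub that by linarith
        then have "E < Suc (e + t)" by (metis mult_less_cancel2)
        moreover have "e * q < Suc E * q" using E lb RS that by simp
        then have "e < Suc E" by (metis mult_less_cancel2)
        ultimately show "coeff D2 E = 0" by (intro D2) auto
      qed
      then show ?thesis by (simp add: coeff_monom_mult')
    qed
    ultimately show "coeff (frob q D1 * C + smult ((- 1) ^ R) (monom 1 R * (frob q D2 * B))) i =
      0 * (- 1) ^ (r - 1 - i)" by simp
  qed
qed

text \<open>Up to a nonzero factor the sum is the value of \<open>y_poly\<close> at -1. If it
  vanished, \<open>T1\<close> would divide \<open>\<Phi> - x * \<Psi>\<close>; regularity of the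
  enlarged pair kills the quotient, so \<open>\<Phi> = x * \<Psi>\<close>, and then the degree bound
  on \<open>\<Phi>\<close> and regularity at \<open>t\<close> kill \<open>\<Psi>\<close>.\<close>

lemma frobenius_values_neq_0:
  fixes \<Phi> \<Psi> :: "'f::field poly"
  assumes reg: "regular TYPE('f) (Suc r) (Suc s) (Suc t)" "regular TYPE('f) r s t" and t: "t < r" "t < s"
    and \<Phi>: "deg_lt (Suc t) \<Phi>" "alt_on (Suc r) (Suc t) 1 (T1 ^ (r + s - 2 * t - 1) * \<Phi>)"
    and \<Psi>: "deg_lt (Suc t) \<Psi>" "alt_on r (Suc t) 1 (T1 ^ (r + s - 2 * t - 1) * \<Psi>)"
  shows "poly \<Phi> (- 1) + poly \<Psi> (- 1) \<noteq> 0"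
proof
  define c where "c = r + s - 2 * t - 1"
  have c: "Suc c = r + s - 2 * t" using t by (simp add: c_def)
  assume "poly \<Phi> (- 1) + poly \<Psi> (- 1) = 0"
  then have "poly (\<Phi> - monom 1 1 * \<Psi>) (- 1) = 0" by simp
  moreover have "deg_lt (Suc (Suc t)) (\<Phi> - monom 1 1 * \<Psi>)"
    by (intro deg_lt_diff deg_lt_monom[OF \<Psi>(1)] deg_lt_mono[OF \<Phi>(1)]) auto
  ultimately obtain u where u: "\<Phi> - monom 1 1 * \<Psi> = T1 * u" "deg_lt (Suc t) u"
    by (rule poly_minus_one_eq_0E)
  have "alt_on (Suc r) (Suc t) 1 (monom 1 1 * (T1 ^ c * \<Psi>))"
    unfolding alt_on_def
  proof (intro allI impI)
    fix i assume i: "i < Suc r" "Suc r \<le> i + Suc t"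
    then have "0 < i" using t by auto
    then have "coeff (T1 ^ c * \<Psi>) (i - 1) = 1 * (- 1) ^ (r - 1 - (i - 1))"
      using \<Psi>(2)[folded c_def, unfolded alt_on_def, rule_format, of "i - 1"] i by auto
    then show "coeff (monom 1 1 * (T1 ^ c * \<Psi>)) i = 1 * (- 1) ^ (Suc r - 1 - i)"
      using \<open>0 < i\<close> by (simp add: coeff_monom_mult')
  qed
  then have "alt_on (Suc r) (Suc t) (1 - 1) (T1 ^ c * \<Phi> - monom 1 1 * (T1 ^ c * \<Psi>))"
    by (intro alt_on_diff \<Phi>(2)[folded c_def])
  also have "T1 ^ c * \<Phi> - monom 1 1 * (T1 ^ c * \<Psi>) = T1 ^ c * (\<Phi> - monom 1 1 * \<Psi>)"
    by (simp add: algebra_simps)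
  also have "\<dots> = T1 ^ (r + s - 2 * t) * u" unfolding u(1) c[symmetric] by (simp add: algebra_simps)
  finally have "u = 0" using reg(1) u(2) by (simp add: regular_def)
  then have \<Phi>\<Psi>: "\<Phi> = monom 1 1 * \<Psi>" using u(1) by simp
  have "deg_lt t \<Psi>" using \<Phi>(1) deg_lt_monom_iff[of 1 t \<Psi>] unfolding \<Phi>\<Psi> by simp
  moreover have "alt_on r t 0 (T1 * (T1 ^ c * \<Psi>))"
    by (rule alt_on_T1[OF \<Psi>(2)[folded c_def]]) (use t in simp)
  then have "alt_on r t 0 (T1 ^ (r + s - 2 * t) * \<Psi>)" unfolding c[symmetric] by (simp add: mult.assoc)
  ultimately have "\<Psi> = 0" using reg(2) by (simp add: regular_def)
  then have "alt_on r (Suc t) 1 (0 :: 'f poly)" using \<Psi>(2) by simp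
  then have "(1 :: 'f) = 0" by (rule alt_on_unique) (use t in auto)
  then show False by simp
qed

section \<open>The action of a cyclic group of prime power order\<close>

lemma sum_fun_apply: "(\<Sum>a\<in>A. f a) x = (\<Sum>a\<in>A. f a x)"
  by (induction A rule: infinite_finite_induct) auto

lemma fscale_apply [simp]: "(c *\<^sub>f u) i = c * u i"
  by (simp add: fscale_def)

definition supported :: "'i set \<Rightarrow> ('i \<Rightarrow> 'f::field) set"
  where "supported A = {u. \<forall>i. i \<notin> A \<longrightarrow> u i = 0}"

lemma supportedD: "u \<in> supported A \<Longrightarrow> i \<notin> A \<Longrightarrow> u i = 0"
  by (simp add: supported_def)

lemma subspace_supported: "fspace.subspace (supported A)"
  by (auto simp: fspace.subspace_def supported_def)

lemma bvec_supported: "i \<in> A \<Longrightarrow> bvec i \<in> supported A"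
  by (auto simp: bvec_def supported_def)

lemma supported_expansion:
  fixes u :: "'i \<Rightarrow> 'f::field"
  assumes "finite A" "u \<in> supported A"
  shows "u = (\<Sum>i\<in>A. u i *\<^sub>f bvec i)"
proof
  fix k
  have "(\<Sum>i\<in>A. u i *\<^sub>f bvec i) k = (\<Sum>i\<in>A. if i = k then u i else 0)"
    unfolding sum_fun_apply by (intro sum.cong) (auto simp: bvec_def)
  then show "u k = (\<Sum>i\<in>A. u i *\<^sub>f bvec i) k" using assms by (auto simp: supported_def)
qed

lemma span_bvec:
  assumes "finite A"
  shows "fspace.span (bvec ` A) = (supported A :: ('i \<Rightarrow> 'f::field) set)"
proof
  show "fspace.span (bvec ` A) \<subseteq> (supported A :: ('i \<Rightarrow> 'f) set)"
    by (rule fspace.span_minimal) (auto simp: subspace_supported bvec_supported)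
  show "(supported A :: ('i \<Rightarrow> 'f) set) \<subseteq> fspace.span (bvec ` A)"
  proof
    fix u :: "'i \<Rightarrow> 'f" assume "u \<in> supported A"
    then have "u = (\<Sum>i\<in>A. u i *\<^sub>f bvec i)" using assms by (intro supported_expansion)
    also have "\<dots> \<in> fspace.span (bvec ` A)"
      by (intro fspace.span_sum fspace.span_scale fspace.span_base) auto
    finally show "u \<in> fspace.span (bvec ` A)" .
  qed
qed

abbreviation flinear :: "(('i \<Rightarrow> 'f::field) \<Rightarrow> 'j \<Rightarrow> 'f) \<Rightarrow> bool"
  where "flinear \<equiv> Vector_Spaces.linear fscale fscale"

lemma flinearI:
  assumes "\<And>u w. \<phi> (u + w) = \<phi> u + \<phi> w" "\<And>c u. \<phi> (c *\<^sub>f u) = c *\<^sub>f \<phi> u"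
  shows "flinear \<phi>"
  using assms by unfold_locales (auto simp: fscale_def fun_eq_iff algebra_simps)

lemma flinear_simps:
  assumes "flinear \<phi>"
  shows "\<phi> (u + w) = \<phi> u + \<phi> w" "\<phi> (u - w) = \<phi> u - \<phi> w" "\<phi> (c *\<^sub>f u) = c *\<^sub>f \<phi> u" "\<phi> 0 = 0"
    "\<phi> (\<Sum>a\<in>A. f a) = (\<Sum>a\<in>A. \<phi> (f a))"
proof -
  interpret Vector_Spaces.linear fscale fscale \<phi> by (rule assms)
  show "\<phi> (u + w) = \<phi> u + \<phi> w" "\<phi> (u - w) = \<phi> u - \<phi> w" "\<phi> (c *\<^sub>f u) = c *\<^sub>f \<phi> u" "\<phi> 0 = 0"
    "\<phi> (\<Sum>a\<in>A. f a) = (\<Sum>a\<in>A. \<phi> (f a))"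
    by (auto simp: add diff scale sum)
qed

lemma flinear_funpow: "flinear \<phi> \<Longrightarrow> flinear (\<phi> ^^ n)"
  for \<phi> :: "('i \<Rightarrow> 'f::field) \<Rightarrow> 'i \<Rightarrow> 'f"
proof (induction n)
  case 0
  show ?case by (rule flinearI) (simp_all only: funpow.simps id_apply)
next
  case (Suc n)
  note n = Suc.IH[OF Suc.prems]
  show ?case
    by (rule flinearI)
      (simp_all only: funpow.simps comp_apply flinear_simps[OF n] flinear_simps[OF Suc.prems])
qed

text \<open>Here \<open>x\<close> acts as \<open>v_i \<mapsto> v_{i-1}\<close>, so
  \<open>gen_map\<close> becomes the action of \<open>T1\<close>; coordinate 0 is suppressed because
  the basis starts at 1.\<close>

definition poly_act :: "'f::field poly \<Rightarrow> (nat \<Rightarrow> 'f) \<Rightarrow> nat \<Rightarrow> 'f"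
  where "poly_act P u k = (if k = 0 then 0 else \<Sum>i\<le>degree P. coeff P i * u (k + i))"

lemma poly_act_bound:
  assumes "degree P \<le> n" "0 < k"
  shows "poly_act P u k = (\<Sum>i\<le>n. coeff P i * u (k + i))"
  using assms unfolding poly_act_def by (auto intro!: sum.mono_neutral_left intro: le_degree simp: coeff_eq_0)

lemma gen_map_apply:
  "gen_map q u k = (if 1 \<le> k \<and> k \<le> q then u k + (if k < q then u (Suc k) else 0) else 0)"
proof -
  have "gen_map q u k = (\<Sum>i = 1..q. if i = k then u k else 0) +
      (\<Sum>i = 1..q. if i = Suc k \<and> 1 \<le> k then u (Suc k) else 0)"
    unfolding gen_map_def sum_fun_apply sum.distrib[symmetric]
    by (intro sum.cong) (auto simp: bvec_def)
  also have "(\<Sum>i = 1..q. if i = k then u k else 0) = (if 1 \<le> k \<and> k \<le> q then u k else 0)"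
    by (auto simp: sum.delta)
  also have "(\<Sum>i = 1..q. if i = Suc k \<and> 1 \<le> k then u (Suc k) else 0) =
      (if 1 \<le> k \<and> k < q then u (Suc k) else 0)"
    by (auto simp: sum.delta)
  finally show ?thesis by auto
qed

lemma flinear_gen_map: "flinear (gen_map q)"
  by (rule flinearI) (auto simp: gen_map_apply fun_eq_iff algebra_simps)

lemma gen_map_supported: "gen_map q u \<in> supported {1..q}"
  by (auto simp: supported_def gen_map_apply)

lemma gen_map_funpow_supported: "u \<in> supported {1..q} \<Longrightarrow> (gen_map q ^^ n) u \<in> supported {1..q}"
  by (cases n) (simp_all only: funpow.simps comp_apply id_apply gen_map_supported)

lemma gen_map_eq:
  assumes "u \<in> supported {1..q}"
  shows "gen_map q u = (\<lambda>k. if k = 0 then 0 else u k + u (Suc k))"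
  using assms by (auto simp: gen_map_apply fun_eq_iff supported_def)

lemma gen_map_funpow:
  fixes u :: "nat \<Rightarrow> 'f::field"
  assumes u: "u \<in> supported {1..q}"
  shows "(gen_map q ^^ n) u = poly_act (T1 ^ n) u"
proof (induction n)
  case 0
  then show ?case using u by (auto simp: poly_act_def fun_eq_iff supported_def)
next
  case (Suc n)
  have "(gen_map q ^^ Suc n) u = gen_map q ((gen_map q ^^ n) u)" by simp
  also have "\<dots> = (\<lambda>k. if k = 0 then 0 else poly_act (T1 ^ n) u k + poly_act (T1 ^ n) u (Suc k))"
    by (subst gen_map_eq[OF gen_map_funpow_supported[OF u]]) (simp only: Suc)
  also have "\<dots> = poly_act (T1 ^ Suc n) u"
  proof
    fix k
    show "(if k = 0 then 0 else poly_act (T1 ^ n) u k + poly_act (T1 ^ n) u (Suc k)) = poly_act (T1 ^ Suc n) u k"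
    proof (cases "k = 0")
      case False
      have "poly_act (T1 ^ Suc n) u k = (\<Sum>i\<le>Suc n. coeff (T1 ^ Suc n) i * u (k + i))"
        using False by (intro poly_act_bound) (simp_all add: degree_T1_power del: power_Suc)
      also have "\<dots> = (\<Sum>i\<le>Suc n. coeff (T1 ^ n) i * u (k + i)) +
          (\<Sum>i\<le>Suc n. (if i = 0 then 0 else coeff (T1 ^ n) (i - 1)) * u (k + i))"
        unfolding power_Suc coeff_T1_mult by (simp only: distrib_right sum.distrib)
      also have "(\<Sum>i\<le>Suc n. coeff (T1 ^ n) i * u (k + i)) = poly_act (T1 ^ n) u k"
        using False by (intro poly_act_bound[symmetric]) (simp_all add: degree_T1_power)
      also have "(\<Sum>i\<le>Suc n. (if i = 0 then 0 else coeff (T1 ^ n) (i - 1)) * u (k + i)) =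
          (\<Sum>i\<le>n. coeff (T1 ^ n) i * u (Suc k + i))"
        unfolding sum.atMost_Suc_shift by simp
      also have "\<dots> = poly_act (T1 ^ n) u (Suc k)"
        by (intro poly_act_bound[symmetric]) (simp_all add: degree_T1_power)
      finally show ?thesis using False by simp
    qed (simp add: poly_act_def)
  qed
  finally show ?case .
qed

section \<open>The group and its action in coordinates\<close>

locale cyclic_p_group =
  fixes G :: "('g, 'b) monoid_scheme" and g :: 'g and p a :: nat and K :: "'f::field itself"
  assumes prime_p: "prime p" and char_p: "CHAR('f) = p"
    and group_G: "group G" and g_in: "g \<in> carrier G" and cyclic: "subgroup_generated G {g} = G"
    and a_pos: "a > 0" and order_G: "order G = p ^ a"
begin

abbreviation q :: nat where "q \<equiv> order G"

lemma T1_power_q: "(T1 :: 'f poly) ^ q = 1 + monom 1 q"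
  unfolding order_G by (rule T1_power_char_power[OF prime_p char_p])

lemma one_less_q: "1 < q"
  unfolding order_G using prime_p a_pos by (metis one_less_power prime_gt_1_nat)

text \<open>\<open>T1 ^ q = 1 + x^q\<close>, and \<open>x^q\<close> annihilates
  \<open>V_q\<close>.\<close>

lemma gen_map_q:
  fixes u :: "nat \<Rightarrow> 'f"
  assumes u: "u \<in> supported {1..q}"
  shows "(gen_map q ^^ q) u = u"
proof
  fix k
  have "poly_act (T1 ^ q) u k = u k"
  proof (cases "k = 0")
    case True
    then show ?thesis using u by (simp add: poly_act_def supported_def)
  next
    case False
    have "poly_act (T1 ^ q) u k = (\<Sum>i\<le>q. coeff (1 + monom 1 q) i * u (k + i))"
      unfolding T1_power_q[symmetric] using False by (intro poly_act_bound) (simp_all add: degree_T1_power)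
    also have "\<dots> = (\<Sum>i\<le>q. if i = 0 then u k else 0)"
      using u False one_less_q
      by (intro sum.cong refl) (auto simp: coeff_monom coeff_1 supported_def)
    finally show ?thesis by (simp add: sum.delta)
  qed
  then show "(gen_map q ^^ q) u k = u k" by (simp add: gen_map_funpow[OF u])
qed

lemma ord_g: "group.ord G g = q"
proof -
  interpret group G by (rule group_G)
  have "carrier G = generate G {g}"
    using cyclic g_in carrier_subgroup_generated[of G "{g}"] by (simp add: Int_absorb1)
  then show ?thesis using generate_pow_card[OF g_in] by (simp add: Coset.order_def)
qed

lemma pow_eq_iff: "g [^]\<^bsub>G\<^esub> (m :: nat) = g [^]\<^bsub>G\<^esub> (n :: nat) \<longleftrightarrow> m mod q = n mod q"
proof -
  interpret group G by (rule group_G)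
  have "m mod q = n mod q \<longleftrightarrow> int q dvd int m - int n"
    by (metis mod_eq_dvd_iff of_nat_eq_iff zmod_int)
  also have "\<dots> \<longleftrightarrow> g [^]\<^bsub>G\<^esub> (int m - int n) = \<one>\<^bsub>G\<^esub>"
    using int_pow_eq_id[OF g_in] ord_g by simp
  also have "\<dots> \<longleftrightarrow> g [^]\<^bsub>G\<^esub> m = g [^]\<^bsub>G\<^esub> n"
  proof -
    have "g [^]\<^bsub>G\<^esub> (int m - int n) = g [^]\<^bsub>G\<^esub> m \<otimes>\<^bsub>G\<^esub> inv\<^bsub>G\<^esub> (g [^]\<^bsub>G\<^esub> n)"
      using g_in by (simp add: int_pow_diff int_pow_int)
    moreover have "\<one>\<^bsub>G\<^esub> = g [^]\<^bsub>G\<^esub> n \<otimes>\<^bsub>G\<^esub> inv\<^bsub>G\<^esub> (g [^]\<^bsub>G\<^esub> n)" using g_in by simp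
    ultimately show ?thesis using g_in by (metis inv_closed nat_pow_closed right_cancel)
  qed
  finally show ?thesis by simp
qed

lemma carrier_cases:
  assumes "h \<in> carrier G"
  obtains n :: nat where "h = g [^]\<^bsub>G\<^esub> n"
proof -
  interpret group G by (rule group_G)
  have "h \<in> range (\<lambda>n::int. g [^]\<^bsub>G\<^esub> n)"
    using carrier_subgroup_generated_by_singleton[OF g_in] cyclic assms by simp
  then obtain i :: int where i: "h = g [^]\<^bsub>G\<^esub> i" by auto
  have "g [^]\<^bsub>G\<^esub> i = g [^]\<^bsub>G\<^esub> (i mod int q)"
  proof -
    have "g [^]\<^bsub>G\<^esub> (i - i mod int q) = \<one>\<^bsub>G\<^esub>"
      using int_pow_eq_id[OF g_in] ord_g by (simp add: minus_mod_eq_mult_div)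
    then show ?thesis using g_in int_pow_mult[of g "i - i mod int q" "i mod int q"] by simp
  qed
  also have "i mod int q = int (nat (i mod int q))" using one_less_q by simp
  finally show ?thesis using that i by (metis int_pow_int)
qed

text \<open>Exponents of the same group element agree modulo \<open>q\<close>, and the
  \<open>q\<close>-th power of the generator acts trivially, so the least exponent chosen in
  \<open>vact\<close> may be replaced by any other.\<close>

lemma vact_pow:
  fixes u :: "nat \<Rightarrow> 'f"
  assumes u: "u \<in> supported {1..q}"
  shows "vact G g (g [^]\<^bsub>G\<^esub> (n :: nat)) u = (gen_map q ^^ n) u"
proof -
  define k where "k = (LEAST k. g [^]\<^bsub>G\<^esub> (k :: nat) = g [^]\<^bsub>G\<^esub> n)"
  have "g [^]\<^bsub>G\<^esub> k = g [^]\<^bsub>G\<^esub> n" unfolding k_def by (rule LeastI[of _ n]) simp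
  then have "k mod q = n mod q" by (simp add: pow_eq_iff)
  moreover have "(gen_map q ^^ m) u = (gen_map q ^^ (m mod q)) u" for m
  proof -
    have "(gen_map q ^^ (q * j)) u = u" for j
      by (induction j) (simp_all add: funpow_add gen_map_q[OF u])
    then have "(gen_map q ^^ (m mod q + q * (m div q))) u = (gen_map q ^^ (m mod q)) u"
      unfolding funpow_add comp_apply by (rule arg_cong)
    then show ?thesis by (simp only: mod_mult_div_eq)
  qed
  ultimately have "(gen_map q ^^ k) u = (gen_map q ^^ n) u" by metis
  then show ?thesis by (simp add: vact_def k_def)
qed

lemma vact_g: "u \<in> supported {1..q} \<Longrightarrow> vact G g g u = gen_map q u" for u :: "nat \<Rightarrow> 'f"
proof -
  interpret group G by (rule group_G)
  show "u \<in> supported {1..q} \<Longrightarrow> vact G g g u = gen_map q u"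
    using vact_pow[of u 1] g_in by simp
qed

lemma flinear_vact: "flinear (vact G g h)"
  unfolding vact_def by (rule flinear_funpow[OF flinear_gen_map])

lemma vact_supported: "u \<in> supported {1..q} \<Longrightarrow> vact G g h u \<in> supported {1..q}" for u :: "nat \<Rightarrow> 'f"
  unfolding vact_def by (rule gen_map_funpow_supported)

lemma vact_int_pow_Suc:
  fixes u :: "nat \<Rightarrow> 'f" and i :: int
  assumes "u \<in> supported {1..q}"
  shows "vact G g (g [^]\<^bsub>G\<^esub> (i + 1)) u = vact G g (g [^]\<^bsub>G\<^esub> i) (gen_map q u)"
    "gen_map q (vact G g (g [^]\<^bsub>G\<^esub> i) u) = vact G g (g [^]\<^bsub>G\<^esub> i) (gen_map q u)"
proof -
  interpret group G by (rule group_G)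
  obtain n :: nat where n: "g [^]\<^bsub>G\<^esub> i = g [^]\<^bsub>G\<^esub> n" using carrier_cases[of "g [^]\<^bsub>G\<^esub> i"] g_in by auto
  have "g [^]\<^bsub>G\<^esub> (i + 1) = g [^]\<^bsub>G\<^esub> Suc n" using g_in n by (simp add: int_pow_mult)
  then show "vact G g (g [^]\<^bsub>G\<^esub> (i + 1)) u = vact G g (g [^]\<^bsub>G\<^esub> i) (gen_map q u)"
    using vact_pow[OF assms, of "Suc n"] vact_pow[OF gen_map_supported, of n u]
    by (simp add: n funpow_swap1)
  show "gen_map q (vact G g (g [^]\<^bsub>G\<^esub> i) u) = vact G g (g [^]\<^bsub>G\<^esub> i) (gen_map q u)"
    using vact_pow[OF assms, of n] vact_pow[OF gen_map_supported, of n u]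
    by (simp add: n funpow_swap1)
qed

lemma vact_inj:
  fixes u :: "nat \<Rightarrow> 'f"
  assumes "u \<in> supported {1..q}" "vact G g h u = 0" "h \<in> carrier G"
  shows "u = 0"
proof -
  obtain n :: nat where n: "h = g [^]\<^bsub>G\<^esub> n" by (rule carrier_cases[OF assms(3)])
  have "(gen_map q ^^ n) u = 0" using assms vact_pow n by simp
  then have "(gen_map q ^^ (q * n - n)) ((gen_map q ^^ n) u) = 0"
    by (simp add: flinear_simps(4)[OF flinear_funpow[OF flinear_gen_map]])
  moreover have "(gen_map q ^^ (q * n - n)) ((gen_map q ^^ n) u) = (gen_map q ^^ (q * n)) u"
  proof -
    have "q * n = (q * n - n) + n" using one_less_q by simp
    then show ?thesis by (metis comp_apply funpow_add)
  qed
  moreover have "(gen_map q ^^ (q * j)) u = u" for j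
    by (induction j) (simp_all add: funpow_add gen_map_q[OF assms(1)])
  ultimately show ?thesis by simp
qed

lemma flinear_tact: "flinear (tact G g h)"
  unfolding tact_def
  by (rule flinearI)
    (simp_all add: fun_eq_iff sum_fun_apply distrib_right sum.distrib sum_distrib_left mult.assoc)

lemma flinear_gm1: "flinear (gm1 G g)"
  unfolding gm1_def by (rule flinearI) (auto simp: flinear_simps[OF flinear_tact] fun_eq_iff algebra_simps)

lemmas gm1_simps = flinear_simps[OF flinear_gm1]
lemmas gm1_funpow_simps = flinear_simps[OF flinear_funpow[OF flinear_gm1]]

lemma tact_tensor:
  fixes u w :: "nat \<Rightarrow> 'f"
  assumes u: "u \<in> supported {1..q}" and w: "w \<in> supported {1..q}"
  shows "tact G g h (u \<otimes>\<^sub>v w) = vact G g h u \<otimes>\<^sub>v vact G g h w"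
proof -
  have *: "vact G g h v = (\<Sum>i = 1..q. v i *\<^sub>f vact G g h (bvec i))" if "v \<in> supported {1..q}" for v :: "nat \<Rightarrow> 'f"
    by (subst supported_expansion[OF _ that])
      (simp_all add: flinear_simps[OF flinear_vact])
  show ?thesis
  proof
    fix x :: "nat \<times> nat"
    obtain k l where x: "x = (k, l)" by (cases x)
    have "(vact G g h u \<otimes>\<^sub>v vact G g h w) x =
      (\<Sum>i = 1..q. u i * vact G g h (bvec i) k) * (\<Sum>j = 1..q. w j * vact G g h (bvec j) l)"
      unfolding x tensor_def prod.case
      by (subst *[OF u], subst *[OF w]) (simp add: sum_fun_apply)
    also have "\<dots> = tact G g h (u \<otimes>\<^sub>v w) x"
      unfolding sum_product x tact_def by (simp add: sum_fun_apply tensor_def mult_ac)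
    finally show "tact G g h (u \<otimes>\<^sub>v w) x = (vact G g h u \<otimes>\<^sub>v vact G g h w) x" by simp
  qed
qed

lemma tensor_add_diff:
  "(A + B) \<otimes>\<^sub>v (C + D) - A \<otimes>\<^sub>v C = B \<otimes>\<^sub>v (C + D) + A \<otimes>\<^sub>v (D :: nat \<Rightarrow> 'f)"
  by (rule ext) (simp add: tensor_def algebra_simps split: prod.split)

lemma tensor_zero: "0 \<otimes>\<^sub>v A = 0" "A \<otimes>\<^sub>v 0 = (0 :: nat \<times> nat \<Rightarrow> 'f)"
  by (auto simp: tensor_def fun_eq_iff)

text \<open>The twist \<open>g^(\<nu>-i)\<close> is made for this: in
  \<open>g v_i = v_i + v_{i-1}\<close> the term \<open>v_{i-1}\<close> meets
  \<open>g^(\<nu>-i) g v_j = g^(\<nu>-(i-1)) v_j\<close>, exactly the twist that belongs to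
  \<open>i - 1\<close>.\<close>

lemma gm1_tvec:
  assumes "i \<le> int q" "j \<le> int q"
  shows "gm1 G g (tvec G g \<nu> i j :: nat \<times> nat \<Rightarrow> 'f) = tvec G g \<nu> (i - 1) j + tvec G g \<nu> i (j - 1)"
proof (cases "i \<le> 0 \<or> j \<le> 0")
  case True
  then show ?thesis by (auto simp: tvec_def gm1_simps)
next
  case False
  define i' j' where "i' = nat i" and "j' = nat j"
  have ij: "i' \<in> {1..q}" "j' \<in> {1..q}" "i = int i'" "j = int j'" using assms False by (auto simp: i'_def j'_def)
  define h where "h = g [^]\<^bsub>G\<^esub> (\<nu> - i)"
  have gb: "gen_map q (bvec k :: nat \<Rightarrow> 'f) = bvec k + (if k = 1 then 0 else bvec (k - 1))"
    if "k \<in> {1..q}" for k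
    using that by (auto simp: gen_map_apply fun_eq_iff bvec_def)
  have s: "bvec i' \<in> supported {1..q}" "(bvec j' :: nat \<Rightarrow> 'f) \<in> supported {1..q}"
    by (rule bvec_supported[OF ij(1)], rule bvec_supported[OF ij(2)])
  have e: "\<nu> - (i - 1) = (\<nu> - i) + 1" by simp
  have t: "tvec G g \<nu> i j = bvec i' \<otimes>\<^sub>v vact G g h (bvec j' :: nat \<Rightarrow> 'f)"
    using False by (simp add: tvec_def i'_def j'_def h_def)
  have "tact G g g (tvec G g \<nu> i j) = gen_map q (bvec i') \<otimes>\<^sub>v gen_map q (vact G g h (bvec j' :: nat \<Rightarrow> 'f))"
    unfolding t tact_tensor[OF s(1) vact_supported[OF s(2)]] vact_g[OF s(1)]
      vact_g[OF vact_supported[OF s(2)]] ..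
  also have "gen_map q (vact G g h (bvec j')) = vact G g h (gen_map q (bvec j' :: nat \<Rightarrow> 'f))"
    unfolding h_def by (rule vact_int_pow_Suc(2)[OF s(2)])
  finally have 1: "tact G g g (tvec G g \<nu> i j) =
      gen_map q (bvec i') \<otimes>\<^sub>v vact G g h (gen_map q (bvec j' :: nat \<Rightarrow> 'f))" .
  have 2: "tvec G g \<nu> (i - 1) j = (if i' = 1 then 0 else bvec (i' - 1)) \<otimes>\<^sub>v vact G g h (gen_map q (bvec j' :: nat \<Rightarrow> 'f))"
  proof (cases "i' = 1")
    case True
    then show ?thesis using ij by (simp add: tvec_def tensor_zero)
  next
    case i1: False
    have "nat (i - 1) = i' - 1" "\<not> (i - 1 \<le> 0 \<or> j \<le> 0)" "nat j = j'" using ij i1 by auto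
    then show ?thesis using i1
      unfolding tvec_def e h_def by (simp add: vact_int_pow_Suc(1)[OF s(2), of "\<nu> - i"])
  qed
  have 3: "tvec G g \<nu> i (j - 1) = bvec i' \<otimes>\<^sub>v vact G g h (if j' = 1 then 0 else bvec (j' - 1) :: nat \<Rightarrow> 'f)"
  proof (cases "j' = 1")
    case True
    then show ?thesis using ij by (simp add: tvec_def tensor_zero flinear_simps(4)[OF flinear_vact])
  next
    case j1: False
    have "nat (j - 1) = j' - 1" "\<not> (i \<le> 0 \<or> j - 1 \<le> 0)" "nat i = i'" using ij j1 by auto
    then show ?thesis using j1 unfolding tvec_def h_def by simp
  qed
  show ?thesis
    unfolding gm1_def 1 unfolding 2 3 t gb[OF ij(1)] gb[OF ij(2)] flinear_simps(1)[OF flinear_vact]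
    by (rule tensor_add_diff)
qed

text \<open>Only the \<open>v_{i,j}\<close> with the given \<open>i\<close> have first tensor factor
  \<open>v_i\<close>; the slice at \<open>i\<close> is \<open>g^(\<nu>-i)\<close> applied to the
  coefficient vector, and this action is injective.\<close>

lemma tvec_independent:
  fixes u :: "nat \<Rightarrow> nat \<Rightarrow> 'f"
  assumes "(\<Sum>i = 1..q. \<Sum>j = 1..q. u i j *\<^sub>f tvec G g \<nu> (int i) (int j)) = 0" "i \<in> {1..q}" "j \<in> {1..q}"
  shows "u i j = 0"
proof -
  define h where "h = g [^]\<^bsub>G\<^esub> (\<nu> - int i)"
  have h: "h \<in> carrier G" unfolding h_def using group.int_pow_closed[OF group_G g_in] .
  define w where "w = (\<Sum>j = 1..q. u i j *\<^sub>f bvec j)"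
  have ws: "w \<in> supported {1..q}" unfolding w_def
    by (intro fspace.subspace_sum fspace.subspace_scale subspace_supported bvec_supported)
  have "vact G g h w = 0"
  proof
    fix l
    have "(\<Sum>i' = 1..q. \<Sum>j = 1..q. u i' j *\<^sub>f tvec G g \<nu> (int i') (int j)) (i, l) =
        (\<Sum>i' = 1..q. if i' = i then \<Sum>j = 1..q. u i j * vact G g h (bvec j) l else 0)"
      unfolding sum_fun_apply
      by (intro sum.cong refl) (auto simp: tvec_def tensor_def bvec_def h_def sum_fun_apply intro!: sum.neutral sum.cong)
    also have "\<dots> = (\<Sum>j = 1..q. u i j * vact G g h (bvec j) l)" using assms(2) by simp
    also have "\<dots> = vact G g h w l"
      unfolding w_def by (simp add: flinear_simps[OF flinear_vact] sum_fun_apply)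
    finally show "vact G g h w l = 0 l" using assms(1) by simp
  qed
  then have "w = 0" using vact_inj[OF ws _ h] by simp
  moreover have "w j = u i j"
  proof -
    have "w j = (\<Sum>j' = 1..q. if j' = j then u i j' else 0)"
      unfolding w_def sum_fun_apply by (intro sum.cong) (auto simp: bvec_def)
    then show ?thesis using assms(3) by simp
  qed
  ultimately show ?thesis by (metis zero_fun_apply)
qed

end

section \<open>Graded coordinates\<close>

context cyclic_p_group
begin

text \<open>\<open>gvec \<nu> d r F\<close> is the element of degree \<open>d\<close> in which \<open>v\<^sub>i\<^sub>,\<^sub>j\<close> has
  coefficient \<open>coeff F (r - i)\<close>; then \<open>g - 1\<close> becomes multiplication by \<open>T1\<close>.\<close>

definition gvec :: "int \<Rightarrow> int \<Rightarrow> int \<Rightarrow> 'f poly \<Rightarrow> nat \<times> nat \<Rightarrow> 'f"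
  where "gvec \<nu> d r F =
    (\<Sum>e\<le>degree F. coeff F e *\<^sub>f tvec G g \<nu> (r - int e) (d + 1 - r + int e))"

lemma gvec_bound:
  assumes "deg_lt n F"
  shows "gvec \<nu> d r F = (\<Sum>e<n. coeff F e *\<^sub>f tvec G g \<nu> (r - int e) (d + 1 - r + int e))"
proof (cases "F = 0")
  case True
  then show ?thesis by (simp add: gvec_def)
next
  case False
  then have "degree F < n" using assms by (metis deg_lt_def leading_coeff_0_iff not_le_imp_less)
  then show ?thesis unfolding gvec_def
    by (intro sum.mono_neutral_left) (auto simp: coeff_eq_0)
qed

lemma deg_lt_Suc_degree: "deg_lt (Suc (degree F)) F"
  by (simp add: deg_lt_Suc_iff)

lemma gvec_add: "gvec \<nu> d r (F + H) = gvec \<nu> d r F + gvec \<nu> d r H"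
proof -
  define n where "n = max (Suc (degree F)) (Suc (degree H))"
  have n: "deg_lt n F" "deg_lt n H" by (auto simp: n_def intro: deg_lt_mono[OF deg_lt_Suc_degree])
  show ?thesis
    unfolding gvec_bound[OF n(1)] gvec_bound[OF n(2)] gvec_bound[OF deg_lt_add[OF n]]
    by (simp add: fspace.scale_left_distrib sum.distrib)
qed

lemma gvec_smult: "gvec \<nu> d r (smult c F) = c *\<^sub>f gvec \<nu> d r F"
proof -
  have "gvec \<nu> d r (smult c F) = (\<Sum>e<Suc (degree F). (c * coeff F e) *\<^sub>f tvec G g \<nu> (r - int e) (d + 1 - r + int e))"
    by (subst gvec_bound[of "Suc (degree F)"]) (simp_all add: deg_lt_smult deg_lt_Suc_degree)
  then show ?thesis
    by (simp add: gvec_def fspace.scale_sum_right lessThan_Suc_atMost)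
qed

lemma gvec_0 [simp]: "gvec \<nu> d r 0 = 0"
  by (simp add: gvec_def)

lemma gvec_diff: "gvec \<nu> d r (F - H) = gvec \<nu> d r F - gvec \<nu> d r H"
  using gvec_add[of \<nu> d r "F - H" H] by (simp add: fun_eq_iff)

lemma gvec_sum: "gvec \<nu> d r (\<Sum>a\<in>A. f a) = (\<Sum>a\<in>A. gvec \<nu> d r (f a))"
  by (induction A rule: infinite_finite_induct) (auto simp: gvec_add)

lemma gvec_monom: "gvec \<nu> d r (monom c e) = c *\<^sub>f tvec G g \<nu> (r - int e) (d + 1 - r + int e)"
proof -
  have "gvec \<nu> d r (monom c e) = (\<Sum>e'<Suc e. if e' = e then c *\<^sub>f tvec G g \<nu> (r - int e) (d + 1 - r + int e) else 0)"
    by (subst gvec_bound[of "Suc e"]) (auto simp: deg_lt_Suc_iff degree_monom_le intro!: sum.cong)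
  then show ?thesis by simp
qed

text \<open>The base index only normalises the exponent of \<open>x\<close>; elements written with
  bases \<open>(t + 1) * q\<close> and \<open>r\<close> become comparable this way.\<close>

lemma gvec_shift: "gvec \<nu> d (r + int k) (monom 1 k * F) = gvec \<nu> d r F"
proof -
  have F: "F = (\<Sum>i\<le>degree F. monom (coeff F i) i)" by (simp add: poly_as_sum_of_monoms)
  have "gvec \<nu> d (r + int k) (monom 1 k * (\<Sum>i\<le>degree F. monom (coeff F i) i)) =
      gvec \<nu> d r (\<Sum>i\<le>degree F. monom (coeff F i) i)"
    by (simp add: sum_distrib_left gvec_sum mult_monom gvec_monom algebra_simps)
  then show ?thesis using F by simp
qed

text \<open>The two inequalities keep all indices at most \<open>q\<close>, the range in which the
  two-term formula for \<open>g - 1\<close> holds.\<close>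

lemma gm1_gvec:
  assumes F: "deg_lt n F" and "r \<le> int q" "d + int n \<le> int q + r"
  shows "gm1 G g (gvec \<nu> d r F) = gvec \<nu> (d - 1) r (T1 * F)"
proof -
  let ?t = "\<lambda>i j. tvec G g \<nu> i j :: nat \<times> nat \<Rightarrow> 'f"
  have T: "deg_lt (Suc n) (T1 * F)" using deg_lt_T1_power[OF F, of 1 "Suc n"] by simp
  have "gm1 G g (gvec \<nu> d r F) = (\<Sum>e<n. coeff F e *\<^sub>f gm1 G g (?t (r - int e) (d + 1 - r + int e)))"
    by (simp add: gvec_bound[OF F] gm1_simps)
  also have "\<dots> = (\<Sum>e<n. coeff F e *\<^sub>f ?t (r - int e) (d - r + int e)) +
      (\<Sum>e<n. coeff F e *\<^sub>f ?t (r - int (Suc e)) (d - r + int (Suc e)))"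
    unfolding sum.distrib[symmetric]
  proof (intro sum.cong refl)
    fix e assume "e \<in> {..<n}"
    then have "gm1 G g (?t (r - int e) (d + 1 - r + int e)) =
        ?t (r - int e - 1) (d + 1 - r + int e) + ?t (r - int e) (d + 1 - r + int e - 1)"
      using assms(2,3) by (intro gm1_tvec) auto
    also have "\<dots> = ?t (r - int e) (d - r + int e) + ?t (r - int (Suc e)) (d - r + int (Suc e))"
      by (simp add: algebra_simps)
    finally show "coeff F e *\<^sub>f gm1 G g (?t (r - int e) (d + 1 - r + int e)) =
        coeff F e *\<^sub>f ?t (r - int e) (d - r + int e) + coeff F e *\<^sub>f ?t (r - int (Suc e)) (d - r + int (Suc e))"
      by (simp add: fspace.scale_right_distrib)
  qed
  also have "(\<Sum>e<n. coeff F e *\<^sub>f ?t (r - int e) (d - r + int e)) =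
      (\<Sum>e<Suc n. coeff F e *\<^sub>f ?t (r - int e) (d - r + int e))"
    using F by (simp add: deg_lt_def)
  also have "(\<Sum>e<n. coeff F e *\<^sub>f ?t (r - int (Suc e)) (d - r + int (Suc e))) =
      (\<Sum>e<Suc n. (if e = 0 then 0 else coeff F (e - 1)) *\<^sub>f ?t (r - int e) (d - r + int e))"
    unfolding sum.lessThan_Suc_shift by simp
  also have "(\<Sum>e<Suc n. coeff F e *\<^sub>f ?t (r - int e) (d - r + int e)) + \<dots> =
      (\<Sum>e<Suc n. coeff (T1 * F) e *\<^sub>f ?t (r - int e) (d - r + int e))"
    by (simp only: coeff_T1_mult fspace.scale_left_distrib sum.distrib)
  also have "\<dots> = gvec \<nu> (d - 1) r (T1 * F)"
    by (simp add: gvec_bound[OF T])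
  finally show ?thesis .
qed

lemma gm1_funpow_gvec:
  assumes F: "deg_lt n F" and r: "r \<le> int q" and d: "d + int n \<le> int q + r"
  shows "(gm1 G g ^^ N) (gvec \<nu> d r F) = gvec \<nu> (d - int N) r (T1 ^ N * F)"
proof (induction N)
  case (Suc N)
  have "(gm1 G g ^^ Suc N) (gvec \<nu> d r F) = gm1 G g (gvec \<nu> (d - int N) r (T1 ^ N * F))"
    by (simp add: Suc)
  also have "\<dots> = gvec \<nu> (d - int N - 1) r (T1 * (T1 ^ N * F))"
    by (rule gm1_gvec[where n = "n + N"]) (use deg_lt_T1_power[OF F, of N "n + N"] r d in auto)
  finally show ?case by (simp add: mult.assoc algebra_simps)
qed simp

lemma gvec_alt_0:
  assumes "alt_on r d 0 F"
  shows "gvec \<nu> (int d) (int r) F = 0"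
proof -
  have "coeff F e *\<^sub>f tvec G g \<nu> (int r - int e) (int d + 1 - int r + int e) = 0" for e
  proof (cases "e < r \<and> r \<le> e + d")
    case True
    then show ?thesis using assms by (auto simp: alt_on_def)
  next
    case False
    then show ?thesis by (auto simp: tvec_def)
  qed
  then show ?thesis unfolding gvec_def by (intro sum.neutral ballI)
qed

lemma gvec_alt:
  assumes "alt_on r d c F" "d \<le> r"
  shows "gvec \<nu> (int d) (int r) F = c *\<^sub>f xvec G g \<nu> (int d)"
proof -
  define F0 where "F0 = (\<Sum>j<d. monom (c * (- 1) ^ j) (r - 1 - j))"
  have c0: "coeff F0 i = c * (- 1) ^ (r - 1 - i)" if "i < r" "r \<le> i + d" for i
  proof -
    have "coeff F0 i = (\<Sum>j<d. if j = r - 1 - i then c * (- 1) ^ j else 0)"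
      unfolding F0_def coeff_sum using that assms(2) by (intro sum.cong) (auto simp: coeff_monom)
    also have "\<dots> = c * (- 1) ^ (r - 1 - i)" using that by (auto simp: sum.delta)
    finally show ?thesis .
  qed
  have "alt_on r d 0 (F - F0)" using assms(1) c0 by (auto simp: alt_on_def)
  from gvec_alt_0[OF this, of \<nu>] have "gvec \<nu> (int d) (int r) F = gvec \<nu> (int d) (int r) F0"
    by (simp add: gvec_diff)
  also have "\<dots> = (\<Sum>j<d. c *\<^sub>f (- 1) ^ j *\<^sub>f tvec G g \<nu> (int j + 1) (int d - int j))"
    unfolding F0_def gvec_sum
  proof (intro sum.cong refl)
    fix j assume "j \<in> {..<d}"
    then have j: "int r - int (r - 1 - j) = int j + 1" "int d + 1 - int r + int (r - 1 - j) = int d - int j"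
      using assms(2) by auto
    show "gvec \<nu> (int d) (int r) (monom (c * (- 1) ^ j) (r - 1 - j)) =
        c *\<^sub>f (- 1) ^ j *\<^sub>f tvec G g \<nu> (int j + 1) (int d - int j)"
      unfolding gvec_monom j fspace.scale_scale ..
  qed
  also have "\<dots> = c *\<^sub>f (\<Sum>j<d. (- 1) ^ j *\<^sub>f tvec G g \<nu> (int j + 1) (int d - int j))"
    by (simp only: fspace.scale_sum_right)
  also have "(\<Sum>j<d. (- 1) ^ j *\<^sub>f tvec G g \<nu> (int j + 1) (int d - int j)) = (xvec G g \<nu> (int d) :: nat \<times> nat \<Rightarrow> 'f)"
    unfolding xvec_def
    by (rule sum.reindex_bij_witness[of _ "\<lambda>i. nat (i - 1)" "\<lambda>j. int j + 1"]) auto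
  finally show ?thesis .
qed

text \<open>The last hypothesis keeps the second indices at most \<open>q\<close>, where the
  \<open>v_{i,j}\<close> are independent; exponents outside the window belong to zero
  vectors.\<close>

lemma gvec_eq_0D:
  assumes v: "gvec \<nu> (int d) (int r) F = 0" and F: "deg_lt n F" and r: "r \<le> q" and d: "d + n \<le> q + r"
  shows "alt_on r d 0 F"
proof -
  let ?t = "\<lambda>i j. tvec G g \<nu> i j :: nat \<times> nat \<Rightarrow> 'f"
  define u where "u i j = (if i \<le> r \<and> i + j = Suc d then coeff F (r - i) else 0)" for i j
  have inner: "(\<Sum>j = 1..q. u i j *\<^sub>f ?t (int i) (int j)) =
      (if i \<le> r then coeff F (r - i) *\<^sub>f ?t (int i) (int d + 1 - int i) else 0)" if "1 \<le> i" for i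
  proof (cases "i \<le> r")
    case True
    have "(\<Sum>j = 1..q. u i j *\<^sub>f ?t (int i) (int j)) =
      (\<Sum>j = 1..q. if j = Suc d - i then if i \<le> Suc d then coeff F (r - i) *\<^sub>f ?t (int i) (int d + 1 - int i) else 0 else 0)"
    proof (intro sum.cong refl)
      fix j
      show "u i j *\<^sub>f ?t (int i) (int j) =
        (if j = Suc d - i then if i \<le> Suc d then coeff F (r - i) *\<^sub>f ?t (int i) (int d + 1 - int i) else 0 else 0)"
      proof (cases "i + j = Suc d")
        case ij: True
        then have jj: "int j = int d + 1 - int i" "j = Suc d - i" "i \<le> Suc d" by auto
        show ?thesis unfolding u_def jj(1) using True ij jj(2,3) by simp
      next
        case False
        then show ?thesis by (auto simp: u_def)
      qed
    qed
    also have "\<dots> = coeff F (r - i) *\<^sub>f ?t (int i) (int d + 1 - int i)"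
    proof (cases "1 \<le> Suc d - i \<and> Suc d - i \<le> q")
      case True
      then have "i \<le> Suc d" by auto
      with True show ?thesis by (simp add: sum.delta)
    next
      case False
      then consider "d < i" | "q < Suc d - i" by linarith
      then show ?thesis
      proof cases
        case 1
        then show ?thesis by (simp add: tvec_def)
      next
        case 2
        then have "coeff F (r - i) = 0" using F d True r by (auto simp: deg_lt_def)
        then show ?thesis by simp
      qed
    qed
    finally show ?thesis using True by simp
  qed (simp add: u_def)
  have "(\<Sum>i = 1..q. \<Sum>j = 1..q. u i j *\<^sub>f ?t (int i) (int j)) =
      (\<Sum>i = 1..q. if i \<le> r then coeff F (r - i) *\<^sub>f ?t (int i) (int d + 1 - int i) else 0)"
    by (intro sum.cong refl inner) simp
  also have "\<dots> = (\<Sum>i = 1..r. coeff F (r - i) *\<^sub>f ?t (int i) (int d + 1 - int i))"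
    using r by (intro sum.mono_neutral_cong_right) auto
  also have "\<dots> = (\<Sum>e<r. coeff F e *\<^sub>f ?t (int r - int e) (int d + 1 - int r + int e))"
    by (rule sum.reindex_bij_witness[of _ "\<lambda>e. r - e" "\<lambda>i. r - i"]) (auto simp: of_nat_diff add_diff_eq)
  also have "\<dots> = (\<Sum>e<max n r. coeff F e *\<^sub>f ?t (int r - int e) (int d + 1 - int r + int e))"
    by (intro sum.mono_neutral_left) (auto simp: tvec_def)
  also have "\<dots> = gvec \<nu> (int d) (int r) F"
    by (rule gvec_bound[symmetric], rule deg_lt_mono[OF F]) simp
  finally have "(\<Sum>i = 1..q. \<Sum>j = 1..q. u i j *\<^sub>f ?t (int i) (int j)) = 0" using v by simp
  note ind = tvec_independent[OF this]
  show ?thesis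
    unfolding alt_on_def
  proof (intro allI impI)
    fix e assume e: "e < r" "r \<le> e + d"
    have "coeff F e = 0"
    proof (cases "Suc d - (r - e) \<le> q")
      case True
      then have "u (r - e) (Suc d - (r - e)) = 0" by (intro ind) (use e r in auto)
      then show ?thesis using e by (auto simp: u_def)
    next
      case False
      then show ?thesis using F d e by (auto simp: deg_lt_def)
    qed
    then show "coeff F e = 0 * (- 1) ^ (r - 1 - e)" by simp
  qed
qed

section \<open>The vectors x_d and the spaces D_d under g - 1\<close>

lemma gm1_xvec:
  assumes "0 < d" "d \<le> q"
  shows "gm1 G g (xvec G g \<nu> (int d) :: nat \<times> nat \<Rightarrow> 'f) = 0"
proof -
  obtain F :: "'f poly" where F: "deg_lt d F" "alt_on d d 1 F"
  proof
    show "deg_lt d (\<Sum>j<d. monom ((- 1) ^ (d - 1 - j)) j :: 'f poly)"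
      by (auto simp: deg_lt_def coeff_sum coeff_monom intro!: sum.neutral)
    show "alt_on d d 1 (\<Sum>j<d. monom ((- 1) ^ (d - 1 - j)) j :: 'f poly)"
      by (simp add: alt_on_def coeff_sum coeff_monom)
  qed
  have "alt_on d (d - 1) 0 (T1 * F)" using F assms by (intro alt_on_T1[where c = 1]) auto
  then have "gvec \<nu> (int (d - 1)) (int d) (T1 * F) = 0" by (rule gvec_alt_0)
  moreover have "gm1 G g (gvec \<nu> (int d) (int d) F) = gvec \<nu> (int d - 1) (int d) (T1 * F)"
    by (rule gm1_gvec[OF F(1)]) (use assms in auto)
  ultimately show ?thesis using gvec_alt[OF F(2), of \<nu>] assms by (simp add: of_nat_diff)
qed

text \<open>The vector \<open>v_{1,d}\<close> occurs in \<open>x_d\<close> with coefficient 1 and in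
  no other \<open>x\<close> vector.\<close>

lemma xvec_independent:
  fixes c :: "nat \<Rightarrow> 'f"
  assumes "(\<Sum>d = 1..m. c d *\<^sub>f xvec G g \<nu> (int d)) = 0" "m \<le> q" "d \<in> {1..m}"
  shows "c d = 0"
proof -
  let ?t = "\<lambda>i j. tvec G g \<nu> i j :: nat \<times> nat \<Rightarrow> 'f"
  define u where "u i j = (if i + j - 1 \<le> m then (- 1) ^ (i - 1) * c (i + j - 1) else 0)" for i j
  have "(\<Sum>i = 1..q. \<Sum>j = 1..q. u i j *\<^sub>f ?t (int i) (int j)) =
      (\<Sum>(i, j)\<in>{1..q} \<times> {1..q}. u i j *\<^sub>f ?t (int i) (int j))"
    by (simp add: sum.cartesian_product)
  also have "\<dots> = (\<Sum>(i, j)\<in>{(i, j). 1 \<le> i \<and> 1 \<le> j \<and> i + j - 1 \<le> m}. u i j *\<^sub>f ?t (int i) (int j))"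
    using assms(2) by (intro sum.mono_neutral_right) (auto simp: u_def)
  also have "\<dots> = (\<Sum>(d, i)\<in>Sigma {1..m} (\<lambda>d. {1..d}). c d *\<^sub>f (- 1) ^ (i - 1) *\<^sub>f ?t (int i) (int d + 1 - int i))"
    by (rule sum.reindex_bij_witness[of _ "\<lambda>(d, i). (i, d + 1 - i)" "\<lambda>(i, j). (i + j - 1, i)"])
      (auto simp: u_def mult.commute of_nat_diff)
  also have "\<dots> = (\<Sum>d = 1..m. \<Sum>i = 1..d. c d *\<^sub>f (- 1) ^ (i - 1) *\<^sub>f ?t (int i) (int d + 1 - int i))"
    by (simp add: sum.Sigma)
  also have "\<dots> = (\<Sum>d = 1..m. c d *\<^sub>f xvec G g \<nu> (int d))"
  proof (intro sum.cong refl)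
    fix d
    have "(\<Sum>i = 1..d. (- 1) ^ (i - 1) *\<^sub>f ?t (int i) (int d + 1 - int i)) = xvec G g \<nu> (int d)"
      unfolding xvec_def
      by (rule sum.reindex_bij_witness[of _ nat int]) (auto simp: nat_diff_distrib)
    then show "(\<Sum>i = 1..d. c d *\<^sub>f (- 1) ^ (i - 1) *\<^sub>f ?t (int i) (int d + 1 - int i)) = c d *\<^sub>f xvec G g \<nu> (int d)"
      by (simp only: fspace.scale_sum_right[symmetric])
  qed
  finally have "(\<Sum>i = 1..q. \<Sum>j = 1..q. u i j *\<^sub>f ?t (int i) (int j)) = 0" using assms(1) by simp
  then have "u 1 d = 0" by (rule tvec_independent) (use assms in auto)
  then show ?thesis using assms(3) by (simp add: u_def)
qed

lemma Dspace_tvec: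
  assumes "i + j = d + 1" "i \<le> int r" "j \<le> int s"
  shows "tvec G g \<nu> i j \<in> (Dspace G g \<nu> r s d :: (nat \<times> nat \<Rightarrow> 'f) set)"
proof (cases "i \<le> 0 \<or> j \<le> 0")
  case True
  then show ?thesis by (simp add: tvec_def Dspace_def fspace.span_zero)
next
  case False
  then show ?thesis unfolding Dspace_def using assms
    by (intro fspace.span_base CollectI exI[of _ i] exI[of _ j]) auto
qed

lemma gm1_funpow_Dspace:
  assumes "r \<le> q" "s \<le> q"
  shows "(gm1 G g ^^ N) ` (Dspace G g \<nu> r s d :: (nat \<times> nat \<Rightarrow> 'f) set) \<subseteq> Dspace G g \<nu> r s (d - int N)"
proof -
  have step: "gm1 G g w \<in> Dspace G g \<nu> r s (d - 1)" if "w \<in> (Dspace G g \<nu> r s d :: (nat \<times> nat \<Rightarrow> 'f) set)" for d w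
    using that unfolding Dspace_def[of G g \<nu> r s d]
  proof (induction rule: fspace.span_induct_alt)
    case base
    show ?case by (simp only: gm1_simps(4) Dspace_def fspace.span_zero)
  next
    case (step c x y)
    then obtain i j where x: "x = tvec G g \<nu> i j" and ij: "i \<in> {1..int r}" "j \<in> {1..int s}" "i + j = d + 1"
      by auto
    have "gm1 G g x = tvec G g \<nu> (i - 1) j + tvec G g \<nu> i (j - 1)"
      unfolding x using ij assms by (intro gm1_tvec) auto
    moreover have "tvec G g \<nu> (i - 1) j \<in> (Dspace G g \<nu> r s (d - 1) :: (nat \<times> nat \<Rightarrow> 'f) set)"
      "tvec G g \<nu> i (j - 1) \<in> (Dspace G g \<nu> r s (d - 1) :: (nat \<times> nat \<Rightarrow> 'f) set)"
      using ij by (auto intro!: Dspace_tvec)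
    ultimately show ?case using step(2) unfolding Dspace_def
      by (simp only: gm1_simps) (intro fspace.span_add fspace.span_scale)
  qed
  show ?thesis
  proof (induction N)
    case (Suc N)
    then show ?case using step[of _ "d - int N"] by (auto simp: image_subset_iff algebra_simps)
  qed simp
qed

end

section \<open>Modules and isomorphisms\<close>

lemma part_nth: "l \<in> {1..length xs} \<Longrightarrow> part xs l \<in> set xs"
  by (auto simp: part_def)

context cyclic_p_group
begin

lemma mcarrier_Vmod: "mcarrier (Vmod G g r :: ('g, nat \<Rightarrow> 'f) fgmod) = supported {1..r}"
  by (simp add: Vmod_def span_bvec)

lemma gen_map_supported_le: "u \<in> supported {1..s} \<Longrightarrow> s \<le> q \<Longrightarrow> gen_map q u \<in> supported {1..s}"
  by (auto simp: supported_def gen_map_apply)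

lemma vact_supported_le:
  fixes u :: "nat \<Rightarrow> 'f"
  assumes "u \<in> supported {1..s}" "s \<le> q"
  shows "vact G g h u \<in> supported {1..s}"
proof -
  have "(gen_map q ^^ n) u \<in> supported {1..s}" for n
  proof (induction n)
    case (Suc n)
    then show ?case using gen_map_supported_le[OF _ assms(2)] by simp
  qed (use assms(1) in simp)
  then show ?thesis by (simp add: vact_def)
qed

lemma bvec_tensor: "bvec i \<otimes>\<^sub>v bvec j = (bvec (i, j) :: nat \<times> nat \<Rightarrow> 'f)"
  by (auto simp: tensor_def bvec_def fun_eq_iff)

lemma tensor_supported: "u \<in> supported A \<Longrightarrow> w \<in> supported B \<Longrightarrow> u \<otimes>\<^sub>v w \<in> supported (A \<times> B)"
  by (auto simp: supported_def tensor_def)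

lemma mcarrier_Vtensor:
  "mcarrier (Vtensor G g r s :: ('g, nat \<times> nat \<Rightarrow> 'f) fgmod) = supported ({1..r} \<times> {1..s})"
proof -
  let ?S = "{u \<otimes>\<^sub>v w |u w. u \<in> supported {1..r} \<and> w \<in> supported {1..s}} :: (nat \<times> nat \<Rightarrow> 'f) set"
  have "fspace.span ?S \<subseteq> supported ({1..r} \<times> {1..s})"
    by (rule fspace.span_minimal) (auto simp: subspace_supported intro: tensor_supported)
  moreover have "fspace.span (bvec ` ({1..r} \<times> {1..s})) \<subseteq> fspace.span ?S"
  proof (rule fspace.span_mono, rule subsetI)
    fix x :: "nat \<times> nat \<Rightarrow> 'f" assume "x \<in> bvec ` ({1..r} \<times> {1..s})"
    then obtain i j where "i \<in> {1..r}" "j \<in> {1..s}" "x = bvec i \<otimes>\<^sub>v bvec j"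
      by (auto simp: bvec_tensor)
    then show "x \<in> ?S"
      by (intro CollectI exI[of _ "bvec i"] exI[of _ "bvec j"] conjI bvec_supported)
  qed
  ultimately have "fspace.span ?S = supported ({1..r} \<times> {1..s})"
    by (simp add: span_bvec)
  then show ?thesis by (simp add: Vtensor_def mcarrier_Vmod)
qed

lemma tact_supported:
  fixes w :: "nat \<times> nat \<Rightarrow> 'f"
  assumes "w \<in> supported ({1..r} \<times> {1..s})" "r \<le> q" "s \<le> q"
  shows "tact G g h w \<in> supported ({1..r} \<times> {1..s})"
proof -
  have "w (i, j) *\<^sub>f (vact G g h (bvec i) \<otimes>\<^sub>v vact G g h (bvec j)) \<in> supported ({1..r} \<times> {1..s})" for i j
  proof (cases "i \<in> {1..r} \<and> j \<in> {1..s}")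
    case True
    then show ?thesis using assms(2,3)
      by (intro fspace.subspace_scale[OF subspace_supported] tensor_supported vact_supported_le bvec_supported) auto
  next
    case False
    then have "w (i, j) = 0" using assms(1) by (auto simp: supported_def)
    then show ?thesis by (simp add: fspace.subspace_0[OF subspace_supported])
  qed
  then show ?thesis unfolding tact_def by (intro fspace.subspace_sum[OF subspace_supported])
qed

text \<open>What is required for testing an isomorphism at the generator alone: every element of
  \<open>G\<close> is a power of \<open>g\<close>, so compatibility with \<open>g\<close> then
  implies compatibility with all of \<open>G\<close>.\<close>

definition gen_module :: "('g, 'i \<Rightarrow> 'f) fgmod \<Rightarrow> bool"
  where "gen_module M \<longleftrightarrow> (\<forall>u \<in> mcarrier M. maction M g u \<in> mcarrier M) \<and>
    (\<forall>n. \<forall>u \<in> mcarrier M. maction M (g [^]\<^bsub>G\<^esub> (n :: nat)) u = (maction M g ^^ n) u) \<and>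
    fspace.subspace (mcarrier M)"

lemma gen_module_Vtensor:
  assumes "r \<le> q" "s \<le> q"
  shows "gen_module (Vtensor G g r s)"
  unfolding gen_module_def mcarrier_Vtensor
proof (intro conjI ballI allI subspace_supported)
  have act: "maction (Vtensor G g r s) = tact G g" by (simp add: Vtensor_def)
  fix u :: "nat \<times> nat \<Rightarrow> 'f" assume u: "u \<in> supported ({1..r} \<times> {1..s})"
  show "maction (Vtensor G g r s) g u \<in> supported ({1..r} \<times> {1..s})"
    unfolding act using tact_supported[OF u assms] .
  fix n :: nat
  have fin: "finite ({1..r} \<times> {1..s})" by simp
  have "tact G g (g [^]\<^bsub>G\<^esub> n) (bvec x) = (tact G g g ^^ n) (bvec x :: nat \<times> nat \<Rightarrow> 'f)"
    if "x \<in> {1..r} \<times> {1..s}" for x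
  proof -
    obtain i j where x: "x = (i, j)" "i \<in> {1..q}" "j \<in> {1..q}" using \<open>x \<in> _\<close> assms by (cases x) auto
    have s: "(bvec i :: nat \<Rightarrow> 'f) \<in> supported {1..q}" "(bvec j :: nat \<Rightarrow> 'f) \<in> supported {1..q}"
      by (rule bvec_supported[OF x(2)], rule bvec_supported[OF x(3)])
    have "(tact G g g ^^ n) (bvec i \<otimes>\<^sub>v bvec j) = (gen_map q ^^ n) (bvec i) \<otimes>\<^sub>v (gen_map q ^^ n) (bvec j :: nat \<Rightarrow> 'f)"
    proof (induction n)
      case (Suc n)
      note sn = gen_map_funpow_supported[OF s(1), of n] gen_map_funpow_supported[OF s(2), of n]
      show ?case unfolding funpow.simps comp_apply Suc tact_tensor[OF sn] vact_g[OF sn(1)] vact_g[OF sn(2)] ..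
    qed simp
    then show ?thesis
      unfolding x(1) bvec_tensor[symmetric] tact_tensor[OF s] vact_pow[OF s(1)] vact_pow[OF s(2)] by simp
  qed
  then show "maction (Vtensor G g r s) (g [^]\<^bsub>G\<^esub> n) u = (maction (Vtensor G g r s) g ^^ n) u"
    unfolding act
    by (subst (1 2) supported_expansion[OF fin u])
      (simp add: flinear_simps[OF flinear_tact] flinear_simps[OF flinear_funpow[OF flinear_tact]])
qed

lemma mcarrier_Vsum:
  "mcarrier (Vsum G g xs :: ('g, nat \<times> nat \<Rightarrow> 'f) fgmod) = supported (Sigma {1..length xs} (\<lambda>l. {1..part xs l}))"
  unfolding Vsum_def supported_def fgmod.simps mcarrier_Vmod
  by (auto simp: supported_def fun_eq_iff split: if_splits)

lemma maction_Vsum: "maction (Vsum G g xs) h u = (\<lambda>(l, i). vact G g h (\<lambda>i'. u (l, i')) i)"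
  by (simp add: Vsum_def)

lemma slice_supported:
  assumes "u \<in> supported (Sigma {1..length xs} (\<lambda>l. {1..part xs l}))" "set xs \<subseteq> {1..q}"
  shows "(\<lambda>i. u (l, i)) \<in> supported {1..q}"
  unfolding supported_def
proof (intro CollectI allI impI)
  fix i assume i: "i \<notin> {1..q}"
  have "(l, i) \<notin> Sigma {1..length xs} (\<lambda>l. {1..part xs l})"
    using i assms(2) part_nth[of l xs] by auto
  then show "u (l, i) = 0" by (rule supportedD[OF assms(1)])
qed

lemma maction_Vsum_g:
  fixes u :: "nat \<times> nat \<Rightarrow> 'f"
  assumes u: "u \<in> supported (Sigma {1..length xs} (\<lambda>l. {1..part xs l}))" and xs: "set xs \<subseteq> {1..q}"
  shows "maction (Vsum G g xs) g u = u + (\<lambda>(l, i). if i = 0 then 0 else u (l, Suc i))"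
proof
  fix x :: "nat \<times> nat"
  obtain l i where x: "x = (l, i)" by (cases x)
  have "u (l, 0) = 0" using u by (auto simp: supported_def)
  then show "maction (Vsum G g xs) g u x = (u + (\<lambda>(l, i). if i = 0 then 0 else u (l, Suc i))) x"
    unfolding x maction_Vsum by (simp add: vact_g[OF slice_supported[OF u xs]] gen_map_eq[OF slice_supported[OF u xs]])
qed

lemma gen_module_Vsum:
  assumes xs: "set xs \<subseteq> {1..q}"
  shows "gen_module (Vsum G g xs)"
  unfolding gen_module_def mcarrier_Vsum
proof (intro conjI ballI allI subspace_supported)
  let ?S = "Sigma {1..length xs} (\<lambda>l. {1..part xs l})"
  have closed: "maction (Vsum G g xs) g u \<in> supported ?S" if "u \<in> supported ?S" for u :: "nat \<times> nat \<Rightarrow> 'f"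
    unfolding maction_Vsum_g[OF that xs] using that by (auto simp: supported_def)
  fix u :: "nat \<times> nat \<Rightarrow> 'f" assume u: "u \<in> supported ?S"
  show "maction (Vsum G g xs) g u \<in> supported ?S" by (rule closed[OF u])
  fix n :: nat
  have "(maction (Vsum G g xs) g ^^ n) u \<in> supported ?S \<and>
    (\<forall>l. (\<lambda>i. (maction (Vsum G g xs) g ^^ n) u (l, i)) = (gen_map q ^^ n) (\<lambda>i. u (l, i)))"
  proof (induction n)
    case (Suc n)
    define w where "w = (maction (Vsum G g xs) g ^^ n) u"
    have w: "w \<in> supported ?S" "\<And>l. (\<lambda>i. w (l, i)) = (gen_map q ^^ n) (\<lambda>i. u (l, i))"
      using Suc by (auto simp: w_def)
    have "(\<lambda>i. maction (Vsum G g xs) g w (l, i)) = (gen_map q ^^ Suc n) (\<lambda>i. u (l, i))" for l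
      unfolding maction_Vsum funpow.simps comp_apply w(2)[symmetric]
      by (simp add: vact_g[OF slice_supported[OF w(1) xs]])
    then show ?case using closed[OF w(1)] by (simp add: w_def)
  qed (use u in simp)
  then have "(maction (Vsum G g xs) g ^^ n) u (l, i) = (gen_map q ^^ n) (\<lambda>i. u (l, i)) i" for l i
    by metis
  then show "maction (Vsum G g xs) (g [^]\<^bsub>G\<^esub> n) u = (maction (Vsum G g xs) g ^^ n) u"
    by (auto simp: fun_eq_iff maction_Vsum vact_pow[OF slice_supported[OF u xs]])
qed

lemma fgmod_isoI:
  assumes M: "gen_module (M :: ('g, 'i \<Rightarrow> 'f) fgmod)" and N: "gen_module (N :: ('g, 'j \<Rightarrow> 'f) fgmod)"
    and bij: "bij_betw \<phi> (mcarrier M) (mcarrier N)"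
    and lin: "\<And>u w. u \<in> mcarrier M \<Longrightarrow> w \<in> mcarrier M \<Longrightarrow> \<phi> (u + w) = \<phi> u + \<phi> w"
      "\<And>c u. u \<in> mcarrier M \<Longrightarrow> \<phi> (c *\<^sub>f u) = c *\<^sub>f \<phi> u"
    and act: "\<And>u. u \<in> mcarrier M \<Longrightarrow> \<phi> (maction M g u) = maction N g (\<phi> u)"
  shows "fgmod_iso G M N"
  unfolding fgmod_iso_def
proof (intro exI[of _ \<phi>] conjI ballI allI bij lin)
  fix h u assume h: "h \<in> carrier G" and u: "u \<in> mcarrier M"
  obtain n :: nat where n: "h = g [^]\<^bsub>G\<^esub> n" by (rule carrier_cases[OF h])
  have "(maction M g ^^ n) u \<in> mcarrier M \<and> \<phi> ((maction M g ^^ n) u) = (maction N g ^^ n) (\<phi> u)" for n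
    by (induction n) (use M u act in \<open>auto simp: gen_module_def\<close>)
  moreover have "\<phi> u \<in> mcarrier N" using bij u by (auto simp: bij_betw_def)
  ultimately show "\<phi> (maction M h u) = maction N h (\<phi> u)"
    using M N u unfolding gen_module_def n by auto
qed

lemma fgmod_iso_sym:
  assumes M: "gen_module (M :: ('g, 'i \<Rightarrow> 'f) fgmod)" and N: "gen_module (N :: ('g, 'j \<Rightarrow> 'f) fgmod)"
    and iso: "fgmod_iso G M N"
  shows "fgmod_iso G N M"
proof -
  obtain \<phi> where bij: "bij_betw \<phi> (mcarrier M) (mcarrier N)"
    and add: "\<And>u w. u \<in> mcarrier M \<Longrightarrow> w \<in> mcarrier M \<Longrightarrow> \<phi> (u + w) = \<phi> u + \<phi> w"
    and scale: "\<And>c u. u \<in> mcarrier M \<Longrightarrow> \<phi> (c *\<^sub>f u) = c *\<^sub>f \<phi> u"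
    and act: "\<And>u. u \<in> mcarrier M \<Longrightarrow> \<phi> (maction M g u) = maction N g (\<phi> u)"
    using iso g_in unfolding fgmod_iso_def by blast
  define \<psi> where "\<psi> = inv_into (mcarrier M) \<phi>"
  have inv: "\<psi> (\<phi> u) = u" if "u \<in> mcarrier M" for u
    using bij that by (auto simp: \<psi>_def bij_betw_def)
  have obt: "\<exists>u \<in> mcarrier M. w = \<phi> u" if "w \<in> mcarrier N" for w
    using bij that by (auto simp: bij_betw_def)
  note cl = M[unfolded gen_module_def]
  show ?thesis
  proof (rule fgmod_isoI[OF N M, of \<psi>])
    show "bij_betw \<psi> (mcarrier N) (mcarrier M)" unfolding \<psi>_def by (rule bij_betw_inv_into[OF bij])
    fix u w :: "'j \<Rightarrow> 'f" and c :: 'f assume u: "u \<in> mcarrier N"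
    obtain u' where u': "u' \<in> mcarrier M" "u = \<phi> u'" using obt[OF u] by blast
    show "\<psi> (c *\<^sub>f u) = c *\<^sub>f \<psi> u"
      unfolding u'(2) scale[OF u'(1), symmetric] using cl u'(1)
      by (simp add: inv fspace.subspace_scale)
    show "\<psi> (maction N g u) = maction M g (\<psi> u)"
      unfolding u'(2) act[OF u'(1), symmetric] using cl u'(1) by (simp add: inv)
    assume w: "w \<in> mcarrier N"
    obtain w' where w': "w' \<in> mcarrier M" "w = \<phi> w'" using obt[OF w] by blast
    show "\<psi> (u + w) = \<psi> u + \<psi> w"
      unfolding u'(2) w'(2) add[OF u'(1) w'(1), symmetric] using cl u'(1) w'(1)
      by (simp add: inv fspace.subspace_add)
  qed
qed

lemma fgmod_iso_trans:
  assumes "fgmod_iso G (M :: ('g, 'i \<Rightarrow> 'f) fgmod) (N :: ('g, 'j \<Rightarrow> 'f) fgmod)"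
    "fgmod_iso G N (L :: ('g, 'k \<Rightarrow> 'f) fgmod)"
  shows "fgmod_iso G M L"
proof -
  obtain \<phi> where \<phi>: "bij_betw \<phi> (mcarrier M) (mcarrier N)"
    "\<forall>u \<in> mcarrier M. \<forall>w \<in> mcarrier M. \<phi> (u + w) = \<phi> u + \<phi> w"
    "\<forall>c. \<forall>u \<in> mcarrier M. \<phi> (c *\<^sub>f u) = c *\<^sub>f \<phi> u"
    "\<forall>h \<in> carrier G. \<forall>u \<in> mcarrier M. \<phi> (maction M h u) = maction N h (\<phi> u)"
    using assms(1) unfolding fgmod_iso_def by blast
  obtain \<psi> where \<psi>: "bij_betw \<psi> (mcarrier N) (mcarrier L)"
    "\<forall>u \<in> mcarrier N. \<forall>w \<in> mcarrier N. \<psi> (u + w) = \<psi> u + \<psi> w"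
    "\<forall>c. \<forall>u \<in> mcarrier N. \<psi> (c *\<^sub>f u) = c *\<^sub>f \<psi> u"
    "\<forall>h \<in> carrier G. \<forall>u \<in> mcarrier N. \<psi> (maction N h u) = maction L h (\<psi> u)"
    using assms(2) unfolding fgmod_iso_def by blast
  have "\<phi> u \<in> mcarrier N" if "u \<in> mcarrier M" for u using \<phi>(1) that by (auto simp: bij_betw_def)
  then show ?thesis unfolding fgmod_iso_def
    using \<phi> \<psi> by (intro exI[of _ "\<psi> \<circ> \<phi>"] conjI bij_betw_trans[OF \<phi>(1) \<psi>(1)]) auto
qed

end

section \<open>Decomposition of the tensor product\<close>

text \<open>\<open>T^q = x^q + y^q\<close> is zero on the module when \<open>r, s <= q\<close>,
  while a longer block would let it act nontrivially.\<close>

lemma jordan_part_le: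
  fixes q :: nat
  assumes frob: "(T1 :: 'f::field poly) ^ q = 1 + monom 1 q" and rs: "r \<le> q" "s \<le> q"
    and l: "0 < l" "l \<le> min r s"
  shows "jordan_part TYPE('f) r s l \<le> q"
proof (rule ccontr)
  define a b where "a = lo TYPE('f) r s l" and "b = hi TYPE('f) r s l"
  assume "\<not> ?thesis"
  then have len: "q < r + s - a - b" by (simp add: jordan_part_def a_def b_def)
  obtain F :: "'f poly" where "string r s (lo TYPE('f) r s l) (hi TYPE('f) r s l) F"
    by (rule string_at[OF l])
  then have F: "string r s a b F" by (simp add: a_def b_def)
  \<comment> \<open>The first summand is divisible by \<open>x^r\<close>; the second stands for
    \<open>y^q F\<close> and misses the window by its degree bound.\<close>
  have "alt_on r (r + s - a - 1 - q) 0 (monom 1 r * (monom 1 (q - r) * F) + F)"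
    by (rule alt_on_0_sum[where e = "Suc a"]) (use F len rs in \<open>auto simp: string_def\<close>)
  also have "monom 1 r * (monom 1 (q - r) * F) + F = T1 ^ q * F"
    unfolding frob using rs by (simp add: mult.assoc[symmetric] mult_monom algebra_simps)
  finally have Z: "alt_on r b 0 (T1 ^ (r + s - a - b - 1 - q) * (T1 ^ q * F))"
    by (rule alt_on_0_T1_power) (use len F in \<open>auto simp: string_def\<close>)
  have "r + s - a - b - 1 = (r + s - a - b - 1 - q) + q" using len by simp
  then have eq: "T1 ^ (r + s - a - b - 1) * F = T1 ^ (r + s - a - b - 1 - q) * (T1 ^ q * F)"
    by (metis mult.assoc power_add)
  have "alt_on r b 0 (T1 ^ (r + s - a - b - 1) * F)" unfolding eq by (rule Z)
  moreover have "alt_on r b 1 (T1 ^ (r + s - a - b - 1) * F)" using F by (simp add: string_def)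
  ultimately have "(0 :: 'f) = 1" by (rule alt_on_unique) (use F in \<open>auto simp: string_def\<close>)
  then show False by simp
qed

text \<open>\<open>dependent\<close> speaks of sets and would overlook a repeated vector, so
  injectivity of the family is part of the conclusion.\<close>

lemma family_independent:
  fixes E :: "'k \<Rightarrow> 'i \<Rightarrow> 'f::field"
  assumes "finite A" and ind: "\<And>u. (\<Sum>\<kappa>\<in>A. u \<kappa> *\<^sub>f E \<kappa>) = 0 \<Longrightarrow> \<forall>\<kappa>\<in>A. u \<kappa> = 0"
  shows "inj_on E A" and "\<not> fspace.dependent (E ` A)"
proof -
  show inj: "inj_on E A"
  proof (rule inj_onI, rule ccontr)
    fix \<kappa> \<kappa>' assume k: "\<kappa> \<in> A" "\<kappa>' \<in> A" "E \<kappa> = E \<kappa>'" "\<kappa> \<noteq> \<kappa>'"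
    define u :: "'k \<Rightarrow> 'f" where "u x = (if x = \<kappa> then 1 else if x = \<kappa>' then - 1 else 0)" for x
    have "(\<Sum>x\<in>A. u x *\<^sub>f E x) = (\<Sum>x\<in>A. if x = \<kappa> then E \<kappa> else 0) + (\<Sum>x\<in>A. if x = \<kappa>' then - E \<kappa> else 0)"
      unfolding sum.distrib[symmetric] using k by (intro sum.cong) (auto simp: u_def)
    also have "\<dots> = 0" using k \<open>finite A\<close> by (simp add: sum.delta)
    finally have "u \<kappa> = 0" using ind k(1) by blast
    then show False by (simp add: u_def)
  qed
  show "\<not> fspace.dependent (E ` A)"
  proof
    assume "fspace.dependent (E ` A)"
    then obtain u v where uv: "v \<in> E ` A" "u v \<noteq> 0" "(\<Sum>v\<in>E ` A. u v *\<^sub>f v) = 0"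
      using fspace.dependent_finite[of "E ` A"] \<open>finite A\<close> by auto
    then have "(\<Sum>\<kappa>\<in>A. u (E \<kappa>) *\<^sub>f E \<kappa>) = 0" by (simp add: sum.reindex[OF inj])
    then have "\<forall>\<kappa>\<in>A. u (E \<kappa>) = 0" by (rule ind)
    with uv show False by auto
  qed
qed

lemma card_bvec: "card (bvec ` A :: ('i \<Rightarrow> 'f::field) set) = card A"
proof (rule card_image, rule inj_onI)
  fix x y :: 'i assume "(bvec x :: 'i \<Rightarrow> 'f) = bvec y"
  then have "(bvec x :: 'i \<Rightarrow> 'f) x = bvec y x" by simp
  then show "x = y" by (simp add: bvec_def split: if_splits)
qed

lemma family_spans:
  fixes E :: "'k \<Rightarrow> 'i \<Rightarrow> 'f::field"
  assumes A: "finite A" and ind: "\<And>u. (\<Sum>\<kappa>\<in>A. u \<kappa> *\<^sub>f E \<kappa>) = 0 \<Longrightarrow> \<forall>\<kappa>\<in>A. u \<kappa> = 0"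
    and B: "finite B" "E ` A \<subseteq> supported B" "card A = card B" and w: "w \<in> supported B"
  obtains u where "u \<in> supported A" "w = (\<Sum>\<kappa>\<in>A. u \<kappa> *\<^sub>f E \<kappa>)"
proof -
  have inj: "inj_on E A" and indep: "\<not> fspace.dependent (E ` A)"
    using family_independent[of A E] A ind by blast+
  have "w \<in> fspace.span (E ` A)"
  proof (rule ccontr)
    assume notin: "w \<notin> fspace.span (E ` A)"
    then have "\<not> fspace.dependent (insert w (E ` A))"
      using indep by (simp add: fspace.independent_insert)
    moreover have "insert w (E ` A) \<subseteq> fspace.span (bvec ` B)"
      using B w by (simp add: span_bvec)
    ultimately have "card (insert w (E ` A)) \<le> card (bvec ` B :: ('i \<Rightarrow> 'f) set)"
      using fspace.independent_span_bound[of "bvec ` B"] B by auto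
    moreover have "w \<notin> E ` A" using notin fspace.span_base by blast
    ultimately show False using A inj B by (simp add: card_bvec card_image)
  qed
  then obtain c where c: "w = (\<Sum>v\<in>E ` A. c v *\<^sub>f v)"
    using fspace.span_finite[of "E ` A"] A by auto
  show ?thesis
  proof (rule that[of "\<lambda>\<kappa>. if \<kappa> \<in> A then c (E \<kappa>) else 0"])
    show "w = (\<Sum>\<kappa>\<in>A. (if \<kappa> \<in> A then c (E \<kappa>) else 0) *\<^sub>f E \<kappa>)"
      unfolding c by (simp add: sum.reindex[OF inj])
  qed (simp add: supported_def)
qed

text \<open>The number of parts of size at least \<open>c\<close> is the \<open>c\<close>-th column
  of the Young diagram, and the columns determine the rows. Positivity makes the first column the
  length.\<close>

lemma sorted_list_eq:
  fixes xs ys :: "nat list"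
  assumes sorted: "sorted_wrt (\<ge>) xs" "sorted_wrt (\<ge>) ys" and pos: "0 \<notin> set xs" "0 \<notin> set ys"
    and le: "\<And>c. 0 < c \<Longrightarrow> card {l \<in> {1..length xs}. c \<le> part xs l} = card {l \<in> {1..length ys}. c \<le> part ys l}"
  shows "xs = ys"
proof (rule nth_equalityI)
  have "1 \<le> part zs l" if "0 \<notin> set zs" "l \<in> {1..length zs}" for zs l
    using that(1) part_nth[OF that(2)] by (cases "part zs l") auto
  then have "{l \<in> {1..length zs}. 1 \<le> part zs l} = {1..length zs}" if "0 \<notin> set zs" for zs
    using that by blast
  then show len: "length xs = length ys" using le[of 1] pos by simp
  have *: "zs ! i \<le> ws ! i" if z: "sorted_wrt (\<ge>) zs" and w: "sorted_wrt (\<ge>) ws" and i: "i < length zs" "i < length ws"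
    and c: "\<And>c. 0 < c \<Longrightarrow> card {l \<in> {1..length zs}. c \<le> part zs l} = card {l \<in> {1..length ws}. c \<le> part ws l}"
    for zs ws :: "nat list" and i
  proof (rule ccontr)
    assume less: "\<not> zs ! i \<le> ws ! i"
    have "{1..Suc i} \<subseteq> {l \<in> {1..length zs}. zs ! i \<le> part zs l}"
    proof
      fix l assume l: "l \<in> {1..Suc i}"
      then have "l - 1 = i \<or> l - 1 < i" by auto
      then have "zs ! i \<le> zs ! (l - 1)" using sorted_wrt_nth_less[OF z, of "l - 1" i] i by auto
      then show "l \<in> {l \<in> {1..length zs}. zs ! i \<le> part zs l}" using l i by (auto simp: part_def)
    qed
    from card_mono[OF _ this] have "Suc i \<le> card {l \<in> {1..length zs}. zs ! i \<le> part zs l}" by simp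
    also have "\<dots> = card {l \<in> {1..length ws}. zs ! i \<le> part ws l}" by (rule c) (use less in simp)
    also have "{l \<in> {1..length ws}. zs ! i \<le> part ws l} \<subseteq> {1..i}"
    proof
      fix l assume l: "l \<in> {l \<in> {1..length ws}. zs ! i \<le> part ws l}"
      have "\<not> i < l"
      proof
        assume "i < l"
        then have "l - 1 = i \<or> i < l - 1" by auto
        then have "ws ! (l - 1) \<le> ws ! i" using sorted_wrt_nth_less[OF w, of i "l - 1"] l by auto
        then show False using l less by (auto simp: part_def)
      qed
      then show "l \<in> {1..i}" using l by auto
    qed
    from card_mono[OF _ this] have "card {l \<in> {1..length ws}. zs ! i \<le> part ws l} \<le> i" by simp
    finally show False by simp
  qed
  show "xs ! i = ys ! i" if "i < length xs" for i
    using *[OF sorted _ _ le, of i] *[OF sorted(2,1) _ _ le[symmetric], of i] that len by simp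
qed

lemma sum_shift_index:
  fixes f h :: "nat \<Rightarrow> 'a::comm_monoid_add"
  assumes "h 1 = 0" "\<And>i. 1 \<le> i \<Longrightarrow> h (Suc i) = f i" "0 < n"
  shows "(\<Sum>i = 1..n. h i) + f n = (\<Sum>i = 1..n. f i)"
  using assms(3)
proof (induction n)
  case (Suc n)
  show ?case
  proof (cases "n = 0")
    case True
    then show ?thesis using assms(1) by simp
  next
    case False
    then show ?thesis using Suc assms(2)[of n] by simp
  qed
qed simp

context cyclic_p_group
begin

definition parts :: "nat \<Rightarrow> nat \<Rightarrow> nat list"
  where "parts r s = map (jordan_part TYPE('f) r s) [1..<Suc (min r s)]"

lemma part_parts: "l \<in> {1..min r s} \<Longrightarrow> part (parts r s) l = jordan_part TYPE('f) r s l"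
proof -
  assume "l \<in> {1..min r s}"
  then have "l - 1 < length [1..<Suc (min r s)]" "[1..<Suc (min r s)] ! (l - 1) = l"
    using nth_upt[of 1 "l - 1" "Suc (min r s)"] by auto
  then show ?thesis unfolding part_def parts_def by (simp only: nth_map)
qed

lemma length_parts: "length (parts r s) = min r s"
  by (simp add: parts_def del: upt_Suc)

lemma set_parts:
  assumes "r \<le> q" "s \<le> q"
  shows "set (parts r s) \<subseteq> {1..q}"
proof
  fix x assume "x \<in> set (parts r s)"
  then obtain l where "l \<in> {1..<Suc (min r s)}" "x = jordan_part TYPE('f) r s l"
    unfolding parts_def set_map set_upt by blast
  then have l: "0 < l" "l \<le> min r s" "x = jordan_part TYPE('f) r s l" by auto
  then show "x \<in> {1..q}"
    using jordan_part_pos[OF l(1,2), of "TYPE('f)"] jordan_part_le[OF T1_power_q assms l(1,2)] by auto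
qed

lemma sorted_parts: "sorted_wrt (\<ge>) (parts r s)"
  unfolding sorted_wrt_iff_nth_less parts_def
  by (auto intro!: jordan_part_antimono simp del: upt_Suc)

lemma tvec_supported:
  assumes "i \<le> int r" "j \<le> int s" "s \<le> q"
  shows "tvec G g \<nu> i j \<in> (supported ({1..r} \<times> {1..s}) :: (nat \<times> nat \<Rightarrow> 'f) set)"
proof (cases "i \<le> 0 \<or> j \<le> 0")
  case True
  then show ?thesis by (simp add: tvec_def fspace.subspace_0[OF subspace_supported])
next
  case False
  then have "nat i \<in> {1..r}" "nat j \<in> {1..s}" using assms by auto
  then show ?thesis unfolding tvec_def if_not_P[OF False]
    by (intro tensor_supported vact_supported_le bvec_supported assms(3))
qed

lemma gm1_funpow_supported:
  fixes w :: "nat \<times> nat \<Rightarrow> 'f"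
  assumes "w \<in> supported ({1..r} \<times> {1..s})" "r \<le> q" "s \<le> q"
  shows "(gm1 G g ^^ n) w \<in> supported ({1..r} \<times> {1..s})"
proof (induction n)
  case (Suc n)
  then show ?case unfolding funpow.simps comp_apply gm1_def[of G g "(gm1 G g ^^ n) w"]
    by (intro fspace.subspace_diff[OF subspace_supported] tact_supported assms(2,3))
qed (use assms(1) in simp)

text \<open>The strings give a family indexed like the standard basis of the direct sum. Their
  bottoms are, up to sign, distinct vectors \<open>x_d\<close>, which makes the whole family
  independent; the dimension count makes it a basis.\<close>

lemma Vsum_iso_Vtensor:
  assumes r: "1 \<le> r" "r \<le> q" and s: "1 \<le> s" "s \<le> q"
  shows "fgmod_iso G (Vsum G g (parts r s)) (Vtensor G g r s :: ('g, nat \<times> nat \<Rightarrow> 'f) fgmod)"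
proof -
  define m where "m = min r s"
  let ?lo = "lo TYPE('f) r s" and ?hi = "hi TYPE('f) r s" and ?L = "jordan_part TYPE('f) r s"
    and ?mir = "mirror TYPE('f) r s"
  define A where "A = Sigma {1..m} (\<lambda>l. {1..?L l})"
  define B where "B = {1..r} \<times> {1..s}"
  have "finite A" "finite B" by (auto simp: A_def B_def)
  have "Sigma {1..length (parts r s)} (\<lambda>l. {1..part (parts r s) l}) = A"
    unfolding A_def length_parts m_def by (rule Sigma_cong) (simp_all add: part_parts)
  then have carrier: "mcarrier (Vsum G g (parts r s) :: ('g, nat \<times> nat \<Rightarrow> 'f) fgmod) = supported A"
    "mcarrier (Vtensor G g r s :: ('g, nat \<times> nat \<Rightarrow> 'f) fgmod) = supported B"
    by (simp_all add: mcarrier_Vsum mcarrier_Vtensor B_def)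
  \<comment> \<open>The choice depends on \<open>l\<close> only through its interval, so the blocks
    of one interval share a generator.\<close>
  define Fs :: "nat \<Rightarrow> 'f poly" where "Fs l = (SOME F. string r s (?lo l) (?hi l) F)" for l
  define Y where "Y l = monom 1 (l - 1 - ?lo l) * Fs l" for l
  define E where "E = (\<lambda>(l, i). (gm1 G g ^^ (?L l - i)) (gvec 0 (int r + int s - int l) (int r) (Y l)))"
  have lm: "0 < l \<and> l \<le> min r s" if "l \<in> {1..m}" for l using that by (auto simp: m_def)
  have Fs: "string r s (?lo l) (?hi l) (Fs l)" if "l \<in> {1..m}" for l
    using string_at[of l r s, where 'f = 'f] lm[OF that] unfolding Fs_def by (metis someI_ex)
  have dY: "deg_lt l (Y l)" if "l \<in> {1..m}" for l
    unfolding Y_def using Fs[OF that] lo_less[of l "TYPE('f)" r s] that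
    by (intro deg_lt_monom[of "Suc (?lo l)"]) (auto simp: string_def)
  have top_supp: "gvec 0 (int r + int s - int l) (int r) (Y l) \<in> supported B" if "l \<in> {1..m}" for l
    unfolding gvec_bound[OF dY[OF that]] B_def using s
    by (intro fspace.subspace_sum fspace.subspace_scale subspace_supported tvec_supported) auto
  have E_supp: "E ` A \<subseteq> supported B"
  proof
    fix x assume "x \<in> E ` A"
    then obtain l i where "l \<in> {1..m}" "x = (gm1 G g ^^ (?L l - i)) (gvec 0 (int r + int s - int l) (int r) (Y l))"
      by (auto simp: E_def A_def)
    then show "x \<in> supported B" using gm1_funpow_supported[of _ r s] top_supp r s by (simp add: B_def)
  qed
  have E1: "E (l, 1) = (- 1) ^ (l - 1 - ?lo l) *\<^sub>f xvec G g 0 (int (?mir l))" if l: "l \<in> {1..m}" for l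
  proof -
    have b: "?lo l < l" "l \<le> ?hi l" "?hi l \<le> min r s" "?mir l \<le> min r s" "0 < ?mir l"
      using lo_less[of l "TYPE('f)" r s] le_hi[of l r s "TYPE('f)"] hi_le[of l r s "TYPE('f)"]
        mirror_bounds[of l r s "TYPE('f)"] lm[OF l] by auto
    have "alt_on r (?hi l - (l - 1 - ?lo l)) ((- 1) ^ (l - 1 - ?lo l))
        (T1 ^ (r + s - ?lo l - ?hi l - 1) * (monom 1 (l - 1 - ?lo l) * Fs l))"
      using b by (intro string_shift[OF Fs[OF l]]) auto
    moreover have "?hi l - (l - 1 - ?lo l) = ?mir l" using b by (simp add: mirror_def)
    ultimately have alt: "alt_on r (?mir l) ((- 1) ^ (l - 1 - ?lo l)) (T1 ^ (?L l - 1) * Y l)"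
      by (simp add: Y_def jordan_part_def)
    have "E (l, 1) = gvec 0 (int r + int s - int l - int (?L l - 1)) (int r) (T1 ^ (?L l - 1) * Y l)"
      unfolding E_def prod.case using r s by (intro gm1_funpow_gvec[OF dY[OF l]]) auto
    also have "int r + int s - int l - int (?L l - 1) = int (?mir l)"
      using jordan_part_mirror[of l r s "TYPE('f)"] lm[OF l] b by auto
    also have "gvec 0 (int (?mir l)) (int r) (T1 ^ (?L l - 1) * Y l) =
        (- 1) ^ (l - 1 - ?lo l) *\<^sub>f xvec G g 0 (int (?mir l))"
      by (rule gvec_alt[OF alt]) (use b in simp)
    finally show ?thesis .
  qed
  have gmE: "(gm1 G g ^^ n) (E (l, i)) = (if n < i then E (l, i - n) else 0)" if li: "(l, i) \<in> A" for n l i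
  proof (cases "n < i")
    case True
    then have "?L l - (i - n) = n + (?L l - i)" using li by (auto simp: A_def)
    then show ?thesis using True by (simp add: E_def funpow_add)
  next
    case False
    have l: "l \<in> {1..m}" and i: "1 \<le> i" "i \<le> ?L l" using li by (auto simp: A_def)
    have "(gm1 G g ^^ (i - 1)) (E (l, i)) = E (l, 1)"
    proof -
      have "?L l - 1 = (i - 1) + (?L l - i)" using i by auto
      then show ?thesis by (simp add: E_def funpow_add)
    qed
    moreover have "gm1 G g (E (l, 1)) = 0"
      unfolding E1[OF l] using mirror_bounds[of l r s "TYPE('f)"] lm[OF l] r gm1_xvec[of "?mir l" 0]
      by (simp add: gm1_simps)
    ultimately have "(gm1 G g ^^ Suc (i - 1)) (E (l, i)) = 0" by simp
    moreover have "n = (n - i) + Suc (i - 1)" using False i by auto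
    ultimately have "(gm1 G g ^^ n) (E (l, i)) = (gm1 G g ^^ (n - i)) 0"
      by (metis comp_apply funpow_add)
    then show ?thesis using False by (simp add: gm1_funpow_simps(4))
  qed
  have ind: "\<forall>\<kappa>\<in>A. u \<kappa> = 0" if u0: "(\<Sum>\<kappa>\<in>A. u \<kappa> *\<^sub>f E \<kappa>) = 0" for u
  proof -
    \<comment> \<open>Downward induction on the level \<open>i\<close>, with \<open>k\<close>
      measuring how far below \<open>r + s\<close> it may lie.\<close>
    have "\<forall>l i. (l, i) \<in> A \<longrightarrow> r + s < i + k \<longrightarrow> u (l, i) = 0" for k
    proof (induction k)
      case 0
      then show ?case by (auto simp: A_def jordan_part_def)
    next
      case (Suc k)
      show ?case
      proof (intro allI impI)
        fix l i assume li: "(l, i) \<in> A" "r + s < i + Suc k"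
        show "u (l, i) = 0"
        proof (cases "r + s < i + k")
          case True
          then show ?thesis using Suc li by blast
        next
          case False
          obtain n where n: "i = Suc n" using li by (cases i) (auto simp: A_def)
          define c where "c l = (if i \<le> ?L l then u (l, i) * (- 1) ^ (l - 1 - ?lo l) else 0)" for l
          have "0 = (gm1 G g ^^ n) (\<Sum>\<kappa>\<in>A. u \<kappa> *\<^sub>f E \<kappa>)" unfolding u0 by (simp only: gm1_funpow_simps(4))
          \<comment> \<open>Applying \<open>(g - 1)^(i-1)\<close> kills the levels below
            \<open>i\<close>, the levels above carry zero coefficients by induction, and level
            \<open>i\<close> is taken to the bottoms of the strings.\<close>
          also have "\<dots> = (\<Sum>\<kappa>\<in>A. u \<kappa> *\<^sub>f (gm1 G g ^^ n) (E \<kappa>))" by (simp only: gm1_funpow_simps)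
          also have "\<dots> = (\<Sum>(l, j)\<in>A. if j = i then u (l, i) *\<^sub>f E (l, 1) else 0)"
          proof (intro sum.cong refl)
            fix \<kappa> assume "\<kappa> \<in> A"
            then obtain l' j where lj: "\<kappa> = (l', j)" "(l', j) \<in> A" by (cases \<kappa>) auto
            consider "j \<le> n" | "j = i" | "i < j" using n by linarith
            then show "u \<kappa> *\<^sub>f (gm1 G g ^^ n) (E \<kappa>) = (case \<kappa> of (l, j) \<Rightarrow> if j = i then u (l, i) *\<^sub>f E (l, 1) else 0)"
            proof cases
              case 3
              then have "u (l', j) = 0" using Suc lj(2) li(2) by auto
              then show ?thesis using 3 lj by simp
            qed (use lj gmE[OF lj(2), of n] n in auto)
          qed
          also have "\<dots> = (\<Sum>l = 1..m. \<Sum>j = 1..?L l. if j = i then u (l, i) *\<^sub>f E (l, 1) else 0)"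
            unfolding A_def by (rule sum.Sigma[symmetric]) auto
          also have "\<dots> = (\<Sum>l = 1..m. c l *\<^sub>f xvec G g 0 (int (?mir l)))"
          proof (intro sum.cong refl)
            fix l assume l: "l \<in> {1..m}"
            show "(\<Sum>j = 1..?L l. if j = i then u (l, i) *\<^sub>f E (l, 1) else 0) = c l *\<^sub>f xvec G g 0 (int (?mir l))"
              using n E1[OF l] by (simp add: c_def sum.delta)
          qed
          also have "\<dots> = (\<Sum>d = 1..m. c (?mir d) *\<^sub>f xvec G g 0 (int d))"
          proof -
            have "(\<Sum>d = 1..m. c (?mir d) *\<^sub>f xvec G g 0 (int d)) =
              (\<Sum>l = 1..m. c (?mir (?mir l)) *\<^sub>f (xvec G g 0 (int (?mir l)) :: nat \<times> nat \<Rightarrow> 'f))"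
              unfolding m_def by (rule sum.reindex_bij_betw[OF bij_betw_mirror, symmetric])
            then show ?thesis using lm by (simp add: mirror_mirror)
          qed
          finally have "(\<Sum>d = 1..m. c (?mir d) *\<^sub>f xvec G g 0 (int d)) = 0" by simp
          moreover have l: "l \<in> {1..m}" using li by (auto simp: A_def)
          then have "?mir l \<in> {1..m}" using mirror_bounds[of l r s "TYPE('f)"] lm[OF l] by (auto simp: m_def)
          ultimately have "c (?mir (?mir l)) = 0"
            using r by (intro xvec_independent[of "\<lambda>d. c (?mir d)" 0 m]) (auto simp: m_def)
          then have "c l = 0" using lm[OF l] by (simp add: mirror_mirror)
          then show ?thesis using li by (simp add: c_def A_def)
        qed
      qed
    qed
    from this[of "r + s"] show ?thesis by (auto simp: A_def)
  qed
  have "card A = (\<Sum>l = 1..m. ?L l)" unfolding A_def by (simp add: card_SigmaI)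
  also have "\<dots> = r * s" unfolding m_def by (rule sum_jordan_part)
  finally have card: "card A = card B" by (simp add: B_def)
  define \<psi> where "\<psi> u = (\<Sum>\<kappa>\<in>A. u \<kappa> *\<^sub>f E \<kappa>)" for u
  have add: "\<psi> (u + w) = \<psi> u + \<psi> w" for u w
    by (simp add: \<psi>_def fspace.scale_left_distrib sum.distrib)
  have scale: "\<psi> (c *\<^sub>f u) = c *\<^sub>f \<psi> u" for c u
    by (simp add: \<psi>_def fspace.scale_sum_right)
  have diff: "\<psi> (u - w) = \<psi> u - \<psi> w" for u w
    by (simp add: \<psi>_def fspace.scale_left_diff_distrib sum_subtractf)
  have "bij_betw \<psi> (supported A) (supported B)"
  proof (rule bij_betw_imageI)
    show "inj_on \<psi> (supported A)"
    proof (rule inj_onI)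
      fix u w assume uw: "u \<in> supported A" "w \<in> supported A" "\<psi> u = \<psi> w"
      then have "\<forall>\<kappa>\<in>A. (u - w) \<kappa> = 0" using diff[of u w] by (intro ind) (simp add: \<psi>_def)
      then show "u = w" using uw(1,2) by (auto simp: supported_def fun_eq_iff)
    qed
    show "\<psi> ` supported A = supported B"
    proof
      show "\<psi> ` supported A \<subseteq> supported B"
        unfolding \<psi>_def using E_supp
        by (auto intro!: fspace.subspace_sum[OF subspace_supported] fspace.subspace_scale[OF subspace_supported])
      show "supported B \<subseteq> \<psi> ` supported A"
      proof
        fix w :: "nat \<times> nat \<Rightarrow> 'f" assume "w \<in> supported B"
        from family_spans[OF \<open>finite A\<close> ind \<open>finite B\<close> E_supp card this]
        obtain u where "u \<in> supported A" "w = (\<Sum>\<kappa>\<in>A. u \<kappa> *\<^sub>f E \<kappa>)" by metis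
        then show "w \<in> \<psi> ` supported A" by (auto simp: \<psi>_def)
      qed
    qed
  qed
  moreover have "\<psi> (maction (Vsum G g (parts r s)) g u) = maction (Vtensor G g r s) g (\<psi> u)"
    if u: "u \<in> supported A" for u
  proof -
    define Su where "Su = (\<lambda>(l, i). if i = 0 then 0 else u (l, Suc i))"
    have "maction (Vsum G g (parts r s)) g u = u + Su"
      unfolding Su_def by (rule maction_Vsum_g[OF _ set_parts[OF r(2) s(2)]])
        (use u carrier mcarrier_Vsum[of "parts r s"] in auto)
    moreover have "maction (Vtensor G g r s) g (\<psi> u) = \<psi> u + gm1 G g (\<psi> u)"
      by (simp add: Vtensor_def gm1_def)
    moreover have "gm1 G g (\<psi> u) = \<psi> Su"
    proof -
      have "gm1 G g (\<psi> u) = (\<Sum>\<kappa>\<in>A. u \<kappa> *\<^sub>f gm1 G g (E \<kappa>))" by (simp add: \<psi>_def gm1_simps)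
      also have "\<dots> = (\<Sum>(l, i)\<in>A. u (l, i) *\<^sub>f (if 1 < i then E (l, i - 1) else 0))"
        using gmE[of _ _ 1] by (intro sum.cong refl) auto
      also have "\<dots> = (\<Sum>l = 1..m. \<Sum>i = 1..?L l. u (l, i) *\<^sub>f (if 1 < i then E (l, i - 1) else 0))"
        unfolding A_def by (rule sum.Sigma[symmetric]) auto
      also have "\<dots> = (\<Sum>l = 1..m. \<Sum>i = 1..?L l. u (l, Suc i) *\<^sub>f E (l, i))"
      proof (rule sum.cong[OF refl])
        fix l assume l: "l \<in> {1..m}"
        have "u (l, Suc (?L l)) = 0" using u by (intro supportedD) (auto simp: A_def)
        then show "(\<Sum>i = 1..?L l. u (l, i) *\<^sub>f (if 1 < i then E (l, i - 1) else 0)) =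
            (\<Sum>i = 1..?L l. u (l, Suc i) *\<^sub>f E (l, i))"
          using sum_shift_index[of "\<lambda>i. u (l, i) *\<^sub>f (if 1 < i then E (l, i - 1) else 0)"
              "\<lambda>i. u (l, Suc i) *\<^sub>f E (l, i)" "?L l"] jordan_part_pos[of l r s "TYPE('f)"] lm[OF l]
          by simp
      qed
      also have "\<dots> = (\<Sum>(l, i)\<in>A. u (l, Suc i) *\<^sub>f E (l, i))"
        unfolding A_def by (rule sum.Sigma) auto
      also have "\<dots> = \<psi> Su" unfolding \<psi>_def Su_def by (intro sum.cong refl) (auto simp: A_def)
      finally show ?thesis .
    qed
    ultimately show ?thesis by (simp add: add)
  qed
  ultimately show ?thesis
    using add scale carrier r s
    by (intro fgmod_isoI[of _ _ \<psi>] gen_module_Vsum set_parts gen_module_Vtensor) auto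
qed

text \<open>The vectors killed by \<open>S\<close> that lie in the image of \<open>S^(c-1)\<close>
  span a space whose dimension is the number of parts of size at least \<open>c\<close>, and
  \<open>\<phi>\<close> respects both conditions. Applied to the inverse isomorphism this gives the
  opposite inequality.\<close>

lemma Vsum_iso_card_le:
  assumes xs: "set xs \<subseteq> {1..q}" and ys: "set ys \<subseteq> {1..q}" and c: "0 < c"
    and iso: "fgmod_iso G (Vsum G g xs :: ('g, nat \<times> nat \<Rightarrow> 'f) fgmod) (Vsum G g ys :: ('g, nat \<times> nat \<Rightarrow> 'f) fgmod)"
  shows "card {l \<in> {1..length xs}. c \<le> part xs l} \<le> card {l \<in> {1..length ys}. c \<le> part ys l}"
proof -
  define S :: "(nat \<times> nat \<Rightarrow> 'f) \<Rightarrow> nat \<times> nat \<Rightarrow> 'f"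
    where "S u = (\<lambda>(l, i). if i = 0 then 0 else u (l, Suc i))" for u
  let ?X = "Sigma {1..length xs} (\<lambda>l. {1..part xs l})" and ?Y = "Sigma {1..length ys} (\<lambda>l. {1..part ys l})"
  obtain \<phi> :: "(nat \<times> nat \<Rightarrow> 'f) \<Rightarrow> nat \<times> nat \<Rightarrow> 'f" where bij: "bij_betw \<phi> (supported ?X) (supported ?Y)"
    and add: "\<And>u w. u \<in> supported ?X \<Longrightarrow> w \<in> supported ?X \<Longrightarrow> \<phi> (u + w) = \<phi> u + \<phi> w"
    and scale: "\<And>c u. u \<in> supported ?X \<Longrightarrow> \<phi> (c *\<^sub>f u) = c *\<^sub>f \<phi> u"
    and act: "\<And>u. u \<in> supported ?X \<Longrightarrow> \<phi> (maction (Vsum G g xs) g u) = maction (Vsum G g ys) g (\<phi> u)"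
    using iso g_in unfolding fgmod_iso_def mcarrier_Vsum by blast
  have \<phi>in: "\<phi> u \<in> supported ?Y" if "u \<in> supported ?X" for u using bij that by (auto simp: bij_betw_def)
  have Sin: "S u \<in> supported ?X" if "u \<in> supported ?X" for u
    using that by (auto simp: S_def supported_def)
  have \<phi>0: "\<phi> 0 = 0"
    using scale[of 0 0] fspace.subspace_0[OF subspace_supported[of ?X]] by simp
  have \<phi>S: "\<phi> (S u) = S (\<phi> u)" if u: "u \<in> supported ?X" for u
  proof -
    have "\<phi> (u + S u) = \<phi> u + S (\<phi> u)"
      using act[OF u] maction_Vsum_g[OF u xs] maction_Vsum_g[OF \<phi>in[OF u] ys] by (simp add: S_def)
    then show ?thesis using add[OF u Sin[OF u]] by simp
  qed
  have S_pow: "(S ^^ n) u (l, i) = u (l, i + n)" if "0 < i" for n u l i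
    using that by (induction n arbitrary: i) (auto simp: S_def)
  have S_pow0: "(S ^^ n) u (l, 0) = 0" if "u (l, 0) = 0" for n u l
    using that by (cases n) (auto simp: S_def)
  define A B where "A = {l \<in> {1..length xs}. c \<le> part xs l}" and "B = {l \<in> {1..length ys}. c \<le> part ys l}"
  define E where "E l = \<phi> (bvec (l, 1))" for l
  have fin: "finite A" "finite B" by (auto simp: A_def B_def)
  have bX: "bvec (l, 1) \<in> supported ?X" "bvec (l, c) \<in> supported ?X" if "l \<in> A" for l
    using that c by (auto intro!: bvec_supported simp: A_def)
  have E_in: "E l \<in> fspace.span (bvec ` ((\<lambda>l. (l, 1)) ` B))" if l: "l \<in> A" for l
  proof -
    define w where "w = \<phi> (bvec (l, c))"
    have w: "w \<in> supported ?Y" unfolding w_def by (rule \<phi>in[OF bX(2)[OF l]])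
    have "(S ^^ (c - 1)) (bvec (l, c)) = (bvec (l, 1) :: nat \<times> nat \<Rightarrow> 'f)"
    proof
      fix x :: "nat \<times> nat"
      obtain l' i where x: "x = (l', i)" by (cases x)
      show "(S ^^ (c - 1)) (bvec (l, c)) x = (bvec (l, 1) x :: 'f)"
      proof (cases "i = 0")
        case True
        then show ?thesis unfolding x using S_pow0[of "bvec (l, c)" l' "c - 1"] c by (simp add: bvec_def)
      next
        case False
        then show ?thesis unfolding x using S_pow[of i "c - 1" "bvec (l, c)" l'] c by (auto simp: bvec_def)
      qed
    qed
    moreover have "\<phi> ((S ^^ n) (bvec (l, c))) = (S ^^ n) w \<and> (S ^^ n) (bvec (l, c)) \<in> supported ?X" for n
    proof (induction n)
      case (Suc n)
      then show ?case unfolding funpow.simps comp_apply by (metis \<phi>S Sin)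
    qed (use bX(2)[OF l] in \<open>simp add: w_def\<close>)
    ultimately have Ew: "E l = (S ^^ (c - 1)) w" by (metis E_def)
    have "S (bvec (l, 1)) = (0 :: nat \<times> nat \<Rightarrow> 'f)" by (auto simp: S_def bvec_def fun_eq_iff)
    then have SE: "S (E l) = 0" using \<phi>S[OF bX(1)[OF l]] \<phi>0 by (simp add: E_def)
    have "E l \<in> supported ((\<lambda>l. (l, 1)) ` B)"
      unfolding supported_def
    proof (intro CollectI allI impI)
      fix x :: "nat \<times> nat" assume x: "x \<notin> (\<lambda>l. (l, 1)) ` B"
      obtain l' i where li: "x = (l', i)" by (cases x)
      have El: "E l \<in> supported ?Y" unfolding E_def by (rule \<phi>in[OF bX(1)[OF l]])
      consider "i = 0" | "i = 1" | "1 < i" by linarith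
      then show "E l x = 0"
      proof cases
        case 1
        then show ?thesis using El li by (auto simp: supported_def)
      next
        case 2
        \<comment> \<open>Outside \<open>B\<close> the vector \<open>w\<close> has no coordinate at
          level \<open>c\<close> that could be shifted down to level 1.\<close>
        then have "l' \<notin> B" using x li by auto
        then have "w (l', c) = 0" using c by (intro supportedD[OF w]) (auto simp: B_def)
        then show ?thesis using 2 li S_pow[of 1 "c - 1" w l'] c Ew by simp
      next
        case 3
        then have "E l x = S (E l) (l', i - 1)" by (simp add: S_def li)
        then show ?thesis using SE by simp
      qed
    qed
    then show ?thesis using fin by (simp add: span_bvec)
  qed
  have ind: "\<forall>l\<in>A. u l = 0" if u: "(\<Sum>l\<in>A. u l *\<^sub>f E l) = 0" for u
  proof -
    have sum: "\<phi> (\<Sum>l\<in>A'. u l *\<^sub>f bvec (l, 1)) = (\<Sum>l\<in>A'. u l *\<^sub>f E l) \<and>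
        (\<Sum>l\<in>A'. u l *\<^sub>f bvec (l, 1)) \<in> supported ?X" if "finite A'" "A' \<subseteq> A" for A'
      using that
    proof (induction A' rule: finite_induct)
      case empty
      show ?case unfolding sum.empty by (intro conjI \<phi>0 fspace.subspace_0[OF subspace_supported])
    next
      case (insert l A')
      have "l \<in> A" "A' \<subseteq> A" using insert.prems by blast+
      then have b: "bvec (l, 1) \<in> supported ?X" by (intro bX(1))
      have ub: "u l *\<^sub>f bvec (l, 1) \<in> supported ?X" by (rule fspace.subspace_scale[OF subspace_supported b])
      have IH: "\<phi> (\<Sum>l\<in>A'. u l *\<^sub>f bvec (l, 1)) = (\<Sum>l\<in>A'. u l *\<^sub>f E l)"
        "(\<Sum>l\<in>A'. u l *\<^sub>f bvec (l, 1)) \<in> supported ?X"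
        using insert.IH[OF \<open>A' \<subseteq> A\<close>] by (rule conjunct1, rule conjunct2)
      show ?case unfolding sum.insert[OF insert(1,2)] add[OF ub IH(2)] scale[OF b] IH(1) E_def[of l]
        by (intro conjI refl fspace.subspace_add[OF subspace_supported] ub IH(2))
    qed
    have inj: "inj_on \<phi> (supported ?X)" by (rule bij_betw_imp_inj_on[OF bij])
    have "\<phi> (\<Sum>l\<in>A. u l *\<^sub>f bvec (l, 1)) = \<phi> 0"
      by (simp only: conjunct1[OF sum[OF fin(1) subset_refl]] u \<phi>0)
    from inj_onD[OF inj this conjunct2[OF sum[OF fin(1) subset_refl]] fspace.subspace_0[OF subspace_supported]]
    have S0: "(\<Sum>l\<in>A. u l *\<^sub>f bvec (l, 1 :: nat)) = (0 :: nat \<times> nat \<Rightarrow> 'f)" .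
    show ?thesis
    proof
      fix l assume "l \<in> A"
      have "(\<Sum>l'\<in>A. u l' *\<^sub>f bvec (l', 1 :: nat)) (l, 1) = (\<Sum>l'\<in>A. if l' = l then u l' else (0 :: 'f))"
        unfolding sum_fun_apply by (intro sum.cong) (auto simp: bvec_def)
      then show "u l = 0" unfolding S0 using \<open>l \<in> A\<close> fin by simp
    qed
  qed
  have "inj_on E A" "\<not> fspace.dependent (E ` A)"
    using family_independent[of A E] fin(1) ind by blast+
  moreover have "E ` A \<subseteq> fspace.span (bvec ` ((\<lambda>l. (l, 1)) ` B))" using E_in by blast
  ultimately have "card (E ` A) \<le> card (bvec ` ((\<lambda>l. (l, 1 :: nat)) ` B) :: (nat \<times> nat \<Rightarrow> 'f) set)"
    using fspace.independent_span_bound[of "bvec ` ((\<lambda>l. (l, 1)) ` B)" "E ` A"] fin by auto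
  also have "\<dots> = card B" by (simp add: card_bvec card_image inj_on_def)
  finally show ?thesis using \<open>inj_on E A\<close> by (simp add: card_image A_def B_def)
qed

lemma decomposes_as_unique:
  assumes M: "gen_module (M :: ('g, 'i \<Rightarrow> 'f) fgmod)"
    and xs: "decomposes_as G g M xs" and ys: "decomposes_as G g M ys"
  shows "xs = ys"
proof -
  have s: "set xs \<subseteq> {1..q}" "set ys \<subseteq> {1..q}" "sorted_wrt (\<ge>) xs" "sorted_wrt (\<ge>) ys"
    and iso: "fgmod_iso G M (Vsum G g xs :: ('g, nat \<times> nat \<Rightarrow> 'f) fgmod)"
      "fgmod_iso G M (Vsum G g ys :: ('g, nat \<times> nat \<Rightarrow> 'f) fgmod)"
    using xs ys by (auto simp: decomposes_as_def)
  note i = fgmod_iso_trans[OF fgmod_iso_sym[OF M gen_module_Vsum[OF s(1)] iso(1)] iso(2)]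
    fgmod_iso_trans[OF fgmod_iso_sym[OF M gen_module_Vsum[OF s(2)] iso(2)] iso(1)]
  show ?thesis
  proof (rule sorted_list_eq[OF s(3,4)])
    show "card {l \<in> {1..length xs}. c \<le> part xs l} = card {l \<in> {1..length ys}. c \<le> part ys l}" if "0 < c" for c
      using Vsum_iso_card_le[OF s(1,2) that i(1)] Vsum_iso_card_le[OF s(2,1) that i(2)] by (rule antisym)
  qed (use s in auto)
qed

lemma decomposes_as_Vtensor_iff:
  assumes "1 \<le> r" "r \<le> q" "1 \<le> s" "s \<le> q"
  shows "decomposes_as G g (Vtensor G g r s :: ('g, nat \<times> nat \<Rightarrow> 'f) fgmod) xs \<longleftrightarrow> xs = parts r s"
proof -
  note m = gen_module_Vtensor[OF assms(2,4)]
  have "decomposes_as G g (Vtensor G g r s :: ('g, nat \<times> nat \<Rightarrow> 'f) fgmod) (parts r s)"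
    unfolding decomposes_as_def
    using sorted_parts set_parts[OF assms(2,4)]
      fgmod_iso_sym[OF gen_module_Vsum[OF set_parts[OF assms(2,4)]] m Vsum_iso_Vtensor[OF assms]]
    by simp
  then show ?thesis using decomposes_as_unique[OF m] by blast
qed

lemma parts_of_Vtensor:
  assumes "1 \<le> r" "r \<le> q" "1 \<le> s" "s \<le> q"
  shows "parts_of G g (Vtensor G g r s :: ('g, nat \<times> nat \<Rightarrow> 'f) fgmod) = parts r s"
  unfolding parts_of_def by (rule the_equality) (simp_all add: decomposes_as_Vtensor_iff[OF assms])

end

section \<open>Lifted strings and the matrices J(r,s)\<close>

text \<open>At -1 the factor \<open>T1 ^ \<mu>\<close> vanishes, and
  \<open>(-1)^(q-R) = - (-1)^R\<close>.\<close>

lemma string_pair_values: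
  fixes \<beta> \<gamma> :: "'f::field poly" and q :: nat
  assumes sgn: "(- 1 :: 'f) ^ q = - 1" and "R \<le> q" "0 < \<mu>"
    and eq: "monom 1 (q - R) * \<gamma> + smult ((- 1) ^ R) \<beta> = T1 ^ \<mu> * h"
  shows "poly \<gamma> (- 1) = poly \<beta> (- 1)"
proof -
  have "poly (monom 1 (q - R) * \<gamma> + smult ((- 1) ^ R) \<beta>) (- 1) = 0"
    unfolding eq using \<open>0 < \<mu>\<close> by (simp add: poly_power)
  then have "(- 1) ^ (q - R) * poly \<gamma> (- 1) = - ((- 1) ^ R * poly \<beta> (- 1))"
    by (simp add: eq_neg_iff_add_eq_0)
  moreover have "(- 1 :: 'f) ^ (q - R) = - ((- 1) ^ R)"
    using neg_one_power_add_eq_neg_one_power_diff[OF \<open>R \<le> q\<close>, where 'a = 'f] sgn by (simp add: power_add)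
  ultimately have "(- 1) ^ R * poly \<gamma> (- 1) = (- 1) ^ R * poly \<beta> (- 1)" by simp
  then show ?thesis by simp
qed

text \<open>In contrast to \<open>alt_on_monom\<close> the base index moves along with the exponent,
  so the element of the module is unchanged and no sign appears.\<close>

lemma alt_on_shift:
  fixes F :: "'f::field poly"
  assumes "alt_on r b c F" "b \<le> r"
  shows "alt_on (r + k) b c (monom 1 k * F)"
  unfolding alt_on_def
proof (intro allI impI)
  fix i assume i: "i < r + k" "r + k \<le> i + b"
  then have "coeff F (i - k) = c * (- 1) ^ (r - 1 - (i - k))" "k \<le> i"
    using assms by (auto simp: alt_on_def)
  moreover have "r - 1 - (i - k) = r + k - 1 - i" using i assms(2) by auto
  ultimately show "coeff (monom 1 k * F) i = c * (- 1) ^ (r + k - 1 - i)" by (simp add: coeff_monom_mult')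
qed

lemma deg_lt_frob_mult:
  fixes D C :: "'f::field poly"
  assumes "deg_lt (Suc t) D" "deg_lt e C" "t * q + e \<le> n"
  shows "deg_lt n (frob q D * C)"
proof (rule deg_lt_mult[OF assms(2)])
  show "degree (frob q D) \<le> t * q"
    using assms(1) by (simp add: degree_pcompose degree_monom_eq deg_lt_Suc_iff)
qed (use assms(3) in simp)

lemma deg_lt_alt_poly: "deg_lt (Suc t) (alt_poly t)"
  by (simp add: deg_lt_def coeff_alt_poly)

context
  fixes \<beta> \<gamma> :: "'f::field poly" and q a b R S :: nat
  assumes frob: "(T1 :: 'f poly) ^ q = 1 + monom 1 q" and sgn: "(- 1 :: 'f) ^ q = - 1"
    and ab: "a < b" "b \<le> R" "b \<le> S" "R + S \<le> q + a" and RS: "R < q" "S < q"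
    and reg: "regular TYPE('f) R (q - S) (R - b)" and reg': "regular TYPE('f) (q - R) S (S - b)"
    and \<beta>: "string (q - R) S (S - b) (S - a) \<beta>"
    and \<gamma>: "string R (q - S) (R - b) (R - a) \<gamma>"
begin

text \<open>\<open>d\<close> is the offset of the row inside its block, and the row is
  \<open>(-1)^d x^d\<close> times the leading one. Moving the target \<open>x\<close> vector down by
  \<open>x^d\<close> costs a second \<open>(-1)^d\<close>, which cancels the first.\<close>

lemma z_poly_socle:
  assumes d: "d + a < b"
  shows "alt_on (Suc t * q) (t * q + (R + S - a - d)) 1
    (T1 ^ (q - (R + S - a - b) - 1) *
      z_poly q R t (smult ((- 1) ^ d) (monom 1 d * \<gamma>)) (smult ((- 1) ^ d) (monom 1 d * \<beta>)))"
proof -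
  define \<mu> where "\<mu> = R + S - a - b"
  obtain h where h: "monom 1 (q - R) * \<gamma> + smult ((- 1) ^ R) \<beta> = T1 ^ \<mu> * h"
    "poly h (- 1) = 1" "deg_lt (Suc (q + a - R - S)) h"
    using string_pair[OF frob sgn ab RS reg \<beta> \<gamma>] unfolding \<mu>_def by metis
  have \<mu>: "(q - \<mu> - 1) + \<mu> = q - 1" using ab by (auto simp: \<mu>_def)
  let ?H = "frob q (alt_poly t) :: 'f poly"
  have "z_poly q R t (smult ((- 1) ^ d) (monom 1 d * \<gamma>)) (smult ((- 1) ^ d) (monom 1 d * \<beta>)) =
      smult ((- 1) ^ d) (monom 1 d * (?H * (monom 1 (q - R) * \<gamma> + smult ((- 1) ^ R) \<beta>)))"
    by (simp add: z_poly_def algebra_simps smult_add_right)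
  then have "T1 ^ (q - \<mu> - 1) *
      z_poly q R t (smult ((- 1) ^ d) (monom 1 d * \<gamma>)) (smult ((- 1) ^ d) (monom 1 d * \<beta>)) =
      smult ((- 1) ^ d) (monom 1 d * (?H * (T1 ^ (q - \<mu> - 1) * T1 ^ \<mu> * h)))"
    unfolding h(1) by (simp add: mult_ac)
  also have "T1 ^ (q - \<mu> - 1) * T1 ^ \<mu> = (T1 ^ (q - 1) :: 'f poly)"
    unfolding \<mu>[symmetric] by (rule power_add[symmetric])
  finally have eq: "T1 ^ (q - \<mu> - 1) *
      z_poly q R t (smult ((- 1) ^ d) (monom 1 d * \<gamma>)) (smult ((- 1) ^ d) (monom 1 d * \<beta>)) =
      smult ((- 1) ^ d) (monom 1 d * (?H * (T1 ^ (q - 1) * h)))" .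
  have "alt_on (Suc t * q) (Suc t * q - (q + a - R - S)) 1 (?H * (T1 ^ (q - 1) * h))"
    using RS by (intro alternating_block[OF frob sgn _ h(3,2)]) simp
  also have "Suc t * q - (q + a - R - S) = (t * q + (R + S - a - d)) + d" using ab d by auto
  finally have "alt_on (Suc t * q) (t * q + (R + S - a - d)) ((- 1) ^ d * 1) (monom 1 d * (?H * (T1 ^ (q - 1) * h)))"
    by (rule alt_on_monom) (use ab d in auto)
  then have "alt_on (Suc t * q) (t * q + (R + S - a - d)) ((- 1) ^ d * ((- 1) ^ d * 1))
      (smult ((- 1) ^ d) (monom 1 d * (?H * (T1 ^ (q - 1) * h))))"
    by (rule alt_on_smult)
  then show ?thesis unfolding eq[unfolded \<mu>_def] by (simp flip: power_add mult_2)
qed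

text \<open>The generators without a shift \<open>x^d\<close> belong to the first index of the
  block. The length splits into \<open>c * q\<close> steps from \<open>y\<close> to \<open>z\<close>
  and \<open>N\<close> steps from \<open>z\<close> to the bottom.\<close>

lemma y_poly_string:
  fixes \<Phi> \<Psi> :: "'f poly"
  assumes t: "t < rn" "t < sn"
    and small: "regular TYPE('f) (Suc rn) (Suc sn) (Suc t)" "regular TYPE('f) rn sn t"
    and \<Phi>: "deg_lt (Suc t) \<Phi>" "alt_on (Suc rn) (Suc t) 1 (T1 ^ (rn + sn - 2 * t - 1) * \<Phi>)"
    and \<Psi>: "deg_lt (Suc t) \<Psi>" "alt_on rn (Suc t) 1 (T1 ^ (rn + sn - 2 * t - 1) * \<Psi>)"
  shows "string (rn * q + R) (sn * q + S) (t * q + (R + S - b)) (t * q + (R + S - a)) (y_poly q R \<Phi> \<Psi> \<gamma> \<beta>)"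
    and "poly (y_poly q R \<Phi> \<Psi> \<gamma> \<beta>) (- 1) \<noteq> 0"
proof -
  define \<mu> c k0 where "\<mu> = R + S - a - b" and "c = rn + sn - 2 * t - 1" and "k0 = Suc (R + S - b)"
  define N where "N = q - \<mu> - 1"
  obtain e where rn: "rn = Suc t + e" using t less_imp_Suc_add by (metis add_Suc)
  obtain e' where sn: "sn = Suc t + e'" using t less_imp_Suc_add by (metis add_Suc)
  have c: "c = e + e' + 1" by (simp add: c_def rn sn)
  have d\<gamma>: "deg_lt (k0 - S) \<gamma>" and d\<beta>: "deg_lt (k0 - R) \<beta>"
    using \<gamma> \<beta> ab by (auto simp: string_def k0_def Suc_diff_le)
  have k0: "R < k0" "S < k0" "k0 \<le> q" "k0 \<le> R + S" using ab by (auto simp: k0_def)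
  have "alt_on (rn * q + R) (Suc t * q + R + S - k0) 0
    (T1 ^ (c * q) * y_poly q R \<Phi> \<Psi> \<gamma> \<beta> - monom 1 (rn * q + R - Suc t * q) * z_poly q R t \<gamma> \<beta>)"
    by (rule y_poly_to_z_poly[OF frob d\<gamma> d\<beta> RS k0 t(1)]) (use \<Phi>(2) \<Psi>(2) in \<open>auto simp: c_def\<close>)
  then have "alt_on (rn * q + R) (t * q + (R + S - a)) 0 (T1 ^ N *
    (T1 ^ (c * q) * y_poly q R \<Phi> \<Psi> \<gamma> \<beta> - monom 1 (rn * q + R - Suc t * q) * z_poly q R t \<gamma> \<beta>))"
    by (rule alt_on_0_T1_power) (use ab RS in \<open>auto simp: N_def \<mu>_def k0_def\<close>)
  moreover have "alt_on (rn * q + R) (t * q + (R + S - a)) 1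
      (monom 1 (rn * q + R - Suc t * q) * (T1 ^ N * z_poly q R t \<gamma> \<beta>))"
  proof -
    have "alt_on (Suc t * q) (t * q + (R + S - a)) 1 (T1 ^ N * z_poly q R t \<gamma> \<beta>)"
      using z_poly_socle[of 0 t] ab by (simp add: N_def \<mu>_def one_pCons[symmetric] flip: one_poly_eq_simps)
    then have "alt_on (Suc t * q + (rn * q + R - Suc t * q)) (t * q + (R + S - a)) 1
      (monom 1 (rn * q + R - Suc t * q) * (T1 ^ N * z_poly q R t \<gamma> \<beta>))"
      by (rule alt_on_shift) (use ab in simp)
    then show ?thesis by (simp add: rn algebra_simps)
  qed
  ultimately have "alt_on (rn * q + R) (t * q + (R + S - a)) (0 + 1) (T1 ^ N *
    (T1 ^ (c * q) * y_poly q R \<Phi> \<Psi> \<gamma> \<beta> - monom 1 (rn * q + R - Suc t * q) * z_poly q R t \<gamma> \<beta>) +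
      monom 1 (rn * q + R - Suc t * q) * (T1 ^ N * z_poly q R t \<gamma> \<beta>))"
    by (rule alt_on_add)
  also have "T1 ^ N * (T1 ^ (c * q) * y_poly q R \<Phi> \<Psi> \<gamma> \<beta> - monom 1 (rn * q + R - Suc t * q) * z_poly q R t \<gamma> \<beta>) +
      monom 1 (rn * q + R - Suc t * q) * (T1 ^ N * z_poly q R t \<gamma> \<beta>) =
      T1 ^ (N + c * q) * y_poly q R \<Phi> \<Psi> \<gamma> \<beta>"
    by (simp add: power_add algebra_simps)
  also have "N + c * q = rn * q + R + (sn * q + S) - (t * q + (R + S - b)) - (t * q + (R + S - a)) - 1"
    using ab RS by (simp add: N_def \<mu>_def c rn sn algebra_simps)
  finally have alt: "alt_on (rn * q + R) (t * q + (R + S - a)) 1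
    (T1 ^ (rn * q + R + (sn * q + S) - (t * q + (R + S - b)) - (t * q + (R + S - a)) - 1) * y_poly q R \<Phi> \<Psi> \<gamma> \<beta>)"
    by simp
  have "deg_lt (t * q + k0) (y_poly q R \<Phi> \<Psi> \<gamma> \<beta>)"
    unfolding y_poly_def
    by (intro deg_lt_add deg_lt_smult deg_lt_monom[where a = "t * q + k0 - R"] deg_lt_frob_mult[OF \<Phi>(1) d\<gamma>]
        deg_lt_frob_mult[OF \<Psi>(1) d\<beta>]) (use k0 in auto)
  then show "string (rn * q + R) (sn * q + S) (t * q + (R + S - b)) (t * q + (R + S - a)) (y_poly q R \<Phi> \<Psi> \<gamma> \<beta>)"
    using alt ab RS by (auto simp: string_def k0_def rn sn algebra_simps)
  obtain h where "monom 1 (q - R) * \<gamma> + smult ((- 1) ^ R) \<beta> = T1 ^ \<mu> * h"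
    using string_pair[OF frob sgn ab RS reg \<beta> \<gamma>] unfolding \<mu>_def by metis
  \<comment> \<open>Because \<open>\<gamma>\<close> and \<open>\<beta>\<close> agree at -1, the
    value of \<open>y_poly\<close> there factors.\<close>
  then have v: "poly \<gamma> (- 1) = poly \<beta> (- 1)"
    by (rule string_pair_values[OF sgn, rotated 2]) (use ab RS in \<open>auto simp: \<mu>_def\<close>)
  have "poly (y_poly q R \<Phi> \<Psi> \<gamma> \<beta>) (- 1) = (poly \<Phi> (- 1) + poly \<Psi> (- 1)) * poly \<beta> (- 1)"
    by (simp add: y_poly_def poly_pcompose sgn v algebra_simps)
  then show "poly (y_poly q R \<Phi> \<Psi> \<gamma> \<beta>) (- 1) \<noteq> 0"
    using frobenius_values_neq_0[OF small t \<Phi> \<Psi>] string_top_nonzero[OF reg' \<beta>] by simp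
qed

end

context cyclic_p_group
begin

lemma gvec_Dspace:
  assumes F: "deg_lt n F" and "r' \<le> int r" "d + int n \<le> int s + r'"
  shows "gvec \<nu> d r' F \<in> Dspace G g \<nu> r s d"
proof -
  have "coeff F e *\<^sub>f tvec G g \<nu> (r' - int e) (d + 1 - r' + int e) \<in> Dspace G g \<nu> r s d" if "e < n" for e
  proof -
    have "tvec G g \<nu> (r' - int e) (d + 1 - r' + int e) \<in> (Dspace G g \<nu> r s d :: (nat \<times> nat \<Rightarrow> 'f) set)"
      by (rule Dspace_tvec) (use assms that in auto)
    then show ?thesis unfolding Dspace_def by (rule fspace.span_scale)
  qed
  then show ?thesis unfolding gvec_bound[OF F] Dspace_def by (intro fspace.span_sum) auto
qed

text \<open>One template for the four double sums in \<open>z\<close> and \<open>y\<close>;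
  \<open>w\<close> is the additional power of \<open>x\<close>, namely \<open>Q0 - R\<close>,
  \<open>0\<close>, \<open>0\<close> and \<open>R\<close>.\<close>

lemma gvec_double_sum:
  assumes "\<And>i j. i \<le> t \<Longrightarrow> j \<in> {1..n} \<Longrightarrow> I i j = r - int ((t - i) * Q + w + (n - j)) \<and> J i j = d + 1 - I i j"
  shows "(\<Sum>i = 0..t. \<alpha> i *\<^sub>f (\<Sum>j = 1..n. c j *\<^sub>f tvec G g \<nu> (I i j) (J i j))) =
    gvec \<nu> d r (monom 1 w * (frob Q (rev_poly t \<alpha>) * (\<Sum>j = 1..n. monom (c j) (n - j))))"
proof -
  have "monom 1 w * (frob Q (rev_poly t \<alpha>) * (\<Sum>j = 1..n. monom (c j) (n - j))) =
      (\<Sum>i\<le>t. \<Sum>j = 1..n. monom (\<alpha> i * c j) ((t - i) * Q + w + (n - j)))"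
    unfolding rev_poly_def
    by (simp add: pcompose_sum frob_monom sum_product sum_distrib_left mult_monom mult.commute add_ac)
  then have "gvec \<nu> d r (monom 1 w * (frob Q (rev_poly t \<alpha>) * (\<Sum>j = 1..n. monom (c j) (n - j)))) =
      (\<Sum>i\<le>t. \<Sum>j = 1..n. (\<alpha> i * c j) *\<^sub>f
        tvec G g \<nu> (r - int ((t - i) * Q + w + (n - j))) (d + 1 - r + int ((t - i) * Q + w + (n - j))))"
    by (simp only: gvec_sum gvec_monom)
  also have "\<dots> = (\<Sum>i = 0..t. \<Sum>j = 1..n. (\<alpha> i * c j) *\<^sub>f tvec G g \<nu> (I i j) (J i j))"
    unfolding atMost_atLeast0
  proof (rule sum.cong[OF refl], rule sum.cong[OF refl])
    fix i j assume "i \<in> {0..t}" "j \<in> {1..n}"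
    then have "I i j = r - int ((t - i) * Q + w + (n - j))" "J i j = d + 1 - r + int ((t - i) * Q + w + (n - j))"
      using assms[of i j] by auto
    then show "(\<alpha> i * c j) *\<^sub>f
        tvec G g \<nu> (r - int ((t - i) * Q + w + (n - j))) (d + 1 - r + int ((t - i) * Q + w + (n - j))) =
        (\<alpha> i * c j) *\<^sub>f tvec G g \<nu> (I i j) (J i j)" by simp
  qed
  finally show ?thesis by (simp only: fspace.scale_sum_right fspace.scale_scale)
qed

text \<open>\<open>Suc k\<close> is the first index of its block, so the coefficients are those of
  the string itself; injectivity at the top of the string is the uniqueness behind
  \<open>THE\<close>.\<close>

lemma Jcoeffs_string:
  assumes rs: "1 \<le> r" "r \<le> q" "1 \<le> s" "s \<le> q"
    and reg: "regular TYPE('f) r s k" and F: "string r s k b (F :: 'f poly)"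
  shows "Jcoeffs G g \<nu> r s (Suc k) = (\<lambda>j. if j \<in> {1..Suc k} then coeff F (Suc k - j) else 0)"
proof -
  define N where "N = r + s - k - b - 1"
  have bounds: "k < b" "b \<le> r" "b \<le> s" using F by (auto simp: string_def)
  have dF: "deg_lt (Suc k) F" and xF: "alt_on r b 1 (T1 ^ N * F)" using F by (auto simp: string_def N_def)
  have lam: "part (parts_of G g (Vtensor G g r s :: ('g, nat \<times> nat \<Rightarrow> 'f) fgmod)) (Suc k) = Suc N"
    unfolding parts_of_Vtensor[OF rs]
    using part_parts[of "Suc k" r s] lo_hi_string[OF reg F, of "Suc k"] bounds
    by (simp add: jordan_part_def N_def)
  define pc where "pc c = (\<Sum>j = 1..Suc k. monom (c j) (Suc k - j))" for c :: "nat \<Rightarrow> 'f"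
  have coeff_pc: "coeff (pc c) i = (if i < Suc k then c (Suc k - i) else 0)" for c i
  proof -
    have "coeff (pc c) i = (\<Sum>j = 1..Suc k. if j = Suc k - i then if i < Suc k then c (Suc k - i) else 0 else 0)"
      unfolding pc_def coeff_sum by (intro sum.cong refl) (auto simp: coeff_monom)
    then show ?thesis by (auto simp: sum.delta)
  qed
  have dpc: "deg_lt (Suc k) (pc c)" for c by (simp add: deg_lt_def coeff_pc)
  have sum_eq: "(\<Sum>j = 1..Suc k. c j *\<^sub>f tvec G g \<nu> (int r - int (Suc k) + int j) (int s + 1 - int j)) =
      gvec \<nu> (int (r + s - Suc k)) (int r) (pc c)" for c
    unfolding pc_def gvec_sum
  proof (rule sum.cong[OF refl])
    fix j assume "j \<in> {1..Suc k}"
    then have "int r - int (Suc k - j) = int r - int (Suc k) + int j"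
      "int (r + s - Suc k) + 1 - int r + int (Suc k - j) = int s + 1 - int j" using bounds by auto
    then show "c j *\<^sub>f tvec G g \<nu> (int r - int (Suc k) + int j) (int s + 1 - int j) =
        gvec \<nu> (int (r + s - Suc k)) (int r) (monom (c j) (Suc k - j))"
      by (simp only: gvec_monom)
  qed
  have pow: "(gm1 G g ^^ N) (gvec \<nu> (int (r + s - Suc k)) (int r) H) = gvec \<nu> (int b) (int r) (T1 ^ N * H)"
    if "deg_lt (Suc k) H" for H
  proof -
    have "int (r + s - Suc k) - int N = int b" using bounds by (auto simp: N_def)
    then show ?thesis using gm1_funpow_gvec[OF that, of "int r" "int (r + s - Suc k)" N \<nu>] rs bounds by auto
  qed
  have x: "xvec G g \<nu> (int r + int s + 1 - int (Suc k) - int (Suc N)) = gvec \<nu> (int b) (int r) (T1 ^ N * F)"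
  proof -
    have "int r + int s + 1 - int (Suc k) - int (Suc N) = int b" using bounds by (auto simp: N_def)
    then show ?thesis using gvec_alt[OF xF, of \<nu>] bounds by simp
  qed
  have iff: "(gm1 G g ^^ N) (gvec \<nu> (int (r + s - Suc k)) (int r) (pc c)) = gvec \<nu> (int b) (int r) (T1 ^ N * F) \<longleftrightarrow> pc c = F" for c
  proof
    assume "(gm1 G g ^^ N) (gvec \<nu> (int (r + s - Suc k)) (int r) (pc c)) = gvec \<nu> (int b) (int r) (T1 ^ N * F)"
    then have 0: "gvec \<nu> (int b) (int r) (T1 ^ N * (pc c - F)) = 0"
      by (simp add: pow[OF dpc] right_diff_distrib gvec_diff)
    have d: "deg_lt (Suc k) (pc c - F)" by (intro deg_lt_diff dpc dF)
    have "alt_on r b 0 (T1 ^ N * (pc c - F))"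
      by (rule gvec_eq_0D[OF 0 deg_lt_T1_power[OF d order_refl]]) (use rs bounds in \<open>auto simp: N_def\<close>)
    then have "pc c - F = 0" unfolding N_def by (rule string_top_inj[OF reg F d])
    then show "pc c = F" by simp
  qed (simp add: pow dF)
  show ?thesis
    unfolding Jcoeffs_def lam Let_def sum_eq diff_Suc_1 x iff
  proof (rule the_equality)
    have "pc (\<lambda>j. if j \<in> {1..Suc k} then coeff F (Suc k - j) else 0) = F"
      using dF by (intro poly_eqI) (auto simp: coeff_pc deg_lt_def)
    then show "(\<forall>j. j \<notin> {1..Suc k} \<longrightarrow> (if j \<in> {1..Suc k} then coeff F (Suc k - j) else 0) = 0) \<and>
        pc (\<lambda>j. if j \<in> {1..Suc k} then coeff F (Suc k - j) else 0) = F" by auto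
    fix c assume c: "(\<forall>j. j \<notin> {1..Suc k} \<longrightarrow> c j = 0) \<and> pc c = F"
    show "c = (\<lambda>j. if j \<in> {1..Suc k} then coeff F (Suc k - j) else 0)"
    proof
      fix j
      show "c j = (if j \<in> {1..Suc k} then coeff F (Suc k - j) else 0)"
        using c coeff_pc[of c "Suc k - j"] by auto
    qed
  qed
qed

text \<open>A later row repeats the leading one up to sign, followed by zeros. In the polynomial
  these zeros are the low coefficients, that is a factor \<open>x^(l - Suc k)\<close>, so all rows
  of a block come from one generator.\<close>

lemma Jmat_string:
  assumes rs: "1 \<le> r" "r \<le> q" "1 \<le> s" "s \<le> q"
    and l: "0 < l" "l \<le> min r s" and k: "lo TYPE('f) r s l = k" and b: "hi TYPE('f) r s l = b"
    and F: "string r s k b (F :: 'f poly)"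
  shows "(\<Sum>j = 1..l. monom (ent (Jmat G g \<nu> r s) (l + 1 - j) j) (l - j)) =
    smult ((- 1) ^ (l - Suc k)) (monom 1 (l - Suc k) * F)"
proof -
  have reg: "regular TYPE('f) r s k" using regular_lo[OF l(1), of "TYPE('f)" r s] by (simp add: k)
  have bounds: "k < l" "l \<le> b" "b \<le> r" "b \<le> s"
    using lo_less[OF l(1), of "TYPE('f)" r s] le_hi[OF l(2), of "TYPE('f)"] F by (auto simp: k b string_def)
  have "{i' \<in> {1..min r s}. part (parts r s) i' = part (parts r s) l} = {Suc k..b}"
  proof -
    have "part (parts r s) i' = part (parts r s) l \<longleftrightarrow> k < i' \<and> i' \<le> b" if "i' \<in> {1..min r s}" for i'
    proof -
      have "0 < i'" "i' \<le> min r s" "l \<in> {1..min r s}" using that l by auto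
      then show ?thesis
        using jordan_part_eq_iff[OF l, of i' "TYPE('f)"] by (simp only: part_parts that k b)
    qed
    then have "{i' \<in> {1..min r s}. part (parts r s) i' = part (parts r s) l} =
        {i' \<in> {1..min r s}. k < i' \<and> i' \<le> b}" by blast
    also have "\<dots> = {Suc k..b}" using bounds by auto
    finally show ?thesis .
  qed
  then have min: "Min {i' \<in> {1..min r s}. part (parts r s) i' = part (parts r s) l} = Suc k"
    using bounds by (simp only:) (rule Min_eqI, auto)
  have ent: "ent (Jmat G g \<nu> r s) (l + 1 - j) j =
      (if j \<le> Suc k then (- 1) ^ (l - Suc k) * coeff F (Suc k - j) else 0)" if j: "j \<in> {1..l}" for j
  proof -
    have i: "l + 1 - j + j - 1 = l" "l - j < r" "j - 1 < s" "l + 1 - j - 1 + 1 = l + 1 - j" "j - 1 + 1 = j"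
      using j bounds by auto
    have "ent (Jmat G g \<nu> r s) (l + 1 - j) j =
      (if l = Suc k then Jcoeffs G g \<nu> r s l j
       else if j \<le> Suc k then (- 1) ^ (l - Suc k) * Jcoeffs G g \<nu> r s (Suc k) j else (0 :: 'f))"
    proof -
      have nl: "(min r s < l) = False" and dim: "l + 1 - j - 1 < r" using l bounds j by auto
      show ?thesis
        unfolding Jmat_def parts_of_Vtensor[OF rs] Let_def ent_def mat1_def index_mat(1)[OF dim i(3)]
        by (simp only: prod.case i(4,5) i(1) min nl if_False)
    qed
    also have "\<dots> = (if j \<le> Suc k then (- 1) ^ (l - Suc k) * Jcoeffs G g \<nu> r s (Suc k) j else (0 :: 'f))"
      using j by auto
    finally show ?thesis using j by (simp add: Jcoeffs_string[OF rs reg F])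
  qed
  show ?thesis
  proof (rule poly_eqI)
    fix i
    have "coeff (\<Sum>j = 1..l. monom (ent (Jmat G g \<nu> r s) (l + 1 - j) j) (l - j)) i =
      (\<Sum>j = 1..l. if j = l - i then if i < l then ent (Jmat G g \<nu> r s) (l + 1 - (l - i)) (l - i) else (0 :: 'f) else 0)"
      unfolding coeff_sum by (intro sum.cong refl) (auto simp: coeff_monom)
    also have "\<dots> = (if i < l then ent (Jmat G g \<nu> r s) (l + 1 - (l - i)) (l - i) else 0)"
      by (auto simp: sum.delta)
    also have "\<dots> = coeff (smult ((- 1) ^ (l - Suc k)) (monom 1 (l - Suc k) * F)) i"
    proof (cases "i < l")
      case True
      have "l - i \<le> Suc k \<longleftrightarrow> l - Suc k \<le> i" "l - i \<le> Suc k \<Longrightarrow> Suc k - (l - i) = i - (l - Suc k)"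
        using True bounds by auto
      then show ?thesis using True ent[of "l - i"] by (auto simp: coeff_monom_mult')
    next
      case False
      then have "coeff F (i - (l - Suc k)) = 0" using F bounds by (auto simp: string_def deg_lt_def)
      then show ?thesis using False by (simp add: coeff_monom_mult')
    qed
    finally show "coeff (\<Sum>j = 1..l. monom (ent (Jmat G g \<nu> r s) (l + 1 - j) j) (l - j)) i =
      coeff (smult ((- 1) ^ (l - Suc k)) (monom 1 (l - Suc k) * F)) i" .
  qed
qed

end

section \<open>The main theorem\<close>

theorem proposition6:
  fixes G :: "('g, 'b) monoid_scheme" and g :: 'g
    and p a q r s n rn R sn S m M t k l \<mu>k k0 kinf :: nat
    and e k' \<nu> :: int
    and lam mu :: "nat list"
    and C B P Q X \<zeta> \<eta> :: "'f::field mat"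
    and z y :: "nat \<times> nat \<Rightarrow> 'f"
  assumes "prime p" and "CHAR('f) = p"
    and "group G" and "g \<in> carrier G" and "subgroup_generated G {g} = G"
    and "a > 0" and "q = p ^ a" and "order G = q"
    and "r \<in> {1..q}" and "s \<in> {1..q}"
    and "decomposes_as G g (Vtensor G g r s :: ('g, nat \<times> nat \<Rightarrow> 'f) fgmod) lam"
    and "length lam = min r s"
    and "p ^ n \<le> max r s" and "max r s < p ^ (n + 1)"
    and "r = rn * p ^ n + R" and "rn < p" and "R < p ^ n"
    and "s = sn * p ^ n + S" and "sn < p" and "S < p ^ n"
    and "m = min R S" and "M = max R S" and "e = int m + int M - int p ^ n"
    and "m > 0"
    and "decomposes_as G g (Vtensor G g R S :: ('g, nat \<times> nat \<Rightarrow> 'f) fgmod) mu"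
    and "length mu = m"
    and "l = t * p ^ n + k" and "1 \<le> k" and "k \<le> p ^ n"
    and "max (int r + int s - int p ^ (n + 1)) 0 + 1 \<le> int l" and "l \<le> min r s"
    and "int t \<le> min (int rn - 1) (int sn - 1)"
    and "M + 1 \<le> k" and "int k \<le> int p ^ n - max (- e) 0"
    and "\<mu>k = part mu (m + M + 1 - k)"
    and "k0 = Min {i. M + 1 \<le> i \<and> int i \<le> int p ^ n - max (- e) 0 \<and> part mu (m + M + 1 - i) = \<mu>k}"
    and "kinf = Max {i. M + 1 \<le> i \<and> int i \<le> int p ^ n - max (- e) 0 \<and> part mu (m + M + 1 - i) = \<mu>k}"
    and "k' = int k0 + int kinf - int k"
    and "C = Jmat G g \<nu> R (p ^ n - S)"
    and "B = Jmat G g \<nu> (p ^ n - R) S"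
    and "z =
      (\<Sum>i = 0..t. (- 1) ^ i *\<^sub>f (\<Sum>j = 1..k - S. ent C (k - S + 1 - j) j *\<^sub>f
         tvec G g (int n) (int i * int p ^ n + int R + int S + int j - int k)
                          ((int t + 1 - int i) * int p ^ n + 1 - int j))) +
      (- 1) ^ R *\<^sub>f
      (\<Sum>i = 0..t. (- 1) ^ i *\<^sub>f (\<Sum>j = 1..k - R. ent B (k - R + 1 - j) j *\<^sub>f
         tvec G g (int n) ((int i + 1) * int p ^ n + int R + int j - int k)
                          ((int t - int i) * int p ^ n + int S + 1 - int j)))"
    and "P = mat1 (t + 1) (t + 1) (\<lambda>i j.
           binom (int rn + int sn - 2 * int t - 1) (int rn - int t + int j - int i))"
    and "Q = mat1 (t + 1) (t + 1) (\<lambda>i j.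
           binom (int rn + int sn - 2 * int t - 1) (int rn - int t + int j - int i - 1))"
    and "X = mat1 (t + 1) 1 (\<lambda>i j. (- 1) ^ (i - 1))"
    and "\<zeta> = the (mat_inverse P) * X"
    and "\<eta> = the (mat_inverse Q) * X"
    and "y =
      (\<Sum>i = 0..t. ent \<zeta> (i + 1) 1 *\<^sub>f (\<Sum>j = 1..k - S. ent C (k - S + 1 - j) j *\<^sub>f
         tvec G g (int n) ((int rn - int t + int i) * int p ^ n + int R + int S + int j - int k)
                          ((int sn - int i) * int p ^ n + 1 - int j))) +
      (- 1) ^ R *\<^sub>f
      (\<Sum>i = 0..t. ent \<eta> (i + 1) 1 *\<^sub>f (\<Sum>j = 1..k - R. ent B (k - R + 1 - j) j *\<^sub>f
         tvec G g (int n) ((int rn - int t + int i) * int p ^ n + int R + int j - int k)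
                          ((int sn - int i) * int p ^ n + int S + 1 - int j)))"
  shows "int (part lam l) = (int rn + int sn - 2 * int t) * int p ^ n - int \<mu>k \<and>
      (gm1 G g ^^ ((rn + sn - 2 * t - 1) * p ^ n)) `
           (Dspace G g (int n) r s ((int rn + int sn - int t) * int p ^ n + int R + int S - int k)
             :: (nat \<times> nat \<Rightarrow> 'f) set)
         \<subseteq> Dspace G g (int n) r s ((int t + 1) * int p ^ n + int R + int S - int k) \<and>
      \<mu>k < p ^ n \<and>
      int p ^ n - int \<mu>k - 1 = int p ^ n + int m + int M - int k0 - int kinf \<and>
      (gm1 G g ^^ (p ^ n - \<mu>k - 1)) `
           (Dspace G g (int n) r s ((int t + 1) * int p ^ n + int R + int S - int k)
             :: (nat \<times> nat \<Rightarrow> 'f) set)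
         \<subseteq> Dspace G g (int n) r s (int t * int p ^ n + k') \<and>
      z \<in> Dspace G g (int n) r s ((int t + 1) * int p ^ n + int R + int S - int k) \<and>
      (gm1 G g ^^ (p ^ n - \<mu>k - 1)) z = xvec G g (int n) (int t * int p ^ n + k') \<and>
      invertible_mat P \<and> invertible_mat Q \<and>
      y \<in> Dspace G g (int n) r s ((int rn + int sn - int t) * int p ^ n + int R + int S - int k) \<and>
      (gm1 G g ^^ ((rn + sn - 2 * t - 1) * p ^ n)) y = z"
proof -
  interpret cyclic_p_group G g p a "TYPE('f)"
    by (rule cyclic_p_group.intro) (use assms(1-8) in auto)
  define Q0 where "Q0 = p ^ n"
  note r_def = assms(15)[folded Q0_def] and s_def = assms(18)[folded Q0_def]
  note l_def = assms(27)[folded Q0_def]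
  have frob: "(T1 :: 'f poly) ^ Q0 = 1 + monom 1 Q0"
    unfolding Q0_def by (rule T1_power_char_power[OF assms(1,2)])
  have sgn: "(- 1 :: 'f) ^ Q0 = - 1"
    unfolding Q0_def by (rule minus_one_power_char_power[OF assms(1,2)])
  have qG: "order G = q" using assms(8) .
  have RS: "R < Q0" "S < Q0" using assms(17,20) by (simp_all add: Q0_def)
  have mM: "m + M = R + S" "0 < R" "0 < S" "R \<le> M" "S \<le> M" "m \<le> R" "m \<le> S"
    using assms(21,22,24) by auto
  have rs: "1 \<le> r" "r \<le> order G" "1 \<le> s" "s \<le> order G" "Q0 \<le> order G"
    using assms(9,10,13) qG by (auto simp: Q0_def)
  have t: "t < rn" "t < sn" using assms(32) by auto
  have int_Q0: "int p ^ n = int Q0" by (simp add: Q0_def)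
  \<comment> \<open>\<open>p ^ n - max (- e) 0\<close> is the smaller of \<open>p ^ n\<close> and
    \<open>R + S\<close>, so \<open>k\<close> is bounded by both.\<close>
  have "0 \<le> max (- e) 0" "- e \<le> max (- e) 0" by auto
  then have k: "R < k" "S < k" "k \<le> Q0" "k \<le> R + S"
    using assms(33,34) mM unfolding assms(23) int_Q0 by linarith+
  \<comment> \<open>With \<open>k <= R + S\<close> the lower bound on \<open>l\<close> turns into
    the degree restriction of \<open>regular_small\<close> for the leading digits.\<close>
  have small: "rn + sn < p + t"
  proof -
    have "int r + int s - int (p * Q0) + 1 \<le> int l"
      using assms(30) by (simp add: Q0_def)
    then have "r + s + 1 \<le> p * Q0 + l" by linarith
    then have "(rn + sn) * Q0 < (p + t) * Q0"
      using k unfolding r_def s_def l_def by (simp add: algebra_simps)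
    then show ?thesis by (metis mult_less_cancel2)
  qed
  \<comment> \<open>\<open>\<mu>k\<close> is the part of index \<open>R + S + 1 - k\<close>; the two
    reflections of this index are the row numbers \<open>k - S\<close> of \<open>C\<close> and
    \<open>k - R\<close> of \<open>B\<close>.\<close>
  define ls where "ls = R + S + 1 - k"
  have ls: "0 < ls" "ls \<le> min R S" "R + S - Q0 < ls" using k mM assms(33) by (auto simp: ls_def assms(21,22))
  define a0 b0 where "a0 = lo TYPE('f) R S ls" and "b0 = hi TYPE('f) R S ls"
  have RS': "R \<le> Q0" "S \<le> Q0" using RS by auto
  note tr = lo_hi_transfer[OF frob RS' ls(3,2), folded a0_def b0_def]
  have ab: "a0 < b0" "b0 \<le> R" "b0 \<le> S" "R + S \<le> Q0 + a0" "a0 < ls" "ls \<le> b0"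
    using lo_less[OF ls(1), of "TYPE('f)" R S] le_hi[OF ls(2), of "TYPE('f)"] hi_le[OF ls(2), of "TYPE('f)"] tr(5)
    by (auto simp: a0_def b0_def)
  have mu: "mu = parts R S"
    using assms(25) decomposes_as_Vtensor_iff[of R S mu] mM RS rs by auto
  have lam: "lam = parts r s"
    using assms(11) decomposes_as_Vtensor_iff[of r s lam] rs by auto
  have muk: "\<mu>k = R + S - a0 - b0"
    unfolding assms(35) mu mM(1) ls_def[symmetric] using part_parts[of ls R S] ls
    by (simp add: jordan_part_def a0_def b0_def)
  have mu_part: "part mu (m + M + 1 - i) = \<mu>k \<longleftrightarrow> a0 < R + S + 1 - i \<and> R + S + 1 - i \<le> b0"
    if "M + 1 \<le> i" "i \<le> R + S" for i
  proof -
    have i: "0 < R + S + 1 - i" "R + S + 1 - i \<le> min R S" "R + S + 1 - i \<in> {1..min R S}"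
      using that mM assms(21,22) by auto
    have "part mu (m + M + 1 - i) = jordan_part TYPE('f) R S (R + S + 1 - i)"
      unfolding mu mM(1) by (rule part_parts[OF i(3)])
    moreover have "\<mu>k = jordan_part TYPE('f) R S ls" by (simp add: muk jordan_part_def a0_def b0_def)
    ultimately show ?thesis
      using jordan_part_eq_iff[OF ls(1,2) i(1,2), of "TYPE('f)"] by (simp only: a0_def b0_def)
  qed
  \<comment> \<open>The range conditions on \<open>i\<close> follow from the bounds on the block, so
    the set is the whole reflected block and its ends are \<open>k0\<close> and
    \<open>kinf\<close>.\<close>
  have "{i. M + 1 \<le> i \<and> int i \<le> int p ^ n - max (- e) 0 \<and> part mu (m + M + 1 - i) = \<mu>k} = {R + S + 1 - b0..R + S - a0}"
  proof -
    have "int i \<le> int p ^ n - max (- e) 0 \<longleftrightarrow> i \<le> Q0 \<and> i \<le> R + S" for i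
      unfolding assms(23) int_Q0 using mM(1) by (auto simp: max_def)
    then have "{i. M + 1 \<le> i \<and> int i \<le> int p ^ n - max (- e) 0 \<and> part mu (m + M + 1 - i) = \<mu>k} =
      {i. M + 1 \<le> i \<and> i \<le> Q0 \<and> i \<le> R + S \<and> a0 < R + S + 1 - i \<and> R + S + 1 - i \<le> b0}"
      using mu_part by auto
    also have "\<dots> = {R + S + 1 - b0..R + S - a0}" using ab mM assms(21,22) by auto
    finally show ?thesis .
  qed
  then have k0: "k0 = R + S + 1 - b0" and kinf: "kinf = R + S - a0"
    unfolding assms(36,37) using ab by (simp_all only:) (rule Min_eqI Max_eqI; auto)+
  \<comment> \<open>Offset of \<open>k\<close> in its block; the target \<open>k'\<close> is then
    \<open>kinf - d\<close>.\<close>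
  define d where "d = k - k0"
  have d: "d + a0 < b0" "k = k0 + d" using k ab by (auto simp: d_def k0 ls_def)
  have k': "k' = int (R + S - a0 - d)" unfolding assms(38) using ab d(1) by (simp add: k0 kinf d(2))
  have lsR: "Suc R - ls = k - S" "Suc S - ls = k - R" using k by (auto simp: ls_def)
  have loC: "lo TYPE('f) R (Q0 - S) (k - S) = R - b0" "hi TYPE('f) R (Q0 - S) (k - S) = R - a0"
    and loB: "lo TYPE('f) (Q0 - R) S (k - R) = S - b0" "hi TYPE('f) (Q0 - R) S (k - R) = S - a0"
    using tr lsR by auto
  have kC: "0 < k - S" "k - S \<le> min R (Q0 - S)" and kB: "0 < k - R" "k - R \<le> min (Q0 - R) S"
    using k by auto
  obtain \<gamma> :: "'f poly" where \<gamma>: "string R (Q0 - S) (R - b0) (R - a0) \<gamma>"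
    using string_at[OF kC, where 'f = 'f] unfolding loC by metis
  obtain \<beta> :: "'f poly" where \<beta>: "string (Q0 - R) S (S - b0) (S - a0) \<beta>"
    using string_at[OF kB, where 'f = 'f] unfolding loB by metis
  have reg: "regular TYPE('f) R (Q0 - S) (R - b0)" "regular TYPE('f) (Q0 - R) S (S - b0)"
    using regular_lo[OF kC(1), of "TYPE('f)" R "Q0 - S"] regular_lo[OF kB(1), of "TYPE('f)" "Q0 - R" S]
    by (simp_all add: loC loB)
  define Cp where "Cp = smult ((- 1) ^ d) (monom 1 d * \<gamma>)"
  define Bp where "Bp = smult ((- 1) ^ d) (monom 1 d * \<beta>)"
  have Cp: "(\<Sum>j = 1..k - S. monom (ent C (k - S + 1 - j) j) (k - S - j)) = Cp"
  proof -
    have "k - S - Suc (R - b0) = d" using ab k by (simp add: d_def k0)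
    then show ?thesis unfolding assms(39) Cp_def Q0_def[symmetric]
      using Jmat_string[OF _ _ _ _ kC loC \<gamma>, of \<nu>] mM RS rs by simp
  qed
  have Bp: "(\<Sum>j = 1..k - R. monom (ent B (k - R + 1 - j) j) (k - R - j)) = Bp"
  proof -
    have "k - R - Suc (S - b0) = d" using ab k by (simp add: d_def k0)
    then show ?thesis unfolding assms(40) Bp_def Q0_def[symmetric]
      using Jmat_string[OF _ _ _ _ kB loB \<beta>, of \<nu>] mM RS rs by simp
  qed
  have dC: "deg_lt (k - S) Cp"
    unfolding Cp_def using \<gamma> ab k d by (intro deg_lt_smult deg_lt_monom[where a = "Suc (R - b0)"]) (auto simp: string_def k0)
  have dB: "deg_lt (k - R) Bp"
    unfolding Bp_def using \<beta> ab k d by (intro deg_lt_smult deg_lt_monom[where a = "Suc (S - b0)"]) (auto simp: string_def k0)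
  define c where "c = rn + sn - 2 * t - 1"
  obtain e1 where rn: "rn = Suc t + e1" using t less_imp_Suc_add by (metis add_Suc)
  obtain e2 where sn: "sn = Suc t + e2" using t less_imp_Suc_add by (metis add_Suc)
  have c: "c = e1 + e2 + 1" by (simp add: c_def rn sn)
  have p: "prime p" "CHAR('f) = p" by (fact assms(1,2))+
  \<comment> \<open>The first two facts give invertibility of \<open>P\<close> and \<open>Q\<close>,
    the last two the nonvanishing of \<open>y_poly\<close> at -1.\<close>
  have regs: "regular TYPE('f) (Suc rn) sn (Suc t)" "regular TYPE('f) rn (Suc sn) (Suc t)"
    "regular TYPE('f) (Suc rn) (Suc sn) (Suc t)" "regular TYPE('f) rn sn t"
    using t small by (auto intro!: regular_small[OF p])
  \<comment> \<open>Written with \<open>(rn + 1) - 1 - t\<close>, the index of \<open>P\<close> is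
    that of the system for \<open>(rn + 1, sn)\<close>; \<open>Q\<close> belongs to
    \<open>(rn, sn + 1)\<close>.\<close>
  have P': "P = mat1 (t + 1) (t + 1) (\<lambda>i j. binom (int c) (int (Suc rn) - 1 - int t + int j - int i))"
    and Q': "Q = mat1 (t + 1) (t + 1) (\<lambda>i j. binom (int c) (int rn - 1 - int t + int j - int i))"
    unfolding assms(42,43) by (simp_all add: c rn sn algebra_simps)
  have cP: "c = Suc rn + sn - 2 * Suc t" and cQ: "c = rn + Suc sn - 2 * Suc t" by (simp_all add: c rn sn)
  have tP: "t < Suc rn" "t < Suc sn" using t by auto
  define \<Phi> where "\<Phi> = rev_poly t (\<lambda>i. ent \<zeta> (i + 1) 1)"
  define \<Psi> where "\<Psi> = rev_poly t (\<lambda>i. ent \<eta> (i + 1) 1)"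
  note toeP = toeplitz_system[OF regs(1) tP(1) t(2) cP P' assms(44)]
    and toeQ = toeplitz_system[OF regs(2) t(1) tP(2) cQ Q' assms(44)]
  have x\<Phi>: "alt_on (Suc rn) (Suc t) 1 (T1 ^ c * \<Phi>)"
    unfolding \<Phi>_def assms(45) by (rule toeP(2))
  have x\<Psi>: "alt_on rn (Suc t) 1 (T1 ^ c * \<Psi>)"
    unfolding \<Psi>_def assms(46) by (rule toeQ(2))
  have d\<Phi>: "deg_lt (Suc t) \<Phi>" and d\<Psi>: "deg_lt (Suc t) \<Psi>"
    unfolding \<Phi>_def \<Psi>_def by (rule deg_lt_rev_poly)+

  define dz where "dz = Suc t * Q0 + R + S - k"
  define dy where "dy = (rn + sn - t) * Q0 + R + S - k"
  have dz: "int dz = (int t + 1) * int p ^ n + int R + int S - int k"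
    unfolding int_Q0 using k by (simp add: dz_def of_nat_diff algebra_simps)
  have dy: "int dy = (int rn + int sn - int t) * int p ^ n + int R + int S - int k"
    unfolding int_Q0 using k by (simp add: dy_def rn sn of_nat_diff algebra_simps)
  define N where "N = Q0 - \<mu>k - 1"
  have dyz: "int dy - int (c * Q0) = int dz"
    using k by (simp add: dy_def dz_def c rn sn of_nat_diff algebra_simps)
  have dzx: "int dz - int N = int t * int p ^ n + k'"
    unfolding int_Q0 k' dz_def N_def using k ab d by (simp add: muk k0 of_nat_diff algebra_simps)
  \<comment> \<open>The base \<open>Suc t * Q0\<close> is independent of \<open>r\<close> and
    \<open>s\<close>, just as the formula for \<open>z\<close> involves only \<open>t\<close>,
    \<open>R\<close>, \<open>S\<close>, \<open>k\<close> and the rows of \<open>C\<close> and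
    \<open>B\<close>.\<close>
  have z: "z = gvec (int n) (int dz) (int (Suc t * Q0)) (z_poly Q0 R t Cp Bp)"
  proof -
    have "(\<Sum>i = 0..t. (- 1) ^ i *\<^sub>f (\<Sum>j = 1..k - S. ent C (k - S + 1 - j) j *\<^sub>f
         tvec G g (int n) (int i * int p ^ n + int R + int S + int j - int k)
                          ((int t + 1 - int i) * int p ^ n + 1 - int j))) =
      gvec (int n) (int dz) (int (Suc t * Q0)) (monom 1 (Q0 - R) * (frob Q0 (rev_poly t (\<lambda>i. (- 1) ^ i)) * Cp))"
      unfolding Cp[symmetric] dz int_Q0
    proof (rule gvec_double_sum)
      fix i j assume ij: "i \<le> t" "j \<in> {1..k - S}"
      have ar: "int (t - i) = int t - int i" "int (k - S - j) = int k - int S - int j" "int (Q0 - R) = int Q0 - int R"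
        using ij k RS by auto
      have "int ((t - i) * Q0 + (Q0 - R) + (k - S - j)) = (int t - int i) * int Q0 + int Q0 - int R + int k - int S - int j"
        unfolding of_nat_add of_nat_mult ar by simp
      then show "int i * int Q0 + int R + int S + int j - int k =
          int (Suc t * Q0) - int ((t - i) * Q0 + (Q0 - R) + (k - S - j)) \<and>
        (int t + 1 - int i) * int Q0 + 1 - int j =
          (int t + 1) * int Q0 + int R + int S - int k + 1 - (int i * int Q0 + int R + int S + int j - int k)"
        by (simp add: algebra_simps)
    qed
    moreover have "(\<Sum>i = 0..t. (- 1) ^ i *\<^sub>f (\<Sum>j = 1..k - R. ent B (k - R + 1 - j) j *\<^sub>f
         tvec G g (int n) ((int i + 1) * int p ^ n + int R + int j - int k)
                          ((int t - int i) * int p ^ n + int S + 1 - int j))) =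
      gvec (int n) (int dz) (int (Suc t * Q0)) (monom 1 0 * (frob Q0 (rev_poly t (\<lambda>i. (- 1) ^ i)) * Bp))"
      unfolding Bp[symmetric] dz int_Q0
    proof (rule gvec_double_sum)
      fix i j assume ij: "i \<le> t" "j \<in> {1..k - R}"
      have ar: "int (t - i) = int t - int i" "int (k - R - j) = int k - int R - int j"
        using ij k RS by auto
      have "int ((t - i) * Q0 + 0 + (k - R - j)) = (int t - int i) * int Q0 + int k - int R - int j"
        unfolding of_nat_add of_nat_mult ar by simp
      then show "(int i + 1) * int Q0 + int R + int j - int k =
          int (Suc t * Q0) - int ((t - i) * Q0 + 0 + (k - R - j)) \<and>
        (int t - int i) * int Q0 + int S + 1 - int j =
          (int t + 1) * int Q0 + int R + int S - int k + 1 - ((int i + 1) * int Q0 + int R + int j - int k)"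
        by (simp add: algebra_simps)
    qed
    moreover have "z_poly Q0 R t Cp Bp = monom 1 (Q0 - R) * (frob Q0 (rev_poly t (\<lambda>i. (- 1) ^ i)) * Cp) +
        smult ((- 1) ^ R) (monom 1 0 * (frob Q0 (rev_poly t (\<lambda>i. (- 1) ^ i)) * Bp))"
      by (simp add: z_poly_def alt_poly_def rev_poly_def algebra_simps flip: one_pCons)
    ultimately show ?thesis unfolding assms(41) by (simp only: gvec_add gvec_smult)
  qed
  have y: "y = gvec (int n) (int dy) (int r) (y_poly Q0 R \<Phi> \<Psi> Cp Bp)"
  proof -
    have "(\<Sum>i = 0..t. ent \<zeta> (i + 1) 1 *\<^sub>f (\<Sum>j = 1..k - S. ent C (k - S + 1 - j) j *\<^sub>f
         tvec G g (int n) ((int rn - int t + int i) * int p ^ n + int R + int S + int j - int k)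
                          ((int sn - int i) * int p ^ n + 1 - int j))) =
      gvec (int n) (int dy) (int r) (monom 1 0 * (frob Q0 \<Phi> * Cp))"
      unfolding Cp[symmetric] dy int_Q0 \<Phi>_def
    proof (rule gvec_double_sum)
      fix i j assume ij: "i \<le> t" "j \<in> {1..k - S}"
      have ar: "int (t - i) = int t - int i" "int (k - S - j) = int k - int S - int j"
        using ij k RS by auto
      have "int ((t - i) * Q0 + 0 + (k - S - j)) = (int t - int i) * int Q0 + int k - int S - int j"
        unfolding of_nat_add of_nat_mult ar by simp
      then show "(int rn - int t + int i) * int Q0 + int R + int S + int j - int k =
          int r - int ((t - i) * Q0 + 0 + (k - S - j)) \<and>
        (int sn - int i) * int Q0 + 1 - int j =
          (int rn + int sn - int t) * int Q0 + int R + int S - int k + 1 -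
          ((int rn - int t + int i) * int Q0 + int R + int S + int j - int k)"
        by (simp add: r_def algebra_simps)
    qed
    moreover have "(\<Sum>i = 0..t. ent \<eta> (i + 1) 1 *\<^sub>f (\<Sum>j = 1..k - R. ent B (k - R + 1 - j) j *\<^sub>f
         tvec G g (int n) ((int rn - int t + int i) * int p ^ n + int R + int j - int k)
                          ((int sn - int i) * int p ^ n + int S + 1 - int j))) =
      gvec (int n) (int dy) (int r) (monom 1 R * (frob Q0 \<Psi> * Bp))"
      unfolding Bp[symmetric] dy int_Q0 \<Psi>_def
    proof (rule gvec_double_sum)
      fix i j assume ij: "i \<le> t" "j \<in> {1..k - R}"
      have ar: "int (t - i) = int t - int i" "int (k - R - j) = int k - int R - int j"
        using ij k RS by auto
      have "int ((t - i) * Q0 + R + (k - R - j)) = (int t - int i) * int Q0 + int k - int j"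
        unfolding of_nat_add of_nat_mult ar by simp
      then show "(int rn - int t + int i) * int Q0 + int R + int j - int k =
          int r - int ((t - i) * Q0 + R + (k - R - j)) \<and>
        (int sn - int i) * int Q0 + int S + 1 - int j =
          (int rn + int sn - int t) * int Q0 + int R + int S - int k + 1 -
          ((int rn - int t + int i) * int Q0 + int R + int j - int k)"
        by (simp add: r_def algebra_simps)
    qed
    moreover have "y_poly Q0 R \<Phi> \<Psi> Cp Bp = monom 1 0 * (frob Q0 \<Phi> * Cp) + smult ((- 1) ^ R) (monom 1 R * (frob Q0 \<Psi> * Bp))"
      by (simp add: y_poly_def flip: one_pCons)
    ultimately show ?thesis unfolding assms(47) by (simp only: gvec_add gvec_smult)
  qed

  have dzp: "deg_lt (Suc t * Q0 + k - R - S) (z_poly Q0 R t Cp Bp)"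
    unfolding z_poly_def
    by (rule deg_lt_frob_mult[OF deg_lt_alt_poly, where e = "Q0 + k - R - S"])
      (use k RS in \<open>auto intro!: deg_lt_add deg_lt_smult deg_lt_monom[OF dC] deg_lt_mono[OF dB]\<close>)
  have dyp: "deg_lt (t * Q0 + k) (y_poly Q0 R \<Phi> \<Psi> Cp Bp)"
    unfolding y_poly_def
    by (intro deg_lt_add deg_lt_smult deg_lt_monom[where a = "t * Q0 + k - R"] deg_lt_frob_mult[OF d\<Phi> dC]
        deg_lt_frob_mult[OF d\<Psi> dB]) (use k in auto)
  have tQ: "Suc t * Q0 \<le> r" "Suc t * Q0 \<le> s" by (simp_all add: r_def s_def rn sn algebra_simps)
  have zdeg: "int dz + int (Suc t * Q0 + k - R - S) = int (Suc t * Q0) + int (Suc t * Q0)"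
    using k RS by (simp add: dz_def of_nat_diff)
  have ydeg: "int dy + int (t * Q0 + k) = int s + int r"
    using k by (simp add: dy_def r_def s_def rn sn of_nat_diff algebra_simps)

  have z_mem: "z \<in> Dspace G g (int n) r s (int dz)"
    unfolding z by (rule gvec_Dspace[OF dzp]) (use tQ zdeg in linarith)+
  have y_mem: "y \<in> Dspace G g (int n) r s (int dy)"
    unfolding y by (rule gvec_Dspace[OF dyp]) (use ydeg in linarith)+

  have z_eq: "(gm1 G g ^^ N) z = xvec G g (int n) (int t * int p ^ n + k')"
  proof -
    have "(gm1 G g ^^ N) z = gvec (int n) (int dz - int N) (int (Suc t * Q0)) (T1 ^ N * z_poly Q0 R t Cp Bp)"
      unfolding z by (rule gm1_funpow_gvec[OF dzp]) (use tQ zdeg rs in linarith)+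
    also have "int dz - int N = int (t * Q0 + (R + S - a0 - d))"
      unfolding dzx int_Q0 k' by simp
    also have "gvec (int n) \<dots> (int (Suc t * Q0)) (T1 ^ N * z_poly Q0 R t Cp Bp) = 1 *\<^sub>f xvec G g (int n) \<dots>"
    proof (rule gvec_alt)
      show "alt_on (Suc t * Q0) (t * Q0 + (R + S - a0 - d)) 1 (T1 ^ N * z_poly Q0 R t Cp Bp)"
        using z_poly_socle[OF frob sgn ab(1-4) RS reg \<beta> \<gamma> d(1), of t]
        unfolding N_def muk Cp_def Bp_def .
      show "t * Q0 + (R + S - a0 - d) \<le> Suc t * Q0" using ab by simp
    qed
    finally show ?thesis unfolding int_Q0 k' by simp
  qed

  have y_eq: "(gm1 G g ^^ (c * Q0)) y = z"
  proof -
    have "(gm1 G g ^^ (c * Q0)) y = gvec (int n) (int dz) (int r) (T1 ^ (c * Q0) * y_poly Q0 R \<Phi> \<Psi> Cp Bp)"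
      unfolding y dyz[symmetric] by (rule gm1_funpow_gvec[OF dyp]) (use ydeg rs in linarith)+
    \<comment> \<open>The two polynomials need not agree, but they differ only at exponents whose
      vectors are zero.\<close>
    also have "\<dots> = gvec (int n) (int dz) (int r) (monom 1 (r - Suc t * Q0) * z_poly Q0 R t Cp Bp)"
    proof -
      have "alt_on r (Suc t * Q0 + R + S - k) 0
        (T1 ^ (c * Q0) * y_poly Q0 R \<Phi> \<Psi> Cp Bp - monom 1 (r - Suc t * Q0) * z_poly Q0 R t Cp Bp)"
        by (rule y_poly_to_z_poly[OF frob dC dB RS k t(1) x\<Phi> x\<Psi> r_def])
      from gvec_alt_0[OF this, of "int n"] show ?thesis by (simp add: gvec_diff dz_def)
    qed
    also have "int r = int (Suc t * Q0) + int (r - Suc t * Q0)" using tQ by linarith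
    also have "gvec (int n) (int dz) \<dots> (monom 1 (r - Suc t * Q0) * z_poly Q0 R t Cp Bp) = z"
      unfolding z by (rule gvec_shift)
    finally show ?thesis .
  qed

  have lam_eq: "int (part lam l) = (int rn + int sn - 2 * int t) * int p ^ n - int \<mu>k"
  proof -
    \<comment> \<open>The size is read off from the unshifted \<open>\<gamma>\<close> and
      \<open>\<beta>\<close>, which describe the first index of the block; \<open>l\<close> lies in
      the same interval.\<close>
    have str: "string r s (t * Q0 + (R + S - b0)) (t * Q0 + (R + S - a0)) (y_poly Q0 R \<Phi> \<Psi> \<gamma> \<beta>)"
      and nz: "poly (y_poly Q0 R \<Phi> \<Psi> \<gamma> \<beta>) (- 1) \<noteq> 0"
      using y_poly_string[OF frob sgn ab(1-4) RS reg \<beta> \<gamma> t regs(3,4) d\<Phi> x\<Phi>[unfolded c_def] d\<Psi> x\<Psi>[unfolded c_def]]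
      unfolding r_def s_def by blast+
    have l: "t * Q0 + (R + S - b0) < l" "l \<le> t * Q0 + (R + S - a0)"
      using ab d by (auto simp: l_def k0)
    have "l \<in> {1..min r s}" using l str by (auto simp: string_def)
    then have "part lam l = r + s - (t * Q0 + (R + S - b0)) - (t * Q0 + (R + S - a0))"
      unfolding lam using part_parts[of l r s] jordan_part_string[OF str nz l] by simp
    then show ?thesis unfolding int_Q0 muk r_def s_def rn sn
      using ab by (simp add: of_nat_diff algebra_simps)
  qed

  have muk_less: "\<mu>k < p ^ n" using ab by (auto simp: muk simp flip: Q0_def)
  have len: "int p ^ n - int \<mu>k - 1 = int p ^ n + int m + int M - int k0 - int kinf"
    using ab mM(1) by (simp add: muk k0 kinf of_nat_diff)
  note im1 = gm1_funpow_Dspace[OF rs(2,4), of "c * Q0" "int n" "int dy", unfolded dyz, unfolded dy dz c_def Q0_def]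
    and im2 = gm1_funpow_Dspace[OF rs(2,4), of N "int n" "int dz", unfolded dzx, unfolded dz N_def Q0_def]
  show ?thesis
    by (intro conjI lam_eq im1 muk_less len im2 z_mem[unfolded dz] z_eq[unfolded N_def Q0_def] toeP(1) toeQ(1)
        y_mem[unfolded dy] y_eq[unfolded c_def Q0_def])
qed

end
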